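(* For every countable model $(M,\mathcal{X})\models\mathrm{B}\Sigma^0_2+\mathrm{WKL}_0$ there is a second-order structure $(K,\mathcal{X})$ which is a proper end extension of $(M,\mathcal{X})$, is $\Sigma^0_2$-elementary over $(M,\mathcal{X})$, and satisfies $\mathrm{B}\Sigma^0_1$.
   Context: $\mathrm{WKL}_0$ is $\mathrm{RCA}_0$ (Robinson arithmetic, $\Sigma^0_1$-induction, $\Delta^0_1$-comprehension) plus: every infinite binary tree has an infinite path. $\mathrm{B}\Sigma^0_k$ is the collection scheme for $\Sigma^0_k$ formulas (with first- and second-order parameters). In $(K,\mathcal{X})$ the second-order universe is indexed by the same collection $\mathcal{X}$: each $A\in\mathcal{X}$ is interpreted as a subset of $K$ whose intersection with $M$ is $A$. Second-order structures are viewed as two-sorted first-order structures; $(M,\mathcal{X})\preccurlyeq_{\Sigma^0_2}(K,\mathcal{X})$ means every $\Sigma^0_2$ formula with parameters from $(M,\mathcal{X})$ has the same truth value in both; an end extension means every element of $K\setminus M$ is above every element of $M$; proper means $K\neq M$. *)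

theory Defs
  imports Main "HOL-Library.Countable_Set"
begin

record ('a, 's) l2str =
  nums :: "'a set"
  zro  :: 'a
  uno  :: 'a
  pls  :: "'a \<Rightarrow> 'a \<Rightarrow> 'a"
  tms  :: "'a \<Rightarrow> 'a \<Rightarrow> 'a"
  lss  :: "'a \<Rightarrow> 'a \<Rightarrow> bool"
  sts  :: "'s set"
  mbr  :: "'a \<Rightarrow> 's \<Rightarrow> bool"

definition l2_wf :: "('a, 's) l2str \<Rightarrow> bool" where
  "l2_wf S \<longleftrightarrow> zro S \<in> nums S \<and> uno S \<in> nums S \<and>
     (\<forall>a\<in>nums S. \<forall>b\<in>nums S. pls S a b \<in> nums S \<and> tms S a b \<in> nums S)"

datatype tm = V nat | Zr | On | Pl tm tm | Tm tm tm

datatype fm =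
    Eq tm tm | Lt tm tm | In tm nat
  | Neg fm | Cj fm fm | Dj fm fm | Im fm fm
  | Ex nat fm | Al nat fm
  | BEx nat tm fm
  | BAl nat tm fm
  | SEx nat fm | SAl nat fm

primrec evt :: "('a, 's) l2str \<Rightarrow> tm \<Rightarrow> (nat \<Rightarrow> 'a) \<Rightarrow> 'a" where
  "evt S (V i) e = e i"
| "evt S Zr e = zro S"
| "evt S On e = uno S"
| "evt S (Pl t u) e = pls S (evt S t e) (evt S u e)"
| "evt S (Tm t u) e = tms S (evt S t e) (evt S u e)"

primrec sat :: "('a, 's) l2str \<Rightarrow> fm \<Rightarrow> (nat \<Rightarrow> 'a) \<Rightarrow> (nat \<Rightarrow> 's) \<Rightarrow> bool" where
  "sat S (Eq t u) e E = (evt S t e = evt S u e)"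
| "sat S (Lt t u) e E = lss S (evt S t e) (evt S u e)"
| "sat S (In t X) e E = mbr S (evt S t e) (E X)"
| "sat S (Neg \<phi>) e E = (\<not> sat S \<phi> e E)"
| "sat S (Cj \<phi> \<psi>) e E = (sat S \<phi> e E \<and> sat S \<psi> e E)"
| "sat S (Dj \<phi> \<psi>) e E = (sat S \<phi> e E \<or> sat S \<psi> e E)"
| "sat S (Im \<phi> \<psi>) e E = (sat S \<phi> e E \<longrightarrow> sat S \<psi> e E)"
| "sat S (Ex x \<phi>) e E = (\<exists>a\<in>nums S. sat S \<phi> (e(x := a)) E)"
| "sat S (Al x \<phi>) e E = (\<forall>a\<in>nums S. sat S \<phi> (e(x := a)) E)"
| "sat S (BEx x t \<phi>) e E =
     (\<exists>a\<in>nums S. lss S a (evt S t e) \<and> sat S \<phi> (e(x := a)) E)"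
| "sat S (BAl x t \<phi>) e E =
     (\<forall>a\<in>nums S. lss S a (evt S t e) \<longrightarrow> sat S \<phi> (e(x := a)) E)"
| "sat S (SEx X \<phi>) e E = (\<exists>A\<in>sts S. sat S \<phi> e (E(X := A)))"
| "sat S (SAl X \<phi>) e E = (\<forall>A\<in>sts S. sat S \<phi> e (E(X := A)))"

definition envs :: "('a, 's) l2str \<Rightarrow> (nat \<Rightarrow> 'a) \<Rightarrow> (nat \<Rightarrow> 's) \<Rightarrow> bool" where
  "envs S e E \<longleftrightarrow> (\<forall>i. e i \<in> nums S) \<and> (\<forall>i. E i \<in> sts S)"

primrec delta0 :: "fm \<Rightarrow> bool" where
  "delta0 (Eq t u) = True"
| "delta0 (Lt t u) = True"
| "delta0 (In t X) = True"
| "delta0 (Neg \<phi>) = delta0 \<phi>"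
| "delta0 (Cj \<phi> \<psi>) = (delta0 \<phi> \<and> delta0 \<psi>)"
| "delta0 (Dj \<phi> \<psi>) = (delta0 \<phi> \<and> delta0 \<psi>)"
| "delta0 (Im \<phi> \<psi>) = (delta0 \<phi> \<and> delta0 \<psi>)"
| "delta0 (Ex x \<phi>) = False"
| "delta0 (Al x \<phi>) = False"
| "delta0 (BEx x t \<phi>) = delta0 \<phi>"
| "delta0 (BAl x t \<phi>) = delta0 \<phi>"
| "delta0 (SEx X \<phi>) = False"
| "delta0 (SAl X \<phi>) = False"

inductive sigma_fm :: "nat \<Rightarrow> fm \<Rightarrow> bool" and pi_fm :: "nat \<Rightarrow> fm \<Rightarrow> bool" where
  s0: "delta0 \<phi> \<Longrightarrow> sigma_fm n \<phi>"
| p0: "delta0 \<phi> \<Longrightarrow> pi_fm n \<phi>"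
| sS: "pi_fm n \<phi> \<Longrightarrow> sigma_fm (Suc n) (Ex x \<phi>)"
| sB: "sigma_fm (Suc n) \<phi> \<Longrightarrow> sigma_fm (Suc n) (Ex x \<phi>)"
| pS: "sigma_fm n \<phi> \<Longrightarrow> pi_fm (Suc n) (Al x \<phi>)"
| pB: "pi_fm (Suc n) \<phi> \<Longrightarrow> pi_fm (Suc n) (Al x \<phi>)"

text \<open>Basic axioms (Robinson arithmetic with the order, as in Simpson's RCA_0).\<close>
definition basic_ax :: "('a, 's) l2str \<Rightarrow> bool" where
  "basic_ax S \<longleftrightarrow> (\<forall>m\<in>nums S. \<forall>n\<in>nums S.
      pls S n (uno S) \<noteq> zro S
    \<and> (pls S m (uno S) = pls S n (uno S) \<longrightarrow> m = n)
    \<and> pls S m (zro S) = m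
    \<and> pls S m (pls S n (uno S)) = pls S (pls S m n) (uno S)
    \<and> tms S m (zro S) = zro S
    \<and> tms S m (pls S n (uno S)) = pls S (tms S m n) m
    \<and> \<not> lss S m (zro S)
    \<and> (lss S m (pls S n (uno S)) \<longleftrightarrow> lss S m n \<or> m = n))"

definition ind_sigma1 :: "('a, 's) l2str \<Rightarrow> bool" where
  "ind_sigma1 S \<longleftrightarrow> (\<forall>\<phi> x e E. sigma_fm 1 \<phi> \<longrightarrow> envs S e E \<longrightarrow>
      (sat S \<phi> (e(x := zro S)) E \<and>
       (\<forall>a\<in>nums S. sat S \<phi> (e(x := a)) E \<longrightarrow> sat S \<phi> (e(x := pls S a (uno S))) E))
      \<longrightarrow> (\<forall>a\<in>nums S. sat S \<phi> (e(x := a)) E))"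

definition comp_delta1 :: "('a, 's) l2str \<Rightarrow> bool" where
  "comp_delta1 S \<longleftrightarrow> (\<forall>\<phi> \<psi> x e E. sigma_fm 1 \<phi> \<longrightarrow> pi_fm 1 \<psi> \<longrightarrow> envs S e E \<longrightarrow>
      (\<forall>a\<in>nums S. sat S \<phi> (e(x := a)) E \<longleftrightarrow> sat S \<psi> (e(x := a)) E)
      \<longrightarrow> (\<exists>A\<in>sts S. \<forall>a\<in>nums S. mbr S a A \<longleftrightarrow> sat S \<phi> (e(x := a)) E))"

definition BSigma :: "nat \<Rightarrow> ('a, 's) l2str \<Rightarrow> bool" where
  "BSigma k S \<longleftrightarrow> (\<forall>\<phi> x y e E. sigma_fm k \<phi> \<longrightarrow> x \<noteq> y \<longrightarrow> envs S e E \<longrightarrow>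
      (\<forall>a\<in>nums S.
        (\<forall>c\<in>nums S. lss S c a \<longrightarrow> (\<exists>d\<in>nums S. sat S \<phi> (e(x := c, y := d)) E))
        \<longrightarrow> (\<exists>b\<in>nums S. \<forall>c\<in>nums S. lss S c a \<longrightarrow>
               (\<exists>d\<in>nums S. lss S d b \<and> sat S \<phi> (e(x := c, y := d)) E))))"

definition RCA0 :: "('a, 's) l2str \<Rightarrow> bool" where
  "RCA0 S \<longleftrightarrow> l2_wf S \<and> basic_ax S \<and> ind_sigma1 S \<and> comp_delta1 S"

text \<open>Weak Koenig's Lemma.  Finite binary strings are coded by positive numbers in
 heap order: the empty string is 1, and the children of the node s are 2s (append 0)
 and 2s+1 (append 1).  A binary tree is a set of (positive) codes closed under taking
 the parent; it is infinite if it is unbounded; an infinite path is a subset of the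
 tree containing the root, closed under parents, and containing exactly one child of
 each of its elements.\<close>

definition bin_tree :: "('a, 's) l2str \<Rightarrow> 's \<Rightarrow> bool" where
  "bin_tree S T \<longleftrightarrow> (\<forall>s\<in>nums S. mbr S s T \<longrightarrow> s \<noteq> zro S) \<and>
     (\<forall>u\<in>nums S. u \<noteq> zro S \<longrightarrow>
        (mbr S (pls S u u) T \<or> mbr S (pls S (pls S u u) (uno S)) T) \<longrightarrow> mbr S u T)"

definition infinite_set :: "('a, 's) l2str \<Rightarrow> 's \<Rightarrow> bool" where
  "infinite_set S T \<longleftrightarrow> (\<forall>a\<in>nums S. \<exists>s\<in>nums S. mbr S s T \<and> lss S a s)"

definition is_path :: "('a, 's) l2str \<Rightarrow> 's \<Rightarrow> 's \<Rightarrow> bool" where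
  "is_path S T P \<longleftrightarrow> (\<forall>s\<in>nums S. mbr S s P \<longrightarrow> mbr S s T) \<and> mbr S (uno S) P \<and>
     (\<forall>s\<in>nums S. mbr S s P \<longrightarrow>
        (mbr S (pls S s s) P \<longleftrightarrow> \<not> mbr S (pls S (pls S s s) (uno S)) P)) \<and>
     (\<forall>u\<in>nums S. u \<noteq> zro S \<longrightarrow>
        (mbr S (pls S u u) P \<or> mbr S (pls S (pls S u u) (uno S)) P) \<longrightarrow> mbr S u P)"

definition WKL :: "('a, 's) l2str \<Rightarrow> bool" where
  "WKL S \<longleftrightarrow> (\<forall>T\<in>sts S. bin_tree S T \<and> infinite_set S T \<longrightarrow> (\<exists>P\<in>sts S. is_path S T P))"

definition WKL0 :: "('a, 's) l2str \<Rightarrow> bool" where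
  "WKL0 S \<longleftrightarrow> RCA0 S \<and> WKL S"

definition end_ext :: "('a, 's) l2str \<Rightarrow> ('b, 's) l2str \<Rightarrow> ('a \<Rightarrow> 'b) \<Rightarrow> bool" where
  "end_ext M K h \<longleftrightarrow>
     inj_on h (nums M) \<and> h ` nums M \<subseteq> nums K \<and>
     h (zro M) = zro K \<and> h (uno M) = uno K \<and>
     (\<forall>a\<in>nums M. \<forall>b\<in>nums M. h (pls M a b) = pls K (h a) (h b) \<and>
        h (tms M a b) = tms K (h a) (h b) \<and> (lss M a b \<longleftrightarrow> lss K (h a) (h b))) \<and>
     sts K = sts M \<and>
     (\<forall>a\<in>nums M. \<forall>A\<in>sts M. mbr K (h a) A \<longleftrightarrow> mbr M a A) \<and>
     (\<forall>c\<in>nums K - h ` nums M. \<forall>a\<in>nums M. lss K (h a) c)"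

definition sigma_elem :: "nat \<Rightarrow> ('a, 's) l2str \<Rightarrow> ('b, 's) l2str \<Rightarrow> ('a \<Rightarrow> 'b) \<Rightarrow> bool" where
  "sigma_elem n M K h \<longleftrightarrow> (\<forall>\<phi> e E. sigma_fm n \<phi> \<longrightarrow> envs M e E \<longrightarrow>
      (sat M \<phi> e E \<longleftrightarrow> sat K \<phi> (h \<circ> e) E))"

end

theory Submission
  imports Defs
begin

text \<open>The extension is an ultrapower \<open>K\<close> of \<open>M\<close> built from the total functions with
  \<open>\<Sigma>\<^sub>1\<close> graph (equivalently, the functions in the second-order part), modulo a sufficiently
  generic filter of unbounded \<open>\<Delta>\<^sub>1\<close> sets.  \<open>\<Sigma>\<^sub>1\<close> uniformization gives Los's theorem for
  \<open>\<Sigma>\<^sub>1\<close> formulas, and \<open>\<Sigma>\<^sub>2\<close>-elementarity follows for any such filter: a \<open>\<Pi>\<^sub>1\<close> property that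
  fails everywhere in \<open>M\<close> is refuted by a Skolem function, which is an element of \<open>K\<close>.
  \<open>B\<Sigma>\<^sub>2\<close> is the infinite pigeonhole principle: it lets the filter make every bounded function
  constant, so \<open>K\<close> is an end extension.
  For \<open>B\<Sigma>\<^sub>1\<close> in \<open>K\<close>, the filter decides the \<open>\<Sigma>\<^sub>1\<close> set of those \<open>i\<close> at which the hypothesis
  \<open>\<forall>c<a(i). \<exists>d. R i c d\<close> holds.  If it is large, collection in \<open>M\<close> yields a bounding function;
  otherwise weak Koenig's lemma selects a function \<open>c < a\<close> of counterexamples, which contradicts
  the hypothesis in \<open>K\<close>.\<close>

text \<open>The difficulty is that a choice function is an element of \<open>K\<close> only if its
  graph is \<open>\<Sigma>\<^sub>1\<close>. For a \<open>\<Sigma>\<^sub>1\<close> matrix such a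
  function always exists, so existential quantifiers pass through Los's theorem. For a
  \<open>\<Pi>\<^sub>1\<close> matrix it need not exist, but a choice below a given function can be
  made along a path of a binary tree. A failure of the collection hypothesis at an index is exactly
  such a bounded witness with a \<open>\<Pi>\<^sub>1\<close> property, and this is where weak
  Koenig's lemma enters. The members of the filter are decidable sets, yet the filter must decide
  \<open>\<Sigma>\<^sub>1\<close> sets; this is possible because every unbounded
  \<open>\<Sigma>\<^sub>1\<close> set has an unbounded decidable subset. Definability in
  \<open>M\<close> is handled through predicates on assignments. Formulas appear only where a scheme
  of \<open>M\<close> is applied, where predicates are counted, and where truth in \<open>K\<close>
  is computed.\<close>

subsection \<open>Isomorphic copies\<close>

text \<open>Used in both directions: \<open>M\<close> is copied to a type all of whose elements are
  numbers, and the extension, which is built on a function type, is copied back to the type of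
  \<open>M\<close>.\<close>

definition push :: "('b \<Rightarrow> 'c) \<Rightarrow> ('b, 's) l2str \<Rightarrow> ('c, 's) l2str" where
  "push j S = (let k = the_inv_into (nums S) j in
     \<lparr>nums = j ` nums S, zro = j (zro S), uno = j (uno S),
      pls = (\<lambda>a b. j (pls S (k a) (k b))), tms = (\<lambda>a b. j (tms S (k a) (k b))),
      lss = (\<lambda>a b. lss S (k a) (k b)), sts = sts S, mbr = (\<lambda>a A. mbr S (k a) A)\<rparr>)"

context
  fixes j :: "'b \<Rightarrow> 'c" and S :: "('b, 's) l2str"
  assumes inj: "inj_on j (nums S)" and wf: "l2_wf S"
begin

lemma push_simps [simp]:
  "nums (push j S) = j ` nums S" "zro (push j S) = j (zro S)" "uno (push j S) = j (uno S)"
  "sts (push j S) = sts S"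
  "a \<in> nums S \<Longrightarrow> b \<in> nums S \<Longrightarrow> pls (push j S) (j a) (j b) = j (pls S a b)"
  "a \<in> nums S \<Longrightarrow> b \<in> nums S \<Longrightarrow> tms (push j S) (j a) (j b) = j (tms S a b)"
  "a \<in> nums S \<Longrightarrow> b \<in> nums S \<Longrightarrow> lss (push j S) (j a) (j b) = lss S a b"
  "a \<in> nums S \<Longrightarrow> mbr (push j S) (j a) A = mbr S a A"
  using inj by (simp_all add: push_def Let_def the_inv_into_f_f)

lemma wf_simps [simp]:
  "zro S \<in> nums S" "uno S \<in> nums S"
  "a \<in> nums S \<Longrightarrow> b \<in> nums S \<Longrightarrow> pls S a b \<in> nums S"
  "a \<in> nums S \<Longrightarrow> b \<in> nums S \<Longrightarrow> tms S a b \<in> nums S"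
  using wf by (auto simp: l2_wf_def)

lemma push_eq [simp]: "a \<in> nums S \<Longrightarrow> b \<in> nums S \<Longrightarrow> j a = j b \<longleftrightarrow> a = b"
  using inj by (auto dest: inj_onD)

lemma evt_closed: "\<forall>i. e i \<in> nums S \<Longrightarrow> evt S t e \<in> nums S"
  by (induction t) auto

lemma evt_push: "\<forall>i. e i \<in> nums S \<Longrightarrow> evt (push j S) t (\<lambda>i. j (e i)) = j (evt S t e)"
  by (induction t) (auto simp: evt_closed)

lemma upd_push: "(\<lambda>i. j (e i))(x := j a) = (\<lambda>i. j ((e(x := a)) i))"
  by auto

lemma upd_closed: "\<forall>i. e i \<in> N \<Longrightarrow> a \<in> N \<Longrightarrow> (e(x := a)) i \<in> N"
  by auto

lemma sat_push:
  "\<forall>i. e i \<in> nums S \<Longrightarrow> sat (push j S) \<phi> (\<lambda>i. j (e i)) E = sat S \<phi> e E"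
  by (induction \<phi> arbitrary: e E)
    (simp_all add: evt_push evt_closed upd_push upd_closed del: fun_upd_apply cong: bex_cong ball_cong)

text \<open>Pulls an environment of the copy back to \<open>S\<close>, where the axiom schemes of
  \<open>S\<close> apply to it.\<close>

lemma envs_push:
  assumes "envs (push j S) e' E"
  obtains e where "e' = (\<lambda>i. j (e i))" "envs S e E" "\<forall>i. e i \<in> nums S"
proof -
  have "\<forall>i. \<exists>a. a \<in> nums S \<and> e' i = j a" and "\<forall>i. E i \<in> sts S"
    using assms by (auto simp: envs_def)
  then show ?thesis using that by (metis envs_def ext)
qed

lemma l2_wf_push: "l2_wf (push j S)"
  by (auto simp: l2_wf_def)

lemma BSigma_push:
  assumes "BSigma k S" shows "BSigma k (push j S)"
  unfolding BSigma_def
proof (intro allI impI)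
  fix \<phi> x y e' E
  assume s: "sigma_fm k \<phi>" "(x::nat) \<noteq> y" "envs (push j S) e' E"
  from envs_push[OF s(3)] obtain e where e: "e' = (\<lambda>i. j (e i))" "envs S e E" "\<forall>i. e i \<in> nums S" .
  have "\<And>c d. c \<in> nums S \<Longrightarrow> d \<in> nums S \<Longrightarrow>
      sat (push j S) \<phi> (e'(x := j c, y := j d)) E = sat S \<phi> (e(x := c, y := d)) E"
    unfolding e(1) upd_push using e(3) by (intro sat_push) auto
  then show "\<forall>a\<in>nums (push j S).
        (\<forall>c\<in>nums (push j S). lss (push j S) c a \<longrightarrow> (\<exists>d\<in>nums (push j S). sat (push j S) \<phi> (e'(x := c, y := d)) E))
        \<longrightarrow> (\<exists>b\<in>nums (push j S). \<forall>c\<in>nums (push j S). lss (push j S) c a \<longrightarrow>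
               (\<exists>d\<in>nums (push j S). lss (push j S) d b \<and> sat (push j S) \<phi> (e'(x := c, y := d)) E))"
    using assms[unfolded BSigma_def, rule_format, OF s(1,2) e(2)]
    by (simp cong: ball_cong bex_cong)
qed

lemma sat_push_upd:
  assumes "e' = (\<lambda>i. j (e i))" "\<forall>i. e i \<in> nums S" "a \<in> nums S"
  shows "sat (push j S) \<phi> (e'(x := j a)) E = sat S \<phi> (e(x := a)) E"
  unfolding assms(1) upd_push using assms by (intro sat_push) auto

lemma RCA0_push:
  assumes "RCA0 S" shows "RCA0 (push j S)"
proof -
  have b: "basic_ax S" and i: "ind_sigma1 S" and c: "comp_delta1 S"
    using assms by (auto simp: RCA0_def)
  have "basic_ax (push j S)"
    using b by (simp add: basic_ax_def)
  moreover have "ind_sigma1 (push j S)"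
    unfolding ind_sigma1_def
  proof (intro allI impI)
    fix \<phi> x e' E
    assume s: "sigma_fm 1 \<phi>" "envs (push j S) e' E"
      and h: "sat (push j S) \<phi> (e'(x := zro (push j S))) E \<and>
       (\<forall>a\<in>nums (push j S). sat (push j S) \<phi> (e'(x := a)) E \<longrightarrow>
          sat (push j S) \<phi> (e'(x := pls (push j S) a (uno (push j S)))) E)"
    from envs_push[OF s(2)] obtain e where e: "e' = (\<lambda>i. j (e i))" "envs S e E" "\<forall>i. e i \<in> nums S" .
    note [simp] = sat_push_upd[OF e(1,3)]
    have "sat S \<phi> (e(x := zro S)) E"
      using h by simp
    moreover have "sat S \<phi> (e(x := pls S a (uno S))) E" if "a \<in> nums S" "sat S \<phi> (e(x := a)) E" for a
      using h[THEN conjunct2, rule_format, of "j a"] that by simp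
    ultimately have "sat S \<phi> (e(x := a)) E" if "a \<in> nums S" for a
      using i s(1) e(2) that unfolding ind_sigma1_def by blast
    then show "\<forall>a\<in>nums (push j S). sat (push j S) \<phi> (e'(x := a)) E"
      by simp
  qed
  moreover have "comp_delta1 (push j S)"
    unfolding comp_delta1_def
  proof (intro allI impI)
    fix \<phi> \<psi> x e' E
    assume s: "sigma_fm 1 \<phi>" "pi_fm 1 \<psi>" "envs (push j S) e' E"
      and h: "\<forall>a\<in>nums (push j S). sat (push j S) \<phi> (e'(x := a)) E \<longleftrightarrow> sat (push j S) \<psi> (e'(x := a)) E"
    from envs_push[OF s(3)] obtain e where e: "e' = (\<lambda>i. j (e i))" "envs S e E" "\<forall>i. e i \<in> nums S" .
    note [simp] = sat_push_upd[OF e(1,3)]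
    show "\<exists>A\<in>sts (push j S). \<forall>a\<in>nums (push j S). mbr (push j S) a A \<longleftrightarrow> sat (push j S) \<phi> (e'(x := a)) E"
      using c[unfolded comp_delta1_def, rule_format, OF s(1,2) e(2), of x] h by simp
  qed
  ultimately show ?thesis by (simp add: RCA0_def l2_wf_push)
qed

lemma WKL_push:
  assumes "WKL S" shows "WKL (push j S)"
proof -
  have "bin_tree (push j S) T = bin_tree S T" "infinite_set (push j S) T = infinite_set S T"
    "is_path (push j S) T P = is_path S T P" for T P
    by (simp_all add: bin_tree_def infinite_set_def is_path_def)
  with assms show ?thesis by (simp add: WKL_def)
qed

lemma WKL0_push: "WKL0 S \<Longrightarrow> WKL0 (push j S)"
  by (simp add: WKL0_def RCA0_push WKL_push)

end

text \<open>Composes the isomorphism of the base, the embedding and the isomorphism of the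
  extension, so that an extension of the copy gives one of the original on any type into which
  \<open>nums K\<close> injects.\<close>

lemma extension_push:
  assumes j: "inj_on j (nums M)" "l2_wf M"
    and k: "inj_on k (nums K)" "l2_wf K"
    and ee: "end_ext (push j M) K h"
    and se: "sigma_elem n (push j M) K h"
    and ne: "nums K \<noteq> h ` nums (push j M)"
  shows "end_ext M (push k K) (\<lambda>a. k (h (j a)))"
    and "sigma_elem n M (push k K) (\<lambda>a. k (h (j a)))"
    and "nums (push k K) \<noteq> (\<lambda>a. k (h (j a))) ` nums M"
proof -
  note [simp] = push_simps[OF j] wf_simps[OF j] push_eq[OF j]
    push_simps[OF k] wf_simps[OF k] push_eq[OF k]
  have hK: "a \<in> nums M \<Longrightarrow> h (j a) \<in> nums K" for a
    using ee by (auto simp: end_ext_def)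
  note ee' = ee[unfolded end_ext_def, simplified]
  have ih: "inj_on h (j ` nums M)" using ee' by simp
  show "end_ext M (push k K) (\<lambda>a. k (h (j a)))"
    unfolding end_ext_def
  proof (intro conjI)
    show "inj_on (\<lambda>a. k (h (j a))) (nums M)"
    proof (rule inj_onI)
      fix x y assume a: "x \<in> nums M" "y \<in> nums M" "k (h (j x)) = k (h (j y))"
      then have "h (j x) = h (j y)" using hK by simp
      then have "j x = j y" using inj_onD[OF ih] a(1,2) by blast
      then show "x = y" using a(1,2) by simp
    qed
    show "\<forall>c\<in>nums (push k K) - (\<lambda>a. k (h (j a))) ` nums M. \<forall>a\<in>nums M. lss (push k K) (k (h (j a))) c"
      using ee' hK by (auto simp: image_iff)
  qed (use ee' hK in \<open>auto\<close>)
  show "sigma_elem n M (push k K) (\<lambda>a. k (h (j a)))"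
    unfolding sigma_elem_def
  proof (intro allI impI)
    fix \<phi> e E assume s: "sigma_fm n \<phi>" "envs M e E"
    have eN: "\<forall>i. e i \<in> nums M" and E: "\<forall>i. E i \<in> sts M" using s(2) by (auto simp: envs_def)
    have "sat M \<phi> e E = sat (push j M) \<phi> (\<lambda>i. j (e i)) E"
      using sat_push[OF j eN] by simp
    also have "\<dots> = sat K \<phi> (h \<circ> (\<lambda>i. j (e i))) E"
      using se s(1) eN E by (auto simp: sigma_elem_def envs_def)
    also have "\<dots> = sat (push k K) \<phi> (\<lambda>i. k ((h \<circ> (\<lambda>i. j (e i))) i)) E"
      using hK eN by (intro sat_push[OF k, symmetric]) auto
    finally show "sat M \<phi> e E = sat (push k K) \<phi> ((\<lambda>a. k (h (j a))) \<circ> e) E"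
      by (simp add: comp_def)
  qed
  show "nums (push k K) \<noteq> (\<lambda>a. k (h (j a))) ` nums M"
  proof
    assume *: "nums (push k K) = (\<lambda>a. k (h (j a))) ` nums M"
    have "c \<in> h ` nums (push j M)" if "c \<in> nums K" for c
    proof -
      have "k c \<in> (\<lambda>a. k (h (j a))) ` nums M" using * that by auto
      then show ?thesis using that hK by auto
    qed
    then have "nums K = h ` nums (push j M)" using hK by auto
    with ne show False by simp
  qed
qed

subsection \<open>Bounded definability\<close>

text \<open>Countably many formulas define countably many predicates, hence leave only countably
  many requirements for the generic filter.\<close>

instance tm :: countable by countable_datatype
instance fm :: countable by countable_datatype

text \<open>Renaming frees a variable for a new quantifier when a bounded predicate is turned back
  into a formula.\<close>

primrec rnt :: "(nat \<Rightarrow> nat) \<Rightarrow> tm \<Rightarrow> tm" where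
  "rnt r (V i) = V (r i)"
| "rnt r Zr = Zr"
| "rnt r On = On"
| "rnt r (Pl t u) = Pl (rnt r t) (rnt r u)"
| "rnt r (Tm t u) = Tm (rnt r t) (rnt r u)"

primrec rn :: "(nat \<Rightarrow> nat) \<Rightarrow> fm \<Rightarrow> fm" where
  "rn r (Eq t u) = Eq (rnt r t) (rnt r u)"
| "rn r (Lt t u) = Lt (rnt r t) (rnt r u)"
| "rn r (In t X) = In (rnt r t) X"
| "rn r (Neg \<phi>) = Neg (rn r \<phi>)"
| "rn r (Cj \<phi> \<psi>) = Cj (rn r \<phi>) (rn r \<psi>)"
| "rn r (Dj \<phi> \<psi>) = Dj (rn r \<phi>) (rn r \<psi>)"
| "rn r (Im \<phi> \<psi>) = Im (rn r \<phi>) (rn r \<psi>)"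
| "rn r (Ex x \<phi>) = Ex (r x) (rn r \<phi>)"
| "rn r (Al x \<phi>) = Al (r x) (rn r \<phi>)"
| "rn r (BEx x t \<phi>) = BEx (r x) (rnt r t) (rn r \<phi>)"
| "rn r (BAl x t \<phi>) = BAl (r x) (rnt r t) (rn r \<phi>)"
| "rn r (SEx X \<phi>) = SEx X (rn r \<phi>)"
| "rn r (SAl X \<phi>) = SAl X (rn r \<phi>)"

lemma evt_rnt: "evt S (rnt r t) e = evt S t (\<lambda>i. e (r i))"
  by (induction t) auto

lemma sat_rn: "inj r \<Longrightarrow> sat S (rn r \<phi>) e E = sat S \<phi> (\<lambda>i. e (r i)) E"
proof (induction \<phi> arbitrary: e E)
  have *: "(\<lambda>i. (e(r x := a)) (r i)) = (\<lambda>i. e (r i))(x := a)" if "inj r" for e x and a :: 'a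
    using that by (auto simp: inj_eq)
qed (simp_all add: evt_rnt fun_upd_def inj_eq)

lemma delta0_rn: "delta0 (rn r \<phi>) = delta0 \<phi>"
  by (induction \<phi>) auto

text \<open>With \<open>nums M = UNIV\<close>, quantifiers over the type are quantifiers over
  \<open>M\<close>. An environment assigns a set to every set variable, so the schemes have content
  only if \<open>sts M\<close> is nonempty; the other case is treated separately at the end.\<close>

locale cmod =
  fixes M :: "('n, 's) l2str"
  assumes nums [simp]: "nums M = UNIV"
    and countable_nums: "countable (UNIV :: 'n set)"
    and countable_sts: "countable (sts M)"
    and sts_nonempty: "sts M \<noteq> {}"
    and WKL0: "WKL0 M"
    and BSigma2: "BSigma 2 M"
begin

abbreviation add (infixl "\<oplus>" 65) where "a \<oplus> b \<equiv> pls M a b"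
abbreviation mul (infixl "\<otimes>" 70) where "a \<otimes> b \<equiv> tms M a b"
abbreviation less (infix "\<prec>" 50) where "a \<prec> b \<equiv> lss M a b"
abbreviation zer ("\<zero>") where "\<zero> \<equiv> zro M"
abbreviation one ("\<one>") where "\<one> \<equiv> uno M"

definition par :: "nat \<Rightarrow> 'n" where "par = from_nat_into UNIV"
definition spar :: "nat \<Rightarrow> 's" where "spar = from_nat_into (sts M)"

lemma par_surj: "\<exists>i. c = par i"
  using from_nat_into_surj[OF countable_nums, of c] by (auto simp: par_def)

lemma spar_surj: "A \<in> sts M \<Longrightarrow> \<exists>i. A = spar i"
  using from_nat_into_surj[OF countable_sts, of A] by (auto simp: spar_def)

lemma spar_in: "spar i \<in> sts M"
  by (simp add: spar_def from_nat_into sts_nonempty)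

text \<open>Terms and bounded predicates are taken semantically, as functions of an assignment, with
  parameters from \<open>M\<close> built in. Binding is in de Bruijn style: the new value is
  position 0 of \<open>case_nat a v\<close>.\<close>

inductive T0 :: "((nat \<Rightarrow> 'n) \<Rightarrow> 'n) \<Rightarrow> bool" where
  T0_var: "T0 (\<lambda>v. v i)"
| T0_const: "T0 (\<lambda>v. c)"
| T0_add: "T0 t \<Longrightarrow> T0 u \<Longrightarrow> T0 (\<lambda>v. t v \<oplus> u v)"
| T0_mul: "T0 t \<Longrightarrow> T0 u \<Longrightarrow> T0 (\<lambda>v. t v \<otimes> u v)"

inductive D0 :: "((nat \<Rightarrow> 'n) \<Rightarrow> bool) \<Rightarrow> bool" where
  D0_eq: "T0 t \<Longrightarrow> T0 u \<Longrightarrow> D0 (\<lambda>v. t v = u v)"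
| D0_less: "T0 t \<Longrightarrow> T0 u \<Longrightarrow> D0 (\<lambda>v. t v \<prec> u v)"
| D0_mem: "T0 t \<Longrightarrow> A \<in> sts M \<Longrightarrow> D0 (\<lambda>v. mbr M (t v) A)"
| D0_not: "D0 P \<Longrightarrow> D0 (\<lambda>v. \<not> P v)"
| D0_conj: "D0 P \<Longrightarrow> D0 Q \<Longrightarrow> D0 (\<lambda>v. P v \<and> Q v)"
| D0_bex': "D0 P \<Longrightarrow> T0 t \<Longrightarrow> D0 (\<lambda>v. \<exists>a. a \<prec> t v \<and> P (case_nat a v))"

lemma case_nat_eta [simp]: "case_nat (v 0) (\<lambda>i. v (Suc i)) = v"
  by (auto split: nat.split)

text \<open>Restates the constructor with \<open>Q\<close> abstracted over the bound value, so that
  it applies by unification under nested binders.\<close>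

lemma D0_bex:
  assumes "D0 (\<lambda>v. Q (v 0) (\<lambda>i. v (Suc i)))" "T0 t"
  shows "D0 (\<lambda>v. \<exists>a. a \<prec> t v \<and> Q a v)"
  using D0_bex'[OF assms] by simp

lemma D0_disj: "D0 P \<Longrightarrow> D0 Q \<Longrightarrow> D0 (\<lambda>v. P v \<or> Q v)"
  using D0_not[OF D0_conj[OF D0_not D0_not], of P Q] by simp

lemma D0_imp: "D0 P \<Longrightarrow> D0 Q \<Longrightarrow> D0 (\<lambda>v. P v \<longrightarrow> Q v)"
  using D0_not[OF D0_conj[OF _ D0_not], of P Q] by simp

lemma D0_ball:
  assumes "D0 (\<lambda>v. Q (v 0) (\<lambda>i. v (Suc i)))" "T0 t"
  shows "D0 (\<lambda>v. \<forall>a. a \<prec> t v \<longrightarrow> Q a v)"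
  using D0_not[OF D0_bex[of "\<lambda>a v. \<not> Q a v", OF D0_not[OF assms(1)] assms(2)]] by simp

lemma T0_subst: "T0 t \<Longrightarrow> (\<And>i. T0 (s i)) \<Longrightarrow> T0 (\<lambda>v. t (\<lambda>i. s i v))"
proof (induction rule: T0.induct)
  case (T0_add t u)
  then show ?case using T0.T0_add[of "\<lambda>v. t (\<lambda>i. s i v)" "\<lambda>v. u (\<lambda>i. s i v)"] by simp
next
  case (T0_mul t u)
  then show ?case using T0.T0_mul[of "\<lambda>v. t (\<lambda>i. s i v)" "\<lambda>v. u (\<lambda>i. s i v)"] by simp
qed (simp_all add: T0_const)

lemma D0_subst: "D0 P \<Longrightarrow> (\<And>i. T0 (s i)) \<Longrightarrow> D0 (\<lambda>v. P (\<lambda>i. s i v))"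
proof (induction arbitrary: s rule: D0.induct)
  case (D0_bex' P t)
  \<comment> \<open>Under a binder the substitution fixes position 0 and acts on the shifted
    assignment elsewhere.\<close>
  define s' where "s' i = (case i of 0 \<Rightarrow> \<lambda>v. v 0 | Suc k \<Rightarrow> \<lambda>v. s k (\<lambda>i. v (Suc i)))" for i
  have "T0 (s' i)" for i
    using T0_subst[OF D0_bex'.prems, of "\<lambda>i v. v (Suc i)"] T0_var by (cases i) (simp_all add: s'_def)
  from D0_bex'.IH[OF this]
  have "D0 (\<lambda>v. P (\<lambda>i. s' i v))" .
  moreover have "(\<lambda>i. s' i v) = case_nat (v 0) (\<lambda>k. s k (\<lambda>i. v (Suc i)))" for v
    by (auto simp: s'_def split: nat.split)
  ultimately have "D0 (\<lambda>v. P (case_nat (v 0) (\<lambda>k. s k (\<lambda>i. v (Suc i)))))" by simp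
  from D0_bex[of "\<lambda>a v. P (case_nat a (\<lambda>k. s k v))", OF this T0_subst[OF D0_bex'.hyps(2) D0_bex'.prems]]
  show ?case .
next
  case (D0_eq t u)
  show ?case using D0.D0_eq[OF T0_subst[OF D0_eq.hyps(1) D0_eq.prems] T0_subst[OF D0_eq.hyps(2) D0_eq.prems]] .
next
  case (D0_less t u)
  show ?case using D0.D0_less[OF T0_subst[OF D0_less.hyps(1) D0_less.prems] T0_subst[OF D0_less.hyps(2) D0_less.prems]] .
next
  case (D0_mem t A)
  show ?case using D0.D0_mem[OF T0_subst[OF D0_mem.hyps(1) D0_mem.prems] D0_mem.hyps(2)] .
next
  case (D0_not P)
  show ?case using D0.D0_not[OF D0_not.IH[OF D0_not.prems]] .
next
  case (D0_conj P Q)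
  show ?case using D0.D0_conj[OF D0_conj.IH(1)[OF D0_conj.prems] D0_conj.IH(2)[OF D0_conj.prems]] .
qed

lemma T0_evt: "T0 (evt M t)"
proof -
  have "T0 (\<lambda>v. evt M t v)"
    by (induction t) (simp_all add: T0_var T0_const T0_add T0_mul)
  then show ?thesis by simp
qed

text \<open>Bridge between the two treatments of binding: an update at the named variable
  \<open>x\<close> becomes a reading of position 0.\<close>

lemma D0_upd:
  assumes "D0 P" shows "D0 (\<lambda>v. P ((\<lambda>i. v (Suc i))(x := v 0)))"
proof -
  have "T0 (\<lambda>v. ((\<lambda>i. v (Suc i))(x := v 0)) i)" for i
    by (cases "i = x") (simp_all add: T0_var)
  from D0_subst[where s="\<lambda>i v. ((\<lambda>i. v (Suc i))(x := v 0)) i", OF assms this] show ?thesis .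
qed

lemma D0_sat:
  assumes "\<And>X. E X \<in> sts M"
  shows "delta0 \<phi> \<Longrightarrow> D0 (\<lambda>v. sat M \<phi> v E)"
proof (induction \<phi>)
  case (BEx x t \<phi>)
  then have "D0 (\<lambda>v. sat M \<phi> v E)" by simp
  from D0_bex[of "\<lambda>a v. sat M \<phi> (v(x := a)) E", OF D0_upd[OF this, of x] T0_evt, of t]
  show ?case by (simp del: fun_upd_apply)
next
  case (BAl x t \<phi>)
  then have "D0 (\<lambda>v. sat M \<phi> v E)" by simp
  from D0_ball[of "\<lambda>a v. sat M \<phi> (v(x := a)) E", OF D0_upd[OF this, of x] T0_evt, of t]
  show ?case by (simp del: fun_upd_apply)
qed (simp_all add: assms T0_evt D0_eq D0_less D0_mem D0_not D0_conj D0_disj D0_imp)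

text \<open>Variables \<open>3 i\<close> hold the arguments, variables \<open>3 i + 1\<close> enumerate all possible parameters,
  and the remaining ones are free to be used as bound variables.\<close>

definition mg :: "(nat \<Rightarrow> 'n) \<Rightarrow> nat \<Rightarrow> 'n" where
  "mg v n = (if n mod 3 = 0 then v (n div 3) else if n mod 3 = 1 then par (n div 3) else par 0)"

text \<open>Sends variable 0, the newest argument, to the bound variable 2, moves the other
  arguments down one place, and moves 2, 5, 8, ... up one place to make room for it. Parameters stay
  fixed.\<close>

definition sh :: "nat \<Rightarrow> nat" where
  "sh n = (if n = 0 then 2 else if n mod 3 = 0 then n - 3 else if n mod 3 = 1 then n else n + 3)"

lemma inj_sh: "inj sh"
  unfolding inj_def sh_def by (auto split: if_splits; presburger)

lemma mg_sh: "(\<lambda>i. ((mg v)(2 := a)) (sh i)) = mg (case_nat a v)"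
proof
  fix i :: nat
  have "i = 0 \<or> (\<exists>k. i = 3 * Suc k) \<or> (\<exists>k. i = 3 * k + 1) \<or> (\<exists>k. i = 3 * k + 2)"
    by presburger
  then consider "i = 0" | k where "i = 3 * Suc k" | k where "i = 3 * k + 1" | k where "i = 3 * k + 2"
    by blast
  then show "((mg v)(2 := a)) (sh i) = mg (case_nat a v) i"
  proof cases
    case (4 k)
    have "(3 * k + 2) mod 3 = 2" "(3 * k + 5) mod 3 = 2" by presburger+
    then show ?thesis by (simp add: 4 mg_def sh_def)
  next
    case (2 k)
    have "3 * k \<noteq> 2" by presburger
    then show ?thesis by (auto simp: 2 mg_def sh_def)
  qed (auto simp: mg_def sh_def)
qed

lemma T0_evt_ex: "T0 t \<Longrightarrow> \<exists>u. \<forall>v. t v = evt M u (mg v)"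
proof (induction rule: T0.induct)
  case (T0_var i)
  then show ?case by (intro exI[of _ "V (3 * i)"]) (simp add: mg_def)
next
  case (T0_const c)
  from par_surj obtain k where "c = par k" by blast
  then show ?case by (intro exI[of _ "V (3 * k + 1)"]) (simp add: mg_def del: One_nat_def add_Suc_right)
next
  case (T0_add t u)
  then show ?case by (metis evt.simps(4))
next
  case (T0_mul t u)
  then show ?case by (metis evt.simps(5))
qed

lemma D0_sat_ex: "D0 P \<Longrightarrow> \<exists>\<phi>. delta0 \<phi> \<and> (\<forall>v. P v = sat M \<phi> (mg v) spar)"
proof (induction rule: D0.induct)
  case (D0_eq t u)
  then show ?case by (metis T0_evt_ex sat.simps(1) delta0.simps(1))
next
  case (D0_less t u)
  then show ?case by (metis T0_evt_ex sat.simps(2) delta0.simps(2))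
next
  case (D0_mem t A)
  then show ?case by (metis T0_evt_ex spar_surj sat.simps(3) delta0.simps(3))
next
  case (D0_not P)
  then show ?case by (metis sat.simps(4) delta0.simps(4))
next
  case (D0_conj P Q)
  then show ?case by (metis sat.simps(5) delta0.simps(5))
next
  case (D0_bex' P t)
  then obtain \<phi> where \<phi>: "delta0 \<phi>" "\<And>v. P v = sat M \<phi> (mg v) spar" by blast
  from T0_evt_ex[OF D0_bex'.hyps(2)] obtain u where u: "\<And>v. t v = evt M u (mg v)" by blast
  show ?case
    by (intro exI[of _ "BEx 2 u (rn sh \<phi>)"]) (simp add: delta0_rn \<phi> u sat_rn[OF inj_sh] mg_sh del: fun_upd_apply)
qed

text \<open>A single unbounded witness suffices: several witnesses are later merged by searching all
  of them below one bound.\<close>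

definition Sig :: "((nat \<Rightarrow> 'n) \<Rightarrow> bool) \<Rightarrow> bool" where
  "Sig P \<longleftrightarrow> (\<exists>D. D0 D \<and> (\<forall>v. P v \<longleftrightarrow> (\<exists>z. D (case_nat z v))))"

lemma Sig_formula:
  assumes "Sig P"
  obtains \<phi> where "delta0 \<phi>" "\<And>v. P v \<longleftrightarrow> sat M (Ex 2 \<phi>) (mg v) spar"
proof -
  obtain D where D: "D0 D" "\<And>v. P v \<longleftrightarrow> (\<exists>z. D (case_nat z v))"
    using assms by (auto simp: Sig_def)
  from D0_sat_ex[OF D(1)] obtain \<phi> where \<phi>: "delta0 \<phi>" "\<And>v. D v = sat M \<phi> (mg v) spar" by blast
  show ?thesis
    by (rule that[of "rn sh \<phi>"]) (simp_all add: delta0_rn \<phi> D sat_rn[OF inj_sh] mg_sh del: fun_upd_apply)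
qed

lemma envs_mg: "envs M (mg v) spar"
  by (simp add: envs_def spar_in)

lemma mg_upd0: "(mg v)(0 := a) = mg (v(0 := a))"
  by (auto simp: mg_def)
text \<open>Arguments sit at multiples of three, so argument 1 is the formula variable 3.\<close>

lemma mg_upd1: "(mg v)(3 := a) = mg (v(Suc 0 := a))"
proof
  fix i :: nat
  have "i mod 3 = 0 \<Longrightarrow> i div 3 = Suc 0 \<longleftrightarrow> i = 3" by presburger
  then show "((mg v)(3 := a)) i = mg (v(Suc 0 := a)) i" by (auto simp: mg_def)
qed

lemma sigma_fm1: "delta0 \<phi> \<Longrightarrow> sigma_fm 1 (Ex x \<phi>)"
  unfolding One_nat_def by (intro sS p0)

lemma RCA0: "RCA0 M" using WKL0 by (simp add: WKL0_def)

lemma Sig_induct: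
  assumes P: "Sig (\<lambda>v. P (v 0))" and z: "P \<zero>" and s: "\<And>a. P a \<Longrightarrow> P (a \<oplus> \<one>)"
  shows "P a"
proof -
  from Sig_formula[OF P] obtain \<phi> where \<phi>: "delta0 \<phi>" "\<And>v. P (v 0) \<longleftrightarrow> sat M (Ex 2 \<phi>) (mg v) spar" by blast
  have "\<And>a. sat M (Ex 2 \<phi>) ((mg undefined)(0 := a)) spar = P a"
    unfolding mg_upd0 \<phi>(2)[symmetric] by simp
  moreover have "ind_sigma1 M" using RCA0 by (simp add: RCA0_def)
  ultimately show ?thesis
    using sigma_fm1[OF \<phi>(1), of 2] z s envs_mg[of undefined]
    unfolding ind_sigma1_def by (metis nums iso_tuple_UNIV_I)
qed

lemma comprehension:
  assumes P: "Sig (\<lambda>v. P (v 0))" and Q: "Sig (\<lambda>v. \<not> P (v 0))"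
  shows "\<exists>A\<in>sts M. \<forall>a. mbr M a A \<longleftrightarrow> P a"
proof -
  from Sig_formula[OF P] obtain \<phi> where \<phi>: "delta0 \<phi>" "\<And>v. P (v 0) \<longleftrightarrow> sat M (Ex 2 \<phi>) (mg v) spar" by blast
  from Sig_formula[OF Q] obtain \<psi> where \<psi>: "delta0 \<psi>" "\<And>v. \<not> P (v 0) \<longleftrightarrow> sat M (Ex 2 \<psi>) (mg v) spar" by blast
  have 1: "sat M (Ex 2 \<phi>) ((mg undefined)(0 := a)) spar = P a" for a
    unfolding mg_upd0 \<phi>(2)[symmetric] by simp
  have "(\<not> sat M (Ex 2 \<psi>) ((mg undefined)(0 := a)) spar) = P a" for a
    unfolding mg_upd0 \<psi>(2)[symmetric] by simp
  then have 2: "sat M (Al 2 (Neg \<psi>)) ((mg undefined)(0 := a)) spar = P a" for a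
    by simp
  have "pi_fm 1 (Al 2 (Neg \<psi>))" unfolding One_nat_def using \<psi>(1) by (intro pS s0) simp
  moreover have "comp_delta1 M" using RCA0 by (simp add: RCA0_def)
  moreover have "\<forall>a\<in>nums M. sat M (Ex 2 \<phi>) ((mg undefined)(0 := a)) spar
      \<longleftrightarrow> sat M (Al 2 (Neg \<psi>)) ((mg undefined)(0 := a)) spar"
    using 1 2 by blast
  ultimately have "\<exists>A\<in>sts M. \<forall>a\<in>nums M. mbr M a A \<longleftrightarrow> sat M (Ex 2 \<phi>) ((mg undefined)(0 := a)) spar"
    using sigma_fm1[OF \<phi>(1), of 2] envs_mg[of undefined]
    unfolding comp_delta1_def by blast
  then show ?thesis by (simp only: 1 nums ball_UNIV)
qed

lemma mg_upd01: "(mg v)(0 := a, 3 := b) = mg (v(0 := a, Suc 0 := b))"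
  by (simp add: mg_upd0 mg_upd1)

lemma Sig_collection:
  assumes P: "Sig (\<lambda>v. P (v 0) (v 1))" and c: "\<And>c. c \<prec> a \<Longrightarrow> \<exists>d. P c d"
  shows "\<exists>b. \<forall>c. c \<prec> a \<longrightarrow> (\<exists>d. d \<prec> b \<and> P c d)"
proof -
  from Sig_formula[OF P] obtain \<phi> where \<phi>: "delta0 \<phi>" "\<And>v. P (v 0) (v 1) \<longleftrightarrow> sat M (Ex 2 \<phi>) (mg v) spar" by blast
  have 1: "sat M (Ex 2 \<phi>) ((mg undefined)(0 := c, 3 := d)) spar = P c d" for c d
    unfolding mg_upd01 \<phi>(2)[symmetric] by simp
  have "sigma_fm 2 (Ex 2 \<phi>)"
    unfolding numeral_2_eq_2 using \<phi>(1) by (intro sS p0)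
  from BSigma2[unfolded BSigma_def, rule_format, OF this _ envs_mg, of 0 3 a undefined] c
  show ?thesis unfolding 1 by simp
qed

text \<open>Here collection for \<open>\<Sigma>\<^sub>2\<close> formulas is used in full; the
  pigeonhole argument for the filter rests on it.\<close>

lemma Pi_collection:
  assumes P: "Sig (\<lambda>v. P (v 0) (v 1))" and c: "\<And>c. c \<prec> a \<Longrightarrow> \<exists>d. \<not> P c d"
  shows "\<exists>b. \<forall>c. c \<prec> a \<longrightarrow> (\<exists>d. d \<prec> b \<and> \<not> P c d)"
proof -
  from Sig_formula[OF P] obtain \<phi> where \<phi>: "delta0 \<phi>" "\<And>v. P (v 0) (v 1) \<longleftrightarrow> sat M (Ex 2 \<phi>) (mg v) spar" by blast
  have *: "sat M (Ex 2 \<phi>) ((mg undefined)(0 := c, 3 := d)) spar = P c d" for c d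
    unfolding mg_upd01 \<phi>(2)[symmetric] by simp
  \<comment> \<open>The outer quantifier is vacuous, since the inner one rebinds variable 2; it
    serves to bring the \<open>\<Pi>\<^sub>1\<close> formula into the form required by
    \<open>sigma_fm 2\<close>.\<close>
  have 1: "sat M (Ex 2 (Al 2 (Neg \<phi>))) ((mg undefined)(0 := c, 3 := d)) spar = (\<not> P c d)" for c d
    using *[of c d] by auto
  have "sigma_fm 2 (Ex 2 (Al 2 (Neg \<phi>)))"
    unfolding numeral_2_eq_2 using \<phi>(1) by (intro sS pS s0) simp
  from BSigma2[unfolded BSigma_def, rule_format, OF this _ envs_mg, of 0 3 a undefined] c
  show ?thesis unfolding 1 by simp
qed

subsection \<open>Arithmetic\<close>

lemma D0_ren: "D0 P \<Longrightarrow> D0 (\<lambda>v. P (\<lambda>i. v (r i)))"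
  by (rule D0_subst[where s="\<lambda>i v. v (r i)"]) (simp_all add: T0_var)

lemma Sig_D0: "D0 P \<Longrightarrow> Sig P"
  unfolding Sig_def using D0_ren[of P Suc] by (intro exI[of _ "\<lambda>v. P (\<lambda>i. v (Suc i))"]) simp

lemmas T0_intros = T0_const T0_var T0_add T0_mul

lemma D0_induct: "D0 (\<lambda>v. P (v 0)) \<Longrightarrow> P \<zero> \<Longrightarrow> (\<And>a. P a \<Longrightarrow> P (a \<oplus> \<one>)) \<Longrightarrow> P a"
  by (rule Sig_induct[OF Sig_D0])

lemma basic:
  "n \<oplus> \<one> \<noteq> \<zero>" "m \<oplus> \<one> = n \<oplus> \<one> \<Longrightarrow> m = n" "m \<oplus> \<zero> = m" "m \<oplus> (n \<oplus> \<one>) = (m \<oplus> n) \<oplus> \<one>"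
  "m \<otimes> \<zero> = \<zero>" "m \<otimes> (n \<oplus> \<one>) = m \<otimes> n \<oplus> m" "\<not> m \<prec> \<zero>" "m \<prec> n \<oplus> \<one> \<longleftrightarrow> m \<prec> n \<or> m = n"
  using RCA0 by (simp_all add: RCA0_def basic_ax_def)

lemma add_assoc: "(a \<oplus> b) \<oplus> c = a \<oplus> (b \<oplus> c)"
  by (rule D0_induct[where P="\<lambda>c. (a \<oplus> b) \<oplus> c = a \<oplus> (b \<oplus> c)"])
    (intro D0_eq T0_intros | simp add: basic)+

lemma zero_add: "\<zero> \<oplus> a = a"
  by (rule D0_induct[where P="\<lambda>a. \<zero> \<oplus> a = a"])
    (intro D0_eq T0_intros | simp add: basic)+

lemma one_add: "\<one> \<oplus> a = a \<oplus> \<one>"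
  by (rule D0_induct[where P="\<lambda>a. \<one> \<oplus> a = a \<oplus> \<one>"])
    (intro D0_eq T0_intros | simp add: basic zero_add)+

lemma add_commute: "a \<oplus> b = b \<oplus> a"
proof (rule D0_induct[where P="\<lambda>b. a \<oplus> b = b \<oplus> a"])
  fix b assume "a \<oplus> b = b \<oplus> a"
  then show "a \<oplus> (b \<oplus> \<one>) = (b \<oplus> \<one>) \<oplus> a"
    by (metis add_assoc one_add)
qed (intro D0_eq T0_intros | simp add: basic zero_add)+

lemma add_left_commute: "a \<oplus> (b \<oplus> c) = b \<oplus> (a \<oplus> c)"
  by (metis add_assoc add_commute)

lemmas add_ac = add_assoc add_commute add_left_commute

lemma zero_mul: "\<zero> \<otimes> a = \<zero>"
  by (rule D0_induct[where P="\<lambda>a. \<zero> \<otimes> a = \<zero>"])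
    (intro D0_eq T0_intros | simp add: basic)+

lemma distrib_right: "(a \<oplus> b) \<otimes> c = a \<otimes> c \<oplus> b \<otimes> c"
  by (rule D0_induct[where P="\<lambda>c. (a \<oplus> b) \<otimes> c = a \<otimes> c \<oplus> b \<otimes> c"])
    (intro D0_eq T0_intros | simp add: basic(3,5,6) add_ac)+

lemma mul_one: "a \<otimes> \<one> = a"
  using basic(6)[of a \<zero>] by (simp add: basic zero_add)

lemma one_mul: "\<one> \<otimes> a = a"
  by (rule D0_induct[where P="\<lambda>a. \<one> \<otimes> a = a"])
    (intro D0_eq T0_intros | simp add: basic(3,5,6))+

lemma mul_commute: "a \<otimes> b = b \<otimes> a"
  by (rule D0_induct[where P="\<lambda>b. a \<otimes> b = b \<otimes> a"])
    (intro D0_eq T0_intros | simp add: basic zero_mul distrib_right one_mul)+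

lemma distrib_left: "c \<otimes> (a \<oplus> b) = c \<otimes> a \<oplus> c \<otimes> b"
  by (metis distrib_right mul_commute)

lemma mul_assoc: "(a \<otimes> b) \<otimes> c = a \<otimes> (b \<otimes> c)"
  by (rule D0_induct[where P="\<lambda>c. (a \<otimes> b) \<otimes> c = a \<otimes> (b \<otimes> c)"])
    (intro D0_eq T0_intros | simp add: basic distrib_left mul_one)+

lemma mul_left_commute: "a \<otimes> (b \<otimes> c) = b \<otimes> (a \<otimes> c)"
  by (metis mul_assoc mul_commute)

lemmas mul_ac = mul_assoc mul_commute mul_left_commute

lemma add_cancel [simp]: "a \<oplus> c = b \<oplus> c \<longleftrightarrow> a = b"
proof -
  have "a \<oplus> c = b \<oplus> c \<longrightarrow> a = b"
    by (rule D0_induct[where P="\<lambda>c. a \<oplus> c = b \<oplus> c \<longrightarrow> a = b"])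
      (intro D0_eq D0_imp T0_intros | simp add: basic)+
  then show ?thesis by blast
qed

lemma add_cancel_left [simp]: "c \<oplus> a = c \<oplus> b \<longleftrightarrow> a = b"
  by (metis add_cancel add_commute)

text \<open>The order is not yet linked to addition, so the predecessor is an unbounded witness and
  the induction is over a \<open>\<Sigma>\<^sub>1\<close> predicate.\<close>

lemma zero_or_suc: "a = \<zero> \<or> (\<exists>b. a = b \<oplus> \<one>)"
proof -
  have "Sig (\<lambda>v. \<exists>z. v 0 = \<zero> \<or> v 0 = z \<oplus> \<one>)"
    unfolding Sig_def
    by (intro exI[of _ "\<lambda>v. v (Suc 0) = \<zero> \<or> v (Suc 0) = v 0 \<oplus> \<one>"] conjI D0_disj D0_eq T0_intros) simp
  then have "\<exists>z. a = \<zero> \<or> a = z \<oplus> \<one>"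
    by (rule Sig_induct) auto
  then show ?thesis by blast
qed

text \<open>The axioms describe the order only at zero and at successors; this link to addition is
  the source of transitivity and monotonicity.\<close>

lemma less_iff_add: "a \<prec> b \<longleftrightarrow> (\<exists>z. b = a \<oplus> (z \<oplus> \<one>))"
proof
  have "Sig (\<lambda>v. \<exists>z. a \<prec> v 0 \<longrightarrow> v 0 = a \<oplus> (z \<oplus> \<one>))"
    unfolding Sig_def
    by (intro exI[of _ "\<lambda>v. a \<prec> v (Suc 0) \<longrightarrow> v (Suc 0) = a \<oplus> (v 0 \<oplus> \<one>)"] conjI D0_imp D0_eq D0_less T0_intros) simp
  then have "\<exists>z. a \<prec> b \<longrightarrow> b = a \<oplus> (z \<oplus> \<one>)"
  proof (rule Sig_induct)
    fix b assume "\<exists>z. a \<prec> b \<longrightarrow> b = a \<oplus> (z \<oplus> \<one>)"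
    then obtain z where z: "a \<prec> b \<longrightarrow> b = a \<oplus> (z \<oplus> \<one>)" ..
    consider "\<not> a \<prec> b \<oplus> \<one>" | "a \<prec> b" | "a = b" using basic(8) by blast
    then show "\<exists>z. a \<prec> b \<oplus> \<one> \<longrightarrow> b \<oplus> \<one> = a \<oplus> (z \<oplus> \<one>)"
    proof cases
      case 2 then show ?thesis using z by (intro exI[of _ "z \<oplus> \<one>"]) (simp add: add_ac)
    next
      case 3 then show ?thesis by (intro exI[of _ "\<zero>"]) (simp add: zero_add)
    qed blast
  qed (simp add: basic)
  then show "a \<prec> b \<Longrightarrow> \<exists>z. b = a \<oplus> (z \<oplus> \<one>)" by blast
next
  have "a \<prec> a \<oplus> (z \<oplus> \<one>)" for z
    by (rule D0_induct[where P="\<lambda>z. a \<prec> a \<oplus> (z \<oplus> \<one>)"])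
      (intro D0_less T0_intros | simp add: basic zero_add)+
  then show "\<exists>z. b = a \<oplus> (z \<oplus> \<one>) \<Longrightarrow> a \<prec> b" by blast
qed

definition leq (infix "\<preceq>" 50) where "a \<preceq> b \<longleftrightarrow> a \<prec> b \<or> a = b"

lemma leq_iff_add: "a \<preceq> b \<longleftrightarrow> (\<exists>z. b = a \<oplus> z)"
  unfolding leq_def less_iff_add by (metis basic(3) zero_or_suc)

lemma less_suc: "a \<prec> b \<oplus> \<one> \<longleftrightarrow> a \<preceq> b"
  by (simp add: basic leq_def)

lemma suc_le: "a \<oplus> \<one> \<preceq> b \<longleftrightarrow> a \<prec> b"
  unfolding leq_iff_add less_iff_add by (simp add: add_ac)

lemma zero_le [simp]: "\<zero> \<preceq> a"
  unfolding leq_iff_add by (auto simp: zero_add)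

lemma less_irrefl: "\<not> a \<prec> a"
proof
  assume "a \<prec> a"
  then obtain z where "a \<oplus> \<zero> = a \<oplus> (z \<oplus> \<one>)" unfolding less_iff_add by (auto simp: basic(3))
  then show False using basic(1)[of z] by simp
qed

lemma less_trans: "a \<prec> b \<Longrightarrow> b \<prec> c \<Longrightarrow> a \<prec> c"
  unfolding less_iff_add by (metis add_assoc)

lemma linear: "a \<prec> b \<or> a = b \<or> b \<prec> a"
proof (rule D0_induct[where P="\<lambda>b. a \<prec> b \<or> a = b \<or> b \<prec> a"])
  show "a \<prec> \<zero> \<or> a = \<zero> \<or> \<zero> \<prec> a"
    using zero_le[of a] unfolding leq_def by auto
  fix b assume "a \<prec> b \<or> a = b \<or> b \<prec> a"
  then show "a \<prec> b \<oplus> \<one> \<or> a = b \<oplus> \<one> \<or> b \<oplus> \<one> \<prec> a"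
    using suc_le[of b a] unfolding basic(8) leq_def by auto
qed (intro D0_disj D0_less D0_eq T0_intros)

sublocale ord: linorder "(\<preceq>)" "(\<prec>)"
proof
  show "a \<prec> b \<longleftrightarrow> a \<preceq> b \<and> \<not> b \<preceq> a" for a b
    unfolding leq_def by (metis less_irrefl less_trans)
qed (metis leq_def less_irrefl less_trans linear)+

lemma add_mono: "a \<preceq> b \<Longrightarrow> c \<preceq> d \<Longrightarrow> a \<oplus> c \<preceq> b \<oplus> d"
  unfolding leq_iff_add by (metis add_assoc add_commute)

lemma add_less_le_mono: "a \<prec> b \<Longrightarrow> c \<preceq> d \<Longrightarrow> a \<oplus> c \<prec> b \<oplus> d"
  unfolding suc_le[symmetric] using add_mono[of "a \<oplus> \<one>" b c d] by (simp add: add_ac)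

lemma mul_mono: "a \<preceq> b \<Longrightarrow> c \<preceq> d \<Longrightarrow> a \<otimes> c \<preceq> b \<otimes> d"
proof -
  assume "a \<preceq> b" "c \<preceq> d"
  then obtain x y where "b = a \<oplus> x" "d = c \<oplus> y" unfolding leq_iff_add by blast
  then show ?thesis unfolding leq_iff_add
    by (intro exI[of _ "a \<otimes> y \<oplus> x \<otimes> (c \<oplus> y)"]) (simp add: distrib_left distrib_right add_ac)
qed

lemma le_add [simp]: "a \<preceq> a \<oplus> b" "a \<preceq> b \<oplus> a"
  unfolding leq_iff_add by (auto simp: add_commute)

lemma less_add_one [simp]: "a \<prec> a \<oplus> \<one>"
  by (simp add: basic)

lemma pos_iff: "\<zero> \<prec> a \<longleftrightarrow> a \<noteq> \<zero>"
  using zero_le[of a] by (auto simp: leq_def less_irrefl)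

text \<open>Lets two unbounded witnesses be searched for below one common bound.\<close>

lemma bound2: "\<exists>w. a \<prec> w \<and> b \<prec> w"
  by (intro exI[of _ "a \<oplus> b \<oplus> \<one>"]) (simp add: less_suc)

subsection \<open>\<open>\<Sigma>\<^sub>1\<close> relations\<close>

lemma D0_leq: "T0 t \<Longrightarrow> T0 u \<Longrightarrow> D0 (\<lambda>v. t v \<preceq> u v)"
  unfolding leq_def by (intro D0_disj D0_less D0_eq)

lemma Sig_ex:
  assumes "Sig (\<lambda>v. Q (v 0) (\<lambda>i. v (Suc i)))"
  shows "Sig (\<lambda>v. \<exists>a. Q a v)"
proof -
  obtain D where D: "D0 D" and QD: "\<And>v. Q (v 0) (\<lambda>i. v (Suc i)) \<longleftrightarrow> (\<exists>z. D (case_nat z v))"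
    using assms by (auto simp: Sig_def)
  have Q: "Q a v \<longleftrightarrow> (\<exists>z. D (case_nat z (case_nat a v)))" for a v
    using QD[of "case_nat a v"] by simp
  \<comment> \<open>Under the two new binders position 2 holds the common bound of \<open>z\<close>
    and \<open>a\<close>, so the renaming skips it.\<close>
  have "D0 (\<lambda>v. D (\<lambda>i. v (case_nat 0 (case_nat (Suc 0) (\<lambda>i. i + 3)) i)))"
    by (rule D0_ren[OF D])
  moreover have "(\<lambda>i. v (case_nat 0 (case_nat (Suc 0) (\<lambda>i. i + 3)) i)) =
     case_nat (v 0) (case_nat (v (Suc 0)) (\<lambda>i. v (Suc (Suc (Suc i)))))" for v :: "nat \<Rightarrow> 'n"
    by (auto split: nat.split simp: numeral_3_eq_3)
  ultimately have "D0 (\<lambda>v. \<exists>a. a \<prec> v 0 \<and> (\<exists>z. z \<prec> v 0 \<and> D (case_nat z (case_nat a (\<lambda>i. v (Suc i))))))"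
    by (intro D0_bex T0_intros) simp
  moreover have "(\<exists>a. Q a v) \<longleftrightarrow> (\<exists>w. \<exists>a. a \<prec> w \<and> (\<exists>z. z \<prec> w \<and> D (case_nat z (case_nat a v))))" for v
    unfolding Q using bound2 by blast
  ultimately show ?thesis
    unfolding Sig_def by (intro exI[of _ "\<lambda>v. \<exists>a. a \<prec> v 0 \<and> (\<exists>z. z \<prec> v 0 \<and> D (case_nat z (case_nat a (\<lambda>i. v (Suc i)))))"]) simp
qed

lemma Sig_disj: "Sig P \<Longrightarrow> Sig Q \<Longrightarrow> Sig (\<lambda>v. P v \<or> Q v)"
  unfolding Sig_def
proof (elim exE conjE)
  fix D D' assume "D0 D" "\<forall>v. P v \<longleftrightarrow> (\<exists>z. D (case_nat z v))" "D0 D'" "\<forall>v. Q v \<longleftrightarrow> (\<exists>z. D' (case_nat z v))"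
  then show "\<exists>D. D0 D \<and> (\<forall>v. (P v \<or> Q v) \<longleftrightarrow> (\<exists>z. D (case_nat z v)))"
    by (intro exI[of _ "\<lambda>v. D v \<or> D' v"]) (auto intro: D0_disj)
qed

lemma Sig_conj:
  assumes "Sig P" "Sig Q"
  shows "Sig (\<lambda>v. P v \<and> Q v)"
proof -
  obtain D D' where D: "D0 D" "\<And>v. P v \<longleftrightarrow> (\<exists>z. D (case_nat z v))"
    "D0 D'" "\<And>v. Q v \<longleftrightarrow> (\<exists>z. D' (case_nat z v))"
    using assms by (auto simp: Sig_def)
  have eq: "(\<lambda>i. v (case_nat 0 (\<lambda>i. i + 2) i)) = case_nat (v 0) (\<lambda>i. v (Suc (Suc i)))" for v :: "nat \<Rightarrow> 'n"
    by (auto split: nat.split)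
  have "D0 (\<lambda>v. (\<exists>z. z \<prec> v 0 \<and> D (case_nat z (\<lambda>i. v (Suc i)))) \<and> (\<exists>z. z \<prec> v 0 \<and> D' (case_nat z (\<lambda>i. v (Suc i)))))"
    using D0_ren[OF D(1), of "case_nat 0 (\<lambda>i. i + 2)"] D0_ren[OF D(3), of "case_nat 0 (\<lambda>i. i + 2)"]
    unfolding eq by (intro D0_conj D0_bex T0_intros)
  moreover have "(P v \<and> Q v) \<longleftrightarrow> (\<exists>w. (\<exists>z. z \<prec> w \<and> D (case_nat z v)) \<and> (\<exists>z. z \<prec> w \<and> D' (case_nat z v)))" for v
    using D bound2 by blast
  ultimately show ?thesis
    unfolding Sig_def by (intro exI[of _ "\<lambda>v. (\<exists>z. z \<prec> v 0 \<and> D (case_nat z (\<lambda>i. v (Suc i)))) \<and> (\<exists>z. z \<prec> v 0 \<and> D' (case_nat z (\<lambda>i. v (Suc i))))"]) simp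
qed

text \<open>Since \<open>t\<close> is total, a \<open>\<Sigma>\<^sub>1\<close> graph is already
  decidable: to differ from a value is to take some other value.\<close>

definition Fn :: "((nat \<Rightarrow> 'n) \<Rightarrow> 'n) \<Rightarrow> bool" where
  "Fn t \<longleftrightarrow> Sig (\<lambda>v. v 0 = t (\<lambda>i. v (Suc i)))"

definition Del :: "((nat \<Rightarrow> 'n) \<Rightarrow> bool) \<Rightarrow> bool" where
  "Del P \<longleftrightarrow> Sig P \<and> Sig (\<lambda>v. \<not> P v)"

lemma Sig_Del: "Del P \<Longrightarrow> Sig P" by (simp add: Del_def)
lemma Del_D0: "D0 P \<Longrightarrow> Del P" by (simp add: Del_def Sig_D0 D0_not)

text \<open>The value of \<open>t\<close> is introduced as an existential witness lying on the
  graph.\<close>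

lemma Sig_let: "Fn t \<Longrightarrow> Sig (\<lambda>v. Q (v 0) (\<lambda>i. v (Suc i))) \<Longrightarrow> Sig (\<lambda>v. Q (t v) v)"
proof -
  assume "Fn t" "Sig (\<lambda>v. Q (v 0) (\<lambda>i. v (Suc i)))"
  then have "Sig (\<lambda>v. v 0 = t (\<lambda>i. v (Suc i)) \<and> Q (v 0) (\<lambda>i. v (Suc i)))"
    unfolding Fn_def by (rule Sig_conj)
  from Sig_ex[of "\<lambda>a v. a = t v \<and> Q a v", OF this] show ?thesis by simp
qed

lemma Sig_ren: "Sig P \<Longrightarrow> Sig (\<lambda>v. P (\<lambda>i. v (r i)))"
proof -
  assume "Sig P"
  then obtain D where D: "D0 D" "\<And>v. P v \<longleftrightarrow> (\<exists>z. D (case_nat z v))" by (auto simp: Sig_def)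
  have "(\<lambda>i. v (case_nat 0 (\<lambda>i. Suc (r i)) i)) = case_nat (v 0) (\<lambda>i. v (Suc (r i)))" for v :: "nat \<Rightarrow> 'n"
    by (auto split: nat.split)
  with D0_ren[OF D(1), of "case_nat 0 (\<lambda>i. Suc (r i))"]
  have "D0 (\<lambda>v. D (case_nat (v 0) (\<lambda>i. v (Suc (r i)))))" by simp
  then show ?thesis unfolding Sig_def
    by (intro exI[of _ "\<lambda>v. D (case_nat (v 0) (\<lambda>i. v (Suc (r i))))"]) (simp add: D)
qed

lemma Fn_ren: "Fn t \<Longrightarrow> Fn (\<lambda>v. t (\<lambda>i. v (r i)))"
  unfolding Fn_def using Sig_ren[of _ "case_nat 0 (\<lambda>i. Suc (r i))"] by fastforce

lemma Fn_shift: "Fn t \<Longrightarrow> Fn (\<lambda>v. t (\<lambda>i. v (Suc i)))"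
  by (rule Fn_ren)

lemma Fn_T0: "T0 t \<Longrightarrow> Fn t"
  unfolding Fn_def
  by (intro Sig_D0 D0_eq T0_var T0_subst[where s="\<lambda>i v. v (Suc i)"])

lemma Fn_var: "Fn (\<lambda>v. v i)" and Fn_const: "Fn (\<lambda>v. c)"
  by (intro Fn_T0 T0_intros)+

lemma Sig_rel:
  assumes "Fn t" "Fn u" "D0 (\<lambda>v. R (v 0) (v (Suc 0)))"
  shows "Sig (\<lambda>v. R (t v) (u v))"
proof -
  have "Sig (\<lambda>v. R (v (Suc 0)) (v 0))"
    using D0_ren[OF assms(3), of "\<lambda>i. if i = 0 then 1 else 0"] by (simp add: Sig_D0)
  then have "Sig (\<lambda>v. R (v 0) (u (\<lambda>i. v (Suc i))))"
    by (rule Sig_let[OF Fn_shift[OF assms(2)], of "\<lambda>b v. R (v 0) b"])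
  then show ?thesis by (rule Sig_let[OF assms(1), of "\<lambda>a v. R a (u v)"])
qed

lemma Del_rel:
  assumes "Fn t" "Fn u" "D0 (\<lambda>v. R (v 0) (v (Suc 0)))"
  shows "Del (\<lambda>v. R (t v) (u v))"
  using Sig_rel[OF assms] Sig_rel[OF assms(1,2), of "\<lambda>a b. \<not> R a b"] D0_not[OF assms(3)]
  by (simp add: Del_def)

lemma Del_eq: "Fn t \<Longrightarrow> Fn u \<Longrightarrow> Del (\<lambda>v. t v = u v)"
  by (rule Del_rel; (assumption | intro D0_eq T0_intros))
lemma Del_less: "Fn t \<Longrightarrow> Fn u \<Longrightarrow> Del (\<lambda>v. t v \<prec> u v)"
  by (rule Del_rel; (assumption | intro D0_less T0_intros))
lemma Del_leq: "Fn t \<Longrightarrow> Fn u \<Longrightarrow> Del (\<lambda>v. t v \<preceq> u v)"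
  by (rule Del_rel; (assumption | intro D0_leq T0_intros))
lemma Del_mem: "Fn t \<Longrightarrow> A \<in> sts M \<Longrightarrow> Del (\<lambda>v. mbr M (t v) A)"
  by (rule Del_rel[where R="\<lambda>a b. mbr M a A"]; (assumption | intro D0_mem T0_intros))
lemma Del_const: "Del (\<lambda>v. c)"
proof -
  have "Del (\<lambda>v. v 0 = v 0)" "Del (\<lambda>v. v 0 \<noteq> v 0)"
    by (intro Del_D0 D0_not D0_eq T0_intros)+
  then show ?thesis by (cases c) simp_all
qed

lemma Fn_op2:
  assumes "Fn t" "Fn u" "T0 (\<lambda>v. f (v 0) (v (Suc 0)))"
  shows "Fn (\<lambda>v. f (t v) (u v))"
proof -
  have "T0 (\<lambda>v. f (v (Suc 0)) (v 0))"
    using T0_subst[OF assms(3), of "\<lambda>i v. v (case_nat 1 (\<lambda>_. 0) i)"] by (simp add: T0_var)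
  then have "Sig (\<lambda>v. v (Suc (Suc 0)) = f (v (Suc 0)) (v 0))"
    by (intro Sig_D0 D0_eq T0_var)
  then have "Sig (\<lambda>v. v (Suc 0) = f (v 0) (u (\<lambda>i. v (Suc (Suc i)))))"
    by (rule Sig_let[OF Fn_ren[OF assms(2), of "\<lambda>i. Suc (Suc i)"], of "\<lambda>b v. v (Suc 0) = f (v 0) b"])
  then show ?thesis unfolding Fn_def
    by (rule Sig_let[OF Fn_shift[OF assms(1)], of "\<lambda>a v. v 0 = f a (u (\<lambda>i. v (Suc i)))"])
qed

lemma Fn_add: "Fn t \<Longrightarrow> Fn u \<Longrightarrow> Fn (\<lambda>v. t v \<oplus> u v)"
  by (rule Fn_op2; (assumption | intro T0_intros))
lemma Fn_mul: "Fn t \<Longrightarrow> Fn u \<Longrightarrow> Fn (\<lambda>v. t v \<otimes> u v)"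
  by (rule Fn_op2; (assumption | intro T0_intros))

text \<open>Collection bounds the witnesses for all \<open>a\<close> below \<open>v k\<close>
  simultaneously, which moves the unbounded quantifier to the front.\<close>

lemma Sig_ball_var:
  assumes "Sig (\<lambda>v. Q (v 0) (\<lambda>i. v (Suc i)))"
  shows "Sig (\<lambda>v. \<forall>a. a \<prec> v k \<longrightarrow> Q a v)"
proof -
  obtain D where D: "D0 D" and QD: "\<And>v. Q (v 0) (\<lambda>i. v (Suc i)) \<longleftrightarrow> (\<exists>z. D (case_nat z v))"
    using assms by (auto simp: Sig_def)
  have Q: "Q a v \<longleftrightarrow> (\<exists>z. D (case_nat z (case_nat a v)))" for a v
    using QD[of "case_nat a v"] by simp
  have "(\<lambda>i. v (case_nat 0 (case_nat (Suc 0) (\<lambda>i. i + 3)) i)) =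
     case_nat (v 0) (case_nat (v (Suc 0)) (\<lambda>i. v (Suc (Suc (Suc i)))))" for v :: "nat \<Rightarrow> 'n"
    by (auto split: nat.split simp: numeral_3_eq_3)
  with D0_ren[OF D, of "case_nat 0 (case_nat (Suc 0) (\<lambda>i. i + 3))"]
  have "D0 (\<lambda>v. \<forall>a. a \<prec> v (Suc k) \<longrightarrow> (\<exists>z. z \<prec> v 0 \<and> D (case_nat z (case_nat a (\<lambda>i. v (Suc i))))))"
    by (intro D0_bex D0_ball T0_intros) simp
  moreover have "(\<forall>a. a \<prec> v k \<longrightarrow> Q a v) \<longleftrightarrow>
      (\<exists>w. \<forall>a. a \<prec> v k \<longrightarrow> (\<exists>z. z \<prec> w \<and> D (case_nat z (case_nat a v))))" for v
  proof
    \<comment> \<open>Exchanges positions 0 and 1, to match the argument order of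
      \<open>Sig_collection\<close>, and freezes the rest of the assignment as parameters.\<close>
    define s where "s i = (case i of 0 \<Rightarrow> \<lambda>v. v (Suc 0) | Suc 0 \<Rightarrow> \<lambda>v. v 0 | Suc (Suc i) \<Rightarrow> \<lambda>_. v i)"
      for i :: nat
    have "T0 (s i)" for i unfolding s_def by (auto split: nat.split intro: T0_var T0_const)
    from D0_subst[OF D this] have "D0 (\<lambda>v. D (\<lambda>i. s i v))" .
    moreover have "(\<lambda>i. s i u) = case_nat (u (Suc 0)) (case_nat (u 0) v)" for u
      by (auto simp: s_def split: nat.split)
    ultimately have S: "Sig (\<lambda>u. D (case_nat (u 1) (case_nat (u 0) v)))"
      by (simp add: Sig_D0)
    assume "\<forall>a. a \<prec> v k \<longrightarrow> Q a v"
    then have "\<And>a. a \<prec> v k \<Longrightarrow> \<exists>z. D (case_nat z (case_nat a v))" unfolding Q by blast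
    from Sig_collection[of "\<lambda>a z. D (case_nat z (case_nat a v))", OF S this]
    show "\<exists>w. \<forall>a. a \<prec> v k \<longrightarrow> (\<exists>z. z \<prec> w \<and> D (case_nat z (case_nat a v)))" .
  qed (unfold Q, blast)
  ultimately show ?thesis
    unfolding Sig_def by (intro exI[of _ "\<lambda>v. \<forall>a. a \<prec> v (Suc k) \<longrightarrow> (\<exists>z. z \<prec> v 0 \<and> D (case_nat z (case_nat a (\<lambda>i. v (Suc i)))))"]) simp
qed

lemma Sig_ball:
  assumes "Fn t" "Sig (\<lambda>v. Q (v 0) (\<lambda>i. v (Suc i)))"
  shows "Sig (\<lambda>v. \<forall>a. a \<prec> t v \<longrightarrow> Q a v)"
proof -
  have "(\<lambda>i. v (case_nat 0 (\<lambda>i. i + 2) i)) = case_nat (v 0) (\<lambda>i. v (Suc (Suc i)))" for v :: "nat \<Rightarrow> 'n"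
    by (auto split: nat.split)
  with Sig_ren[OF assms(2), of "case_nat 0 (\<lambda>i. i + 2)"]
  have "Sig (\<lambda>v. Q (v 0) (\<lambda>i. v (Suc (Suc i))))" by simp
  from Sig_ball_var[of "\<lambda>a v. Q a (\<lambda>i. v (Suc i))", OF this]
  show ?thesis by (rule Sig_let[OF assms(1), of "\<lambda>b v. \<forall>a. a \<prec> b \<longrightarrow> Q a v"])
qed

lemma Sig_bex:
  assumes "Fn t" "Sig (\<lambda>v. Q (v 0) (\<lambda>i. v (Suc i)))"
  shows "Sig (\<lambda>v. \<exists>a. a \<prec> t v \<and> Q a v)"
  by (rule Sig_ex[of "\<lambda>a v. a \<prec> t v \<and> Q a v"])
    (intro Sig_conj Sig_Del[OF Del_less] Fn_var Fn_shift assms)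

lemma Del_not: "Del P \<Longrightarrow> Del (\<lambda>v. \<not> P v)"
  by (simp add: Del_def)
lemma Del_conj: "Del P \<Longrightarrow> Del Q \<Longrightarrow> Del (\<lambda>v. P v \<and> Q v)"
  using Sig_disj[of "\<lambda>v. \<not> P v" "\<lambda>v. \<not> Q v"] by (simp add: Del_def Sig_conj)
lemma Del_disj: "Del P \<Longrightarrow> Del Q \<Longrightarrow> Del (\<lambda>v. P v \<or> Q v)"
  using Del_not[OF Del_conj[OF Del_not Del_not]] by simp
lemma Del_imp: "Del P \<Longrightarrow> Del Q \<Longrightarrow> Del (\<lambda>v. P v \<longrightarrow> Q v)"
  unfolding imp_conv_disj by (intro Del_disj Del_not)
lemma Del_iff: "Del P \<Longrightarrow> Del Q \<Longrightarrow> Del (\<lambda>v. P v \<longleftrightarrow> Q v)"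
  unfolding iff_conv_conj_imp by (intro Del_conj Del_imp)
lemma Del_ball:
  "Fn t \<Longrightarrow> Del (\<lambda>v. Q (v 0) (\<lambda>i. v (Suc i))) \<Longrightarrow> Del (\<lambda>v. \<forall>a. a \<prec> t v \<longrightarrow> Q a v)"
  using Sig_ball[of t Q] Sig_bex[of t "\<lambda>a v. \<not> Q a v"] by (simp add: Del_def)
lemma Del_bex:
  "Fn t \<Longrightarrow> Del (\<lambda>v. Q (v 0) (\<lambda>i. v (Suc i))) \<Longrightarrow> Del (\<lambda>v. \<exists>a. a \<prec> t v \<and> Q a v)"
  using Sig_bex[of t Q] Sig_ball[of t "\<lambda>a v. \<not> Q a v"] by (simp add: Del_def)
lemma Del_ball_le:
  "Fn t \<Longrightarrow> Del (\<lambda>v. Q (v 0) (\<lambda>i. v (Suc i))) \<Longrightarrow> Del (\<lambda>v. \<forall>a. a \<preceq> t v \<longrightarrow> Q a v)"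
  using Del_ball[of "\<lambda>v. t v \<oplus> \<one>" Q] by (simp add: less_suc Fn_add Fn_const)
lemma Del_bex_le:
  "Fn t \<Longrightarrow> Del (\<lambda>v. Q (v 0) (\<lambda>i. v (Suc i))) \<Longrightarrow> Del (\<lambda>v. \<exists>a. a \<preceq> t v \<and> Q a v)"
  using Del_bex[of "\<lambda>v. t v \<oplus> \<one>" Q] by (simp add: less_suc Fn_add Fn_const)

lemma Fn_T0_subst:
  assumes s: "\<And>i. Fn (s i)"
  shows "T0 t \<Longrightarrow> Fn (\<lambda>v. t (\<lambda>i. s i v))"
  by (induction rule: T0.induct) (simp_all add: s Fn_const Fn_add Fn_mul)

lemma Del_D0_subst:
  "D0 P \<Longrightarrow> (\<And>i. Fn (s i)) \<Longrightarrow> Del (\<lambda>v. P (\<lambda>i. s i v))"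
proof (induction arbitrary: s rule: D0.induct)
  case (D0_eq t u)
  show ?case using Del_eq[OF Fn_T0_subst[OF D0_eq.prems D0_eq.hyps(1)] Fn_T0_subst[OF D0_eq.prems D0_eq.hyps(2)]] .
next
  case (D0_less t u)
  show ?case using Del_less[OF Fn_T0_subst[OF D0_less.prems D0_less.hyps(1)] Fn_T0_subst[OF D0_less.prems D0_less.hyps(2)]] .
next
  case (D0_mem t A)
  show ?case using Del_mem[OF Fn_T0_subst[OF D0_mem.prems D0_mem.hyps(1)] D0_mem.hyps(2)] .
next
  case (D0_not P)
  show ?case using Del_not[OF D0_not.IH[OF D0_not.prems]] .
next
  case (D0_conj P Q)
  show ?case using Del_conj[OF D0_conj.IH(1)[OF D0_conj.prems] D0_conj.IH(2)[OF D0_conj.prems]] .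
next
  case (D0_bex' P t)
  define s' where "s' i = (case i of 0 \<Rightarrow> \<lambda>v. v 0 | Suc k \<Rightarrow> \<lambda>v. s k (\<lambda>i. v (Suc i)))" for i
  have "Fn (s' i)" for i
    using Fn_shift[OF D0_bex'.prems] Fn_var by (cases i) (simp_all add: s'_def)
  from D0_bex'.IH[OF this]
  have "Del (\<lambda>v. P (\<lambda>i. s' i v))" .
  moreover have "(\<lambda>i. s' i v) = case_nat (v 0) (\<lambda>k. s k (\<lambda>i. v (Suc i)))" for v
    by (auto simp: s'_def split: nat.split)
  ultimately have "Del (\<lambda>v. P (case_nat (v 0) (\<lambda>k. s k (\<lambda>i. v (Suc i)))))" by simp
  from Del_bex[of _ "\<lambda>a v. P (case_nat a (\<lambda>k. s k v))", OF Fn_T0_subst[OF D0_bex'.prems D0_bex'.hyps(2)] this]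
  show ?case .
qed

lemma Sig_subst:
  assumes "Sig P" "\<And>i. Fn (s i)"
  shows "Sig (\<lambda>v. P (\<lambda>i. s i v))"
proof -
  obtain D where D: "D0 D" "\<And>v. P v \<longleftrightarrow> (\<exists>z. D (case_nat z v))" using assms(1) by (auto simp: Sig_def)
  define s' where "s' i = (case i of 0 \<Rightarrow> \<lambda>v. v 0 | Suc k \<Rightarrow> \<lambda>v. s k (\<lambda>i. v (Suc i)))" for i
  have "Fn (s' i)" for i
    using Fn_shift[OF assms(2)] Fn_var by (cases i) (simp_all add: s'_def)
  from Sig_Del[OF Del_D0_subst[OF D(1) this]]
  have "Sig (\<lambda>v. D (\<lambda>i. s' i v))" .
  moreover have "(\<lambda>i. s' i v) = case_nat (v 0) (\<lambda>k. s k (\<lambda>i. v (Suc i)))" for v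
    by (auto simp: s'_def split: nat.split)
  ultimately have "Sig (\<lambda>v. D (case_nat (v 0) (\<lambda>k. s k (\<lambda>i. v (Suc i)))))" by simp
  from Sig_ex[of "\<lambda>a v. D (case_nat a (\<lambda>k. s k v))", OF this]
  show ?thesis by (simp add: D)
qed

lemma Del_subst: "Del P \<Longrightarrow> (\<And>i. Fn (s i)) \<Longrightarrow> Del (\<lambda>v. P (\<lambda>i. s i v))"
  using Sig_subst[of P s] Sig_subst[of "\<lambda>v. \<not> P v" s] by (simp add: Del_def)

lemma Fn_subst: "Fn t \<Longrightarrow> (\<And>i. Fn (s i)) \<Longrightarrow> Fn (\<lambda>v. t (\<lambda>i. s i v))"
proof -
  assume t: "Fn t" and s: "\<And>i. Fn (s i)"
  have "Fn (case_nat (\<lambda>v. v 0) (\<lambda>k v. s k (\<lambda>i. v (Suc i))) i)" for i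
    using Fn_shift[OF s] Fn_var by (cases i) simp_all
  from Sig_subst[where s="case_nat (\<lambda>v. v 0) (\<lambda>k v. s k (\<lambda>i. v (Suc i)))", OF t[unfolded Fn_def] this]
  show ?thesis by (simp add: Fn_def)
qed

lemma Del1: "Del (\<lambda>v. R (v 0)) \<Longrightarrow> Fn t \<Longrightarrow> Del (\<lambda>v. R (t v))"
  using Del_subst[of "\<lambda>v. R (v 0)" "\<lambda>_. t"] by simp
lemma Fn1: "Fn (\<lambda>v. f (v 0)) \<Longrightarrow> Fn t \<Longrightarrow> Fn (\<lambda>v. f (t v))"
  using Fn_subst[of "\<lambda>v. f (v 0)" "\<lambda>_. t"] by simp

lemma Fn_case: "Fn t \<Longrightarrow> (\<And>i. Fn (s i)) \<Longrightarrow> Fn (case_nat t s i)"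
  by (cases i) auto

lemma Sig2: "Sig (\<lambda>v. R (v 0) (v 1)) \<Longrightarrow> Fn t \<Longrightarrow> Fn u \<Longrightarrow> Sig (\<lambda>v. R (t v) (u v))"
  using Sig_subst[of "\<lambda>v. R (v 0) (v 1)" "case_nat t (\<lambda>_. u)"] by (simp add: Fn_case)
lemma Fn2: "Fn (\<lambda>v. f (v 0) (v 1)) \<Longrightarrow> Fn t \<Longrightarrow> Fn u \<Longrightarrow> Fn (\<lambda>v. f (t v) (u v))"
  using Fn_subst[of "\<lambda>v. f (v 0) (v 1)" "case_nat t (\<lambda>_. u)"] by (simp add: Fn_case)
lemma Sig3: "Sig (\<lambda>v. R (v 0) (v 1) (v 2)) \<Longrightarrow> Fn t \<Longrightarrow> Fn u \<Longrightarrow> Fn w \<Longrightarrow> Sig (\<lambda>v. R (t v) (u v) (w v))"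
  using Sig_subst[of "\<lambda>v. R (v 0) (v 1) (v 2)" "case_nat t (case_nat u (\<lambda>_. w))"]
  by (simp add: Fn_case numeral_2_eq_2)

lemmas Fn_intros = Fn_const Fn_var Fn_add Fn_mul
lemmas Del_intros = Del_ball Del_ball_le Del_bex Del_bex_le Del_conj Del_disj Del_imp Del_iff Del_not
  Del_less Del_leq Del_eq Fn_intros

section \<open>Least elements and \<open>\<Sigma>\<^sub>1\<close> uniformization\<close>

lemma Del_least:
  assumes P: "Del (\<lambda>v. P (v 0))" and "P a"
  obtains m where "P m" "\<And>b. b \<prec> m \<Longrightarrow> \<not> P b"
proof -
  have "\<exists>m. P m \<and> (\<forall>b. b \<prec> m \<longrightarrow> \<not> P b)"
  proof (rule ccontr)
    assume no: "\<nexists>m. P m \<and> (\<forall>b. b \<prec> m \<longrightarrow> \<not> P b)"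
    have "Del (\<lambda>v. \<forall>b. b \<prec> v 0 \<longrightarrow> \<not> P b)"
      by (intro Del_intros Del1[of P, OF P])
    from Sig_Del[OF this] have "\<forall>b. b \<prec> n \<longrightarrow> \<not> P b" for n
    proof (rule Sig_induct)
      fix n assume "\<forall>b. b \<prec> n \<longrightarrow> \<not> P b"
      with no show "\<forall>b. b \<prec> n \<oplus> \<one> \<longrightarrow> \<not> P b" by (auto simp: less_suc leq_def)
    qed (simp add: basic)
    from this[of "a \<oplus> \<one>"] \<open>P a\<close> show False by simp
  qed
  with that show ?thesis by blast
qed

lemma Del_induct: "Del (\<lambda>v. P (v 0)) \<Longrightarrow> P \<zero> \<Longrightarrow> (\<And>a. P a \<Longrightarrow> P (a \<oplus> \<one>)) \<Longrightarrow> P a"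
  by (rule Sig_induct[OF Sig_Del])

text \<open>Picking the least \<open>d\<close> outright need not be \<open>\<Sigma>\<^sub>1\<close>.
  Instead one takes the least stage \<open>w\<close> at which some \<open>d\<close> below
  \<open>w\<close> is verified by a witness below \<open>w\<close>, and then the least
  \<open>d\<close> verified at that stage; both searches are decidable.\<close>

lemma Sig_choice:
  assumes S: "Sig (\<lambda>v. R (v 0) (\<lambda>i. v (Suc i)))" and ex: "\<And>v. \<exists>d. R d v"
  obtains t where "Fn t" "\<And>v. R (t v) v"
proof -
  obtain D where D: "D0 D" and RD: "\<And>v. R (v 0) (\<lambda>i. v (Suc i)) \<longleftrightarrow> (\<exists>z. D (case_nat z v))"
    using S by (auto simp: Sig_def)
  have R: "R d v \<longleftrightarrow> (\<exists>z. D (case_nat z (case_nat d v)))" for d v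
    using RD[of "case_nat d v"] by simp
  define B where "B w d v \<longleftrightarrow> (\<exists>z. z \<prec> w \<and> D (case_nat z (case_nat d v)))" for w d v
  define C where "C w v \<longleftrightarrow> (\<exists>d. d \<prec> w \<and> B w d v)" for w v
  have DB: "Del (\<lambda>v. B (t v) (u v) (\<lambda>i. s i v))" if "Fn t" "Fn u" "\<And>i. Fn (s i)" for t u s
  proof -
    have "Del (\<lambda>v. D (\<lambda>i. case_nat (\<lambda>v. v 0) (case_nat (\<lambda>v. u (\<lambda>i. v (Suc i))) (\<lambda>i v. s i (\<lambda>i. v (Suc i)))) i v))"
      by (intro Del_D0_subst[OF D] Fn_case Fn_var Fn_shift that)
    moreover have "(\<lambda>i. case_nat (\<lambda>v. v 0) (case_nat (\<lambda>v. u (\<lambda>i. v (Suc i))) (\<lambda>i v. s i (\<lambda>i. v (Suc i)))) i v)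
       = case_nat (v 0) (case_nat (u (\<lambda>i. v (Suc i))) (\<lambda>i. s i (\<lambda>i. v (Suc i))))" for v
      by (auto split: nat.split)
    ultimately show ?thesis unfolding B_def by (intro Del_bex that) simp
  qed
  have DC: "Del (\<lambda>v. C (t v) (\<lambda>i. s i v))" if "Fn t" "\<And>i. Fn (s i)" for t s
    unfolding C_def by (intro Del_bex DB that Fn_shift Fn_var)
  define G where "G d v \<longleftrightarrow> (\<exists>w. (C w v \<and> (\<forall>w'. w' \<prec> w \<longrightarrow> \<not> C w' v)) \<and> (B w d v \<and> (\<forall>d'. d' \<prec> d \<longrightarrow> \<not> B w d' v)))" for d v
  have SG: "Sig (\<lambda>v. G (v 0) (\<lambda>i. v (Suc i)))"
    unfolding G_def by (intro Sig_ex Sig_Del Del_conj Del_ball Del_not DB DC Fn_var)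
  have exG: "\<exists>d. G d v" for v
  proof -
    from ex[of v] obtain d z where "D (case_nat z (case_nat d v))" unfolding R by blast
    moreover obtain w where "d \<prec> w" "z \<prec> w" using bound2 by blast
    ultimately have "C w v" unfolding C_def B_def by blast
    moreover have "Del (\<lambda>u. C (u 0) v)" using DC[of "\<lambda>u. u 0" "\<lambda>i _. v i"] by (simp add: Fn_var Fn_const)
    ultimately obtain w where w: "C w v" "\<And>w'. w' \<prec> w \<Longrightarrow> \<not> C w' v"
      using Del_least[of "\<lambda>w. C w v"] by blast
    have "Del (\<lambda>u. B w (u 0) v)" using DB[of "\<lambda>u. w" "\<lambda>u. u 0" "\<lambda>i _. v i"] by (simp add: Fn_var Fn_const)
    with w(1) obtain d where "B w d v" "\<And>d'. d' \<prec> d \<Longrightarrow> \<not> B w d' v"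
      unfolding C_def using Del_least[of "\<lambda>d. B w d v"] by blast
    with w show ?thesis unfolding G_def by blast
  qed
  have unG: "d = d'" if "G d v" "G d' v" for d d' v
    using that unfolding G_def by (metis linear)
  define t where "t v = (THE d. G d v)" for v
  have t: "G d v \<longleftrightarrow> d = t v" for d v
    unfolding t_def using exG unG by (metis theI)
  show ?thesis
  proof (rule that)
    show "Fn t" unfolding Fn_def using SG by (simp add: t)
    show "R (t v) v" for v using t[of "t v" v] unfolding G_def B_def R by blast
  qed
qed

lemma Sig_choice1:
  assumes S: "Sig (\<lambda>v. R (v 0) (v 1))" and ex: "\<And>i. \<exists>d. R i d"
  obtains f where "Fn (\<lambda>v. f (v 0))" "\<And>i. R i (f i)"
proof -
  have "Sig (\<lambda>v. R (v (Suc 0)) (v 0))"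
    using Sig2[of R "\<lambda>v. v (Suc 0)" "\<lambda>v. v 0", OF S] Fn_var by simp
  from Sig_choice[of "\<lambda>d v. R (v 0) d", OF this ex]
  obtain t where t: "Fn t" "\<And>v. R (v 0) (t v)" by blast
  show ?thesis
    by (rule that[of "\<lambda>i. t (\<lambda>_. i)"]) (use t Fn_ren[OF t(1), of "\<lambda>_. 0"] t(2)[of "\<lambda>_. _"] in simp_all)
qed

subsection \<open>Pairs and finite sets\<close>

text \<open>Unlike Cantor's pairing this one avoids halving. Codes of pairs with sum
  \<open>s\<close> lie between the square of \<open>s\<close> and that square plus \<open>s\<close>,
  hence below the square of \<open>s + 1\<close>; so the map is injective, though not onto.\<close>

definition pr :: "'n \<Rightarrow> 'n \<Rightarrow> 'n" where
  "pr i c = (i \<oplus> c) \<otimes> (i \<oplus> c) \<oplus> i"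

lemma pr_sum_less: "i \<oplus> c \<prec> i' \<oplus> c' \<Longrightarrow> pr i c \<prec> pr i' c'"
proof -
  assume "i \<oplus> c \<prec> i' \<oplus> c'"
  then have "i \<oplus> c \<oplus> \<one> \<preceq> i' \<oplus> c'" by (simp add: suc_le)
  then have "(i \<oplus> c \<oplus> \<one>) \<otimes> (i \<oplus> c \<oplus> \<one>) \<preceq> (i' \<oplus> c') \<otimes> (i' \<oplus> c')"
    by (intro mul_mono)
  moreover have "(i \<oplus> c \<oplus> \<one>) \<otimes> (i \<oplus> c \<oplus> \<one>) = pr i c \<oplus> (i \<oplus> c \<oplus> c \<oplus> \<one>)"
    by (simp add: pr_def distrib_left distrib_right mul_one one_mul add_ac)
  ultimately have "pr i c \<oplus> (i \<oplus> c \<oplus> c \<oplus> \<one>) \<preceq> pr i' c'"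
    using le_add(1)[of "(i' \<oplus> c') \<otimes> (i' \<oplus> c')" i'] unfolding pr_def by order
  moreover have "pr i c \<prec> pr i c \<oplus> (i \<oplus> c \<oplus> c \<oplus> \<one>)"
    unfolding less_iff_add by blast
  ultimately show ?thesis by order
qed

lemma pr_inj: "pr i c = pr i' c' \<longleftrightarrow> i = i' \<and> c = c'"
proof
  assume eq: "pr i c = pr i' c'"
  then have "i \<oplus> c = i' \<oplus> c'"
    using pr_sum_less[of i c i' c'] pr_sum_less[of i' c' i c] linear[of "i \<oplus> c" "i' \<oplus> c'"]
    by (auto simp: less_irrefl)
  with eq show "i = i' \<and> c = c'" by (auto simp: pr_def)
qed simp

lemma le_square: "a \<preceq> a \<otimes> a"
  using mul_mono[of \<one> a a a] by (cases "a = \<zero>") (auto simp: one_mul pos_iff suc_le[of \<zero>, unfolded zero_add])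

lemma pr_ge: "i \<preceq> pr i c" "c \<preceq> pr i c"
  using le_square[of "i \<oplus> c"] le_add[of "(i \<oplus> c) \<otimes> (i \<oplus> c)" i] le_add[of i c] le_add(2)[of c i] le_add(2)[of i "(i \<oplus> c) \<otimes> (i \<oplus> c)"]
  unfolding pr_def by order+

lemma pr_mono: "c \<preceq> c' \<Longrightarrow> pr i c \<preceq> pr i c'"
  unfolding pr_def by (intro add_mono mul_mono) auto

lemma Fn_pr: "Fn t \<Longrightarrow> Fn u \<Longrightarrow> Fn (\<lambda>v. pr (t v) (u v))"
  unfolding pr_def by (intro Fn_add Fn_mul)

section \<open>Divisibility and coded finite sets\<close>

definition divides :: "'n \<Rightarrow> 'n \<Rightarrow> bool" where
  "divides x y \<longleftrightarrow> (\<exists>k. y = x \<otimes> k)"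

text \<open>A variant of Goedel's beta function: \<open>u\<close> belongs to the set coded by
  \<open>a\<close> and \<open>b\<close> if the modulus attached to \<open>u\<close> divides
  \<open>a\<close>.\<close>

definition el :: "'n \<Rightarrow> 'n \<Rightarrow> 'n \<Rightarrow> bool" where
  "el a b u \<longleftrightarrow> divides (((u \<oplus> \<one>) \<otimes> b) \<oplus> \<one>) a"

lemma divides_bound:
  assumes "x \<noteq> \<zero>" shows "divides x y \<longleftrightarrow> (\<exists>k. k \<preceq> y \<and> y = x \<otimes> k)"
proof -
  have "k \<preceq> x \<otimes> k" for k
    using mul_mono[of \<one> x k k] assms by (simp add: one_mul pos_iff[symmetric] suc_le[of \<zero>, unfolded zero_add])
  then show ?thesis unfolding divides_def by blast
qed

lemma Del_el: "Fn t \<Longrightarrow> Fn u \<Longrightarrow> Fn w \<Longrightarrow> Del (\<lambda>v. el (t v) (u v) (w v))"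
  unfolding el_def divides_bound[OF basic(1)]
  by (intro Del_intros Fn_shift)

lemma divides_mul: "divides x a \<Longrightarrow> divides x (a \<otimes> b)"
  unfolding divides_def by (metis mul_assoc)

text \<open>Replaces subtraction: the cofactor of \<open>b\<close> is the difference of the
  cofactors of \<open>a \<oplus> b\<close> and \<open>a\<close>.\<close>

lemma divides_diff:
  assumes "divides x a" "divides x (a \<oplus> b)" shows "divides x b"
proof (cases "b = \<zero>")
  case True then show ?thesis unfolding divides_def by (metis basic(5))
next
  case False
  obtain k l where k: "a = x \<otimes> k" and l: "a \<oplus> b = x \<otimes> l" using assms by (auto simp: divides_def)
  have "k \<preceq> l"
  proof (rule ccontr)
    assume "\<not> k \<preceq> l"
    then have "x \<otimes> l \<preceq> x \<otimes> k" by (intro mul_mono) order+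
    moreover have "a \<prec> a \<oplus> b" using add_less_le_mono[of \<zero> b a a] False
      by (simp add: pos_iff zero_add add_commute basic(3))
    ultimately show False using k l by (metis ord.not_le)
  qed
  then obtain m where "l = k \<oplus> m" unfolding leq_iff_add by blast
  with k l have "a \<oplus> b = a \<oplus> x \<otimes> m" by (simp add: distrib_left)
  then show ?thesis by (auto simp: divides_def)
qed

text \<open>The moduli \<open>m\<^sub>u = (u + 1) b + 1\<close> are pairwise coprime: \<open>(v + 1) m\<^sub>u + k = (u + 1) m\<^sub>v\<close> if
  \<open>u = v + k\<close>, and \<open>k\<close> divides \<open>b\<close>, which is invertible modulo \<open>m\<^sub>v\<close>.\<close>

lemma modulus_coprime:
  fixes u v b
  defines "x \<equiv> ((u \<oplus> \<one>) \<otimes> b) \<oplus> \<one>" and "y \<equiv> ((v \<oplus> \<one>) \<otimes> b) \<oplus> \<one>"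
  assumes uv: "u = v \<oplus> k \<or> v = u \<oplus> k" and k: "divides k b" and d: "divides y (a \<otimes> x)"
  shows "divides y a"
proof -
  have ak: "divides y (a \<otimes> k)"
    using uv
  proof
    assume u: "u = v \<oplus> k"
    have "(v \<oplus> \<one>) \<otimes> x \<oplus> k = (u \<oplus> \<one>) \<otimes> y"
      unfolding x_def y_def u by (simp add: distrib_left distrib_right one_mul mul_one mul_ac add_ac)
    then have "(a \<otimes> x) \<otimes> (v \<oplus> \<one>) \<oplus> a \<otimes> k = y \<otimes> (a \<otimes> (u \<oplus> \<one>))"
      by (metis distrib_left mul_assoc mul_commute)
    then show ?thesis using d divides_mul divides_diff unfolding divides_def by metis
  next
    assume v: "v = u \<oplus> k"
    have "(v \<oplus> \<one>) \<otimes> x = (u \<oplus> \<one>) \<otimes> y \<oplus> k"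
      unfolding x_def y_def v by (simp add: distrib_left distrib_right one_mul mul_one mul_ac add_ac)
    then have "(a \<otimes> x) \<otimes> (v \<oplus> \<one>) = y \<otimes> (a \<otimes> (u \<oplus> \<one>)) \<oplus> a \<otimes> k"
      by (metis distrib_left mul_assoc mul_commute)
    then show ?thesis using divides_mul[OF d] divides_diff unfolding divides_def by metis
  qed
  \<comment> \<open>Modulo \<open>y\<close> the product \<open>b (v + 1)\<close> is -1, so
    multiplying \<open>a k\<close> by \<open>q (v + 1)\<close> gives \<open>-a\<close>.\<close>
  from k obtain q where q: "b = k \<otimes> q" unfolding divides_def by blast
  have "divides y ((a \<otimes> k) \<otimes> (q \<otimes> (v \<oplus> \<one>)))" by (rule divides_mul[OF ak])
  moreover have "(a \<otimes> k) \<otimes> (q \<otimes> (v \<oplus> \<one>)) \<oplus> a = y \<otimes> a"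
    unfolding y_def q by (simp add: distrib_left distrib_right one_mul mul_one mul_ac add_ac)
  ultimately show ?thesis using divides_diff unfolding divides_def by metis
qed

text \<open>Plays the role of the factorial of \<open>n\<close> and is built in the same way, by
  multiplying with \<open>n + 1\<close> in an induction.\<close>

lemma common_multiple: "\<exists>b. b \<noteq> \<zero> \<and> (\<forall>k. k \<preceq> n \<longrightarrow> k \<noteq> \<zero> \<longrightarrow> divides k b)"
proof -
  have "Sig (\<lambda>v. \<exists>b. b \<noteq> \<zero> \<and> (\<forall>k. k \<preceq> v 0 \<longrightarrow> k \<noteq> \<zero> \<longrightarrow> (\<exists>q. q \<preceq> b \<and> b = k \<otimes> q)))"
    by (intro Sig_ex Sig_Del Del_intros)
  then have "\<exists>b. b \<noteq> \<zero> \<and> (\<forall>k. k \<preceq> n \<longrightarrow> k \<noteq> \<zero> \<longrightarrow> (\<exists>q. q \<preceq> b \<and> b = k \<otimes> q))"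
  proof (rule Sig_induct)
    have "\<one> \<noteq> \<zero>" using basic(1)[of \<zero>] by (simp add: zero_add)
    then show "\<exists>b. b \<noteq> \<zero> \<and> (\<forall>k. k \<preceq> \<zero> \<longrightarrow> k \<noteq> \<zero> \<longrightarrow> (\<exists>q. q \<preceq> b \<and> b = k \<otimes> q))"
      by (auto simp: leq_def basic(7))
    fix n assume "\<exists>b. b \<noteq> \<zero> \<and> (\<forall>k. k \<preceq> n \<longrightarrow> k \<noteq> \<zero> \<longrightarrow> (\<exists>q. q \<preceq> b \<and> b = k \<otimes> q))"
    then obtain b where b: "b \<noteq> \<zero>" "\<And>k. k \<preceq> n \<Longrightarrow> k \<noteq> \<zero> \<Longrightarrow> divides k b"
      by (auto simp: divides_def)
    have "b \<otimes> (n \<oplus> \<one>) \<noteq> \<zero>"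
      using b(1) mul_mono[of b b \<one> "n \<oplus> \<one>"] le_add(2)[of \<one> n] zero_le[of b]
      by (auto simp: mul_one) (metis leq_def basic(7))
    moreover have "\<exists>q. q \<preceq> b \<otimes> (n \<oplus> \<one>) \<and> b \<otimes> (n \<oplus> \<one>) = k \<otimes> q" if "k \<preceq> n \<oplus> \<one>" "k \<noteq> \<zero>" for k
    proof -
      have "divides k (b \<otimes> (n \<oplus> \<one>))"
      proof (cases "k \<preceq> n")
        case True then show ?thesis using b(2) that(2) by (intro divides_mul)
      next
        case False
        with that have "k = n \<oplus> \<one>" by (auto simp: leq_def less_suc)
        then show ?thesis unfolding divides_def by (metis mul_commute)
      qed
      then show ?thesis using divides_bound[OF that(2)] by blast
    qed
    ultimately show "\<exists>b. b \<noteq> \<zero> \<and> (\<forall>k. k \<preceq> n \<oplus> \<one> \<longrightarrow> k \<noteq> \<zero> \<longrightarrow> (\<exists>q. q \<preceq> b \<and> b = k \<otimes> q))"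
      by blast
  qed
  then show ?thesis unfolding divides_def by blast
qed

text \<open>With \<open>b\<close> fixed, the code \<open>a\<close> is the product of the moduli of
  the elements of \<open>P\<close>, taken in one at a time by \<open>\<Sigma>\<^sub>1\<close>
  induction.\<close>

lemma finite_code:
  assumes P: "Del (\<lambda>v. P (v 0))"
  shows "\<exists>a b. \<forall>u. u \<prec> N \<longrightarrow> (el a b u \<longleftrightarrow> P u)"
proof -
  obtain b where b: "b \<noteq> \<zero>" "\<And>k. k \<preceq> N \<Longrightarrow> k \<noteq> \<zero> \<Longrightarrow> divides k b"
    using common_multiple by blast
  have "Sig (\<lambda>v. \<exists>a. \<forall>u. u \<prec> N \<longrightarrow> (el a b u \<longleftrightarrow> u \<prec> v 0 \<and> P u))"
    by (intro Sig_ex Sig_Del Del_intros Del_el Del1[of P, OF P])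
  then have "\<exists>a. \<forall>u. u \<prec> N \<longrightarrow> (el a b u \<longleftrightarrow> u \<prec> N \<and> P u)"
  proof (rule Sig_induct)
    \<comment> \<open>The empty product codes the empty set: as \<open>b\<close> is nonzero, every
      modulus exceeds one.\<close>
    have "\<not> el \<one> b u" for u
    proof
      assume "el \<one> b u"
      then obtain k where k: "\<one> = (((u \<oplus> \<one>) \<otimes> b) \<oplus> \<one>) \<otimes> k" by (auto simp: el_def divides_def)
      then have "k \<noteq> \<zero>" by (metis basic(1,5) zero_add)
      then have "\<one> \<preceq> k" by (simp add: pos_iff[symmetric] suc_le[of \<zero>, unfolded zero_add])
      then have "((u \<oplus> \<one>) \<otimes> b) \<oplus> \<one> \<preceq> \<one>"
        using mul_mono[of "((u \<oplus> \<one>) \<otimes> b) \<oplus> \<one>" "((u \<oplus> \<one>) \<otimes> b) \<oplus> \<one>" \<one> k] k by (simp add: mul_one)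
      then have "(u \<oplus> \<one>) \<otimes> b \<prec> \<one>" by (simp add: suc_le)
      moreover have "b \<preceq> (u \<oplus> \<one>) \<otimes> b" by (simp add: distrib_right one_mul)
      ultimately have "b \<prec> \<zero> \<oplus> \<one>" unfolding zero_add by order
      then show False using b(1) zero_le[of b] unfolding less_suc by order
    qed
    then show "\<exists>a. \<forall>u. u \<prec> N \<longrightarrow> (el a b u \<longleftrightarrow> u \<prec> \<zero> \<and> P u)" by (auto simp: basic(7))
    fix n assume "\<exists>a. \<forall>u. u \<prec> N \<longrightarrow> (el a b u \<longleftrightarrow> u \<prec> n \<and> P u)"
    then obtain a where a: "\<And>u. u \<prec> N \<Longrightarrow> (el a b u \<longleftrightarrow> u \<prec> n \<and> P u)" by blast
    show "\<exists>a. \<forall>u. u \<prec> N \<longrightarrow> (el a b u \<longleftrightarrow> u \<prec> n \<oplus> \<one> \<and> P u)"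
    proof (cases "P n \<and> n \<prec> N")
      case False
      then have "\<forall>u. u \<prec> N \<longrightarrow> (el a b u \<longleftrightarrow> u \<prec> n \<oplus> \<one> \<and> P u)" using a by (auto simp: less_suc leq_def)
      then show ?thesis ..
    next
      case True
      define x where "x = ((n \<oplus> \<one>) \<otimes> b) \<oplus> \<one>"
      have "el (a \<otimes> x) b u \<longleftrightarrow> el a b u \<or> u = n" if u: "u \<prec> N" for u
      proof
        assume "el a b u \<or> u = n"
        then show "el (a \<otimes> x) b u"
          unfolding el_def x_def using divides_mul by (metis divides_def mul_commute)
      next
        assume e: "el (a \<otimes> x) b u"
        show "el a b u \<or> u = n"
        proof (rule disjCI)
          assume "u \<noteq> n"
          \<comment> \<open>The distance \<open>k\<close> between \<open>u\<close> and
            \<open>n\<close> is at most \<open>N\<close>, so it divides \<open>b\<close>, and the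
            factor belonging to \<open>n\<close> cannot bring in \<open>u\<close>.\<close>
          then obtain k where k: "n = u \<oplus> k \<or> u = n \<oplus> k" "k \<noteq> \<zero>"
            using linear[of u n] unfolding less_iff_add by (metis basic(1))
          have "k \<preceq> N" using k(1) le_add[of k n] le_add[of k u] u True by (metis ord.less_imp_le ord.order_trans)
          then have "divides k b" using b(2) k(2) by blast
          with modulus_coprime[OF k(1)] e show "el a b u" unfolding el_def x_def by blast
        qed
      qed
      then have "\<forall>u. u \<prec> N \<longrightarrow> (el (a \<otimes> x) b u \<longleftrightarrow> u \<prec> n \<oplus> \<one> \<and> P u)"
        using a True by (auto simp: less_suc leq_def)
      then show ?thesis ..
    qed
  qed
  then show ?thesis by blast
qed

subsection \<open>Iteration\<close>

text \<open>Only backward justification is required: each coded pair is the start or comes from a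
  coded pair one step earlier. Induction on the step then shows that two traces agree.\<close>

definition trace :: "('n \<Rightarrow> 'n) \<Rightarrow> 'n \<Rightarrow> 'n \<Rightarrow> 'n \<Rightarrow> 'n \<Rightarrow> bool" where
  "trace g s a b N \<longleftrightarrow> (\<forall>k. k \<prec> N \<longrightarrow> (\<forall>x. x \<prec> N \<longrightarrow> pr k x \<prec> N \<and> el a b (pr k x) \<longrightarrow>
     (k = \<zero> \<and> x = s) \<or> (\<exists>l. l \<prec> N \<and> (\<exists>y. y \<prec> N \<and> k = l \<oplus> \<one> \<and> x = g y \<and> pr l y \<prec> N \<and> el a b (pr l y)))))"

definition iter_rel :: "('n \<Rightarrow> 'n) \<Rightarrow> 'n \<Rightarrow> 'n \<Rightarrow> 'n \<Rightarrow> bool" where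
  "iter_rel g s n y \<longleftrightarrow> (\<exists>a b N. trace g s a b N \<and> pr n y \<prec> N \<and> el a b (pr n y))"

definition iter :: "('n \<Rightarrow> 'n) \<Rightarrow> 'n \<Rightarrow> 'n \<Rightarrow> 'n" where
  "iter g s n = (THE y. iter_rel g s n y)"

context
  fixes g :: "'n \<Rightarrow> 'n"
  assumes g: "Fn (\<lambda>v. g (v 0))"
begin

lemma Sig_iter_rel: "Sig (\<lambda>v. iter_rel g (v 0) (v 1) (v 2))"
  unfolding iter_rel_def trace_def
  by (intro Sig_ex Sig_Del Del_intros Del_el Fn_pr Fn1[OF g])

lemma trace_step:
  assumes "trace g s a b N" "pr k x \<prec> N" "el a b (pr k x)"
  shows "(k = \<zero> \<and> x = s) \<or> (\<exists>l y. k = l \<oplus> \<one> \<and> x = g y \<and> pr l y \<prec> N \<and> el a b (pr l y))"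
proof -
  have "k \<prec> N" "x \<prec> N" using pr_ge[of k x] pr_ge(2)[of x k] assms(2) by order+
  with assms show ?thesis unfolding trace_def by blast
qed

lemma iter_rel_0: "iter_rel g s \<zero> y \<longleftrightarrow> y = s"
proof
  assume "iter_rel g s \<zero> y"
  then show "y = s" unfolding iter_rel_def using trace_step basic(1) by metis
next
  assume y: "y = s"
  have "Del (\<lambda>v. v 0 = pr \<zero> s)" by (intro Del_intros Fn_pr)
  from finite_code[OF this, of "pr \<zero> s \<oplus> \<one>"] obtain a b
    where "\<And>u. u \<prec> pr \<zero> s \<oplus> \<one> \<Longrightarrow> el a b u \<longleftrightarrow> u = pr \<zero> s" by blast
  then have "trace g s a b (pr \<zero> s \<oplus> \<one>)" "el a b (pr \<zero> s)"
    unfolding trace_def by (auto simp: pr_inj)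
  then show "iter_rel g s \<zero> y" unfolding iter_rel_def y using less_add_one by blast
qed

lemma iter_rel_Suc: "iter_rel g s (n \<oplus> \<one>) y \<longleftrightarrow> (\<exists>x. iter_rel g s n x \<and> y = g x)"
proof
  assume "iter_rel g s (n \<oplus> \<one>) y"
  then show "\<exists>x. iter_rel g s n x \<and> y = g x" unfolding iter_rel_def using trace_step basic(1,2) by metis
next
  assume "\<exists>x. iter_rel g s n x \<and> y = g x"
  then obtain x a b N where y: "y = g x" and t: "trace g s a b N" "pr n x \<prec> N" "el a b (pr n x)"
    unfolding iter_rel_def by blast
  obtain N' where N': "N \<prec> N'" "pr (n \<oplus> \<one>) y \<prec> N'" using bound2 by blast
  \<comment> \<open>A code is not extended in place; the old set together with the new pair is
    decidable and is coded afresh below \<open>N'\<close>.\<close>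
  have "Del (\<lambda>v. (v 0 \<prec> N \<and> el a b (v 0)) \<or> v 0 = pr (n \<oplus> \<one>) y)" by (intro Del_intros Fn_pr Del_el)
  from finite_code[OF this, of N'] obtain a' b'
    where e: "\<And>u. u \<prec> N' \<Longrightarrow> el a' b' u \<longleftrightarrow> (u \<prec> N \<and> el a b u) \<or> u = pr (n \<oplus> \<one>) y" by blast
  have "trace g s a' b' N'" unfolding trace_def
  proof (intro allI impI)
    fix k z assume "k \<prec> N'" "z \<prec> N'" and kz: "pr k z \<prec> N' \<and> el a' b' (pr k z)"
    have "k = \<zero> \<and> z = s \<or> (\<exists>l u. k = l \<oplus> \<one> \<and> z = g u \<and> pr l u \<prec> N \<and> el a b (pr l u))"
    proof (cases "pr k z = pr (n \<oplus> \<one>) y")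
      case True then show ?thesis using t y by (auto simp: pr_inj)
    next
      case False then show ?thesis using kz e[of "pr k z"] trace_step[OF t(1)] by blast
    qed
    moreover have "l \<prec> N' \<and> u \<prec> N' \<and> pr l u \<prec> N' \<and> el a' b' (pr l u)" if "pr l u \<prec> N" "el a b (pr l u)" for l u
    proof -
      have "l \<prec> N'" "u \<prec> N'" "pr l u \<prec> N'" using pr_ge[of l u] pr_ge(2)[of u l] that(1) N'(1) by order+
      then show ?thesis using e that by blast
    qed
    ultimately show "k = \<zero> \<and> z = s \<or> (\<exists>l. l \<prec> N' \<and> (\<exists>y. y \<prec> N' \<and> k = l \<oplus> \<one> \<and> z = g y \<and> pr l y \<prec> N' \<and> el a' b' (pr l y)))"
      by blast
  qed
  moreover have "el a' b' (pr (n \<oplus> \<one>) y)" using e N'(2) by blast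
  ultimately show "iter_rel g s (n \<oplus> \<one>) y" unfolding iter_rel_def using N'(2) by blast
qed

lemma iter_rel_ex: "\<exists>y. iter_rel g s n y"
proof -
  have "Sig (\<lambda>v. \<exists>y. iter_rel g s (v 0) y)"
    by (intro Sig_ex Sig3[of "iter_rel g", OF Sig_iter_rel] Fn_intros)
  then show ?thesis
    by (rule Sig_induct) (use iter_rel_0 iter_rel_Suc in blast)+
qed

lemma iter_rel_unique:
  assumes "iter_rel g s n y" "iter_rel g s n y'" shows "y = y'"
proof -
  obtain a b N where t: "trace g s a b N" "pr n y \<prec> N" "el a b (pr n y)"
    using assms(1) unfolding iter_rel_def by blast
  obtain a' b' N' where t': "trace g s a' b' N'" "pr n y' \<prec> N'" "el a' b' (pr n y')"
    using assms(2) unfolding iter_rel_def by blast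
  \<comment> \<open>Comparing the two traces below their own bounds keeps the statement decidable,
    so induction on the step applies.\<close>
  have "Del (\<lambda>v. \<forall>x. x \<prec> N \<longrightarrow> (\<forall>x'. x' \<prec> N' \<longrightarrow> pr (v 0) x \<prec> N \<and> el a b (pr (v 0) x) \<and>
      pr (v 0) x' \<prec> N' \<and> el a' b' (pr (v 0) x') \<longrightarrow> x = x'))"
    by (intro Del_intros Fn_pr Del_el)
  then have "\<forall>x. x \<prec> N \<longrightarrow> (\<forall>x'. x' \<prec> N' \<longrightarrow> pr n x \<prec> N \<and> el a b (pr n x) \<and>
      pr n x' \<prec> N' \<and> el a' b' (pr n x') \<longrightarrow> x = x')"
  proof (rule Del_induct)
    show "\<forall>x. x \<prec> N \<longrightarrow> (\<forall>x'. x' \<prec> N' \<longrightarrow> pr \<zero> x \<prec> N \<and> el a b (pr \<zero> x) \<and>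
      pr \<zero> x' \<prec> N' \<and> el a' b' (pr \<zero> x') \<longrightarrow> x = x')"
      using trace_step[OF t(1)] trace_step[OF t'(1)] basic(1) by metis
    fix k assume IH: "\<forall>x. x \<prec> N \<longrightarrow> (\<forall>x'. x' \<prec> N' \<longrightarrow> pr k x \<prec> N \<and> el a b (pr k x) \<and>
      pr k x' \<prec> N' \<and> el a' b' (pr k x') \<longrightarrow> x = x')"
    show "\<forall>x. x \<prec> N \<longrightarrow> (\<forall>x'. x' \<prec> N' \<longrightarrow> pr (k \<oplus> \<one>) x \<prec> N \<and> el a b (pr (k \<oplus> \<one>) x) \<and>
      pr (k \<oplus> \<one>) x' \<prec> N' \<and> el a' b' (pr (k \<oplus> \<one>) x') \<longrightarrow> x = x')"
    proof (intro allI impI, elim conjE)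
      fix x x' assume h: "pr (k \<oplus> \<one>) x \<prec> N" "el a b (pr (k \<oplus> \<one>) x)" "pr (k \<oplus> \<one>) x' \<prec> N'" "el a' b' (pr (k \<oplus> \<one>) x')"
      obtain z where z: "x = g z" "pr k z \<prec> N" "el a b (pr k z)"
        using trace_step[OF t(1) h(1,2)] basic(1,2) by metis
      obtain z' where z': "x' = g z'" "pr k z' \<prec> N'" "el a' b' (pr k z')"
        using trace_step[OF t'(1) h(3,4)] basic(1,2) by metis
      have "z \<prec> N" "z' \<prec> N'" using pr_ge(2)[of z k] pr_ge(2)[of z' k] z(2) z'(2) by order+
      with IH z z' show "x = x'" by blast
    qed
  qed
  moreover have "y \<prec> N" "y' \<prec> N'" using pr_ge(2)[of y n] pr_ge(2)[of y' n] t(2) t'(2) by order+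
  ultimately show ?thesis using t t' by blast
qed

lemma iter_rel_iff: "iter_rel g s n y \<longleftrightarrow> y = iter g s n"
  unfolding iter_def using iter_rel_ex iter_rel_unique by (metis theI)

lemma iter_0 [simp]: "iter g s \<zero> = s"
  using iter_rel_0 iter_rel_iff by blast

lemma iter_Suc: "iter g s (n \<oplus> \<one>) = g (iter g s n)"
  using iter_rel_Suc[of s n "iter g s (n \<oplus> \<one>)"] by (simp add: iter_rel_iff)

lemma Fn_iter: "Fn t \<Longrightarrow> Fn u \<Longrightarrow> Fn (\<lambda>v. iter g (t v) (u v))"
proof -
  have "Fn (\<lambda>v. iter g (v 0) (v 1))"
    unfolding Fn_def using Sig3[of "iter_rel g", OF Sig_iter_rel, of "\<lambda>v. v (Suc 0)" "\<lambda>v. v (Suc (Suc 0))" "\<lambda>v. v 0"]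
    by (simp add: Fn_var iter_rel_iff)
  then show "Fn t \<Longrightarrow> Fn u \<Longrightarrow> Fn (\<lambda>v. iter g (t v) (u v))" by (rule Fn2)
qed

text \<open>Iteration is defined by its last step, while lengths and bits are computed by recursion
  on \<open>half s\<close>, which removes the first.\<close>

lemma iter_Suc': "iter g s (n \<oplus> \<one>) = iter g (g s) n"
proof (rule Del_induct[where P="\<lambda>n. iter g s (n \<oplus> \<one>) = iter g (g s) n"])
  show "Del (\<lambda>v. iter g s (v 0 \<oplus> \<one>) = iter g (g s) (v 0))"
    by (intro Del_intros Fn_iter)
  show "iter g s (\<zero> \<oplus> \<one>) = iter g (g s) \<zero>" by (simp only: iter_Suc iter_0)
  show "iter g s (a \<oplus> \<one>) = iter g (g s) a \<Longrightarrow> iter g s (a \<oplus> \<one> \<oplus> \<one>) = iter g (g s) (a \<oplus> \<one>)" for a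
    using iter_Suc[of s "a \<oplus> \<one>"] iter_Suc[of "g s" a] by simp
qed

end

subsection \<open>Binary strings\<close>

lemma even_or_odd: "\<exists>u. x = u \<oplus> u \<or> x = u \<oplus> u \<oplus> \<one>"
proof (rule Sig_induct[where P="\<lambda>x. \<exists>u. x = u \<oplus> u \<or> x = u \<oplus> u \<oplus> \<one>"])
  show "Sig (\<lambda>v. \<exists>u. v 0 = u \<oplus> u \<or> v 0 = u \<oplus> u \<oplus> \<one>)"
    by (intro Sig_ex Sig_Del Del_intros)
  show "\<exists>u. \<zero> = u \<oplus> u \<or> \<zero> = u \<oplus> u \<oplus> \<one>" by (metis basic(3))
  fix x assume "\<exists>u. x = u \<oplus> u \<or> x = u \<oplus> u \<oplus> \<one>"
  then obtain u where "x = u \<oplus> u \<or> x = u \<oplus> u \<oplus> \<one>" ..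
  then show "\<exists>u. x \<oplus> \<one> = u \<oplus> u \<or> x \<oplus> \<one> = u \<oplus> u \<oplus> \<one>"
  proof
    assume "x = u \<oplus> u \<oplus> \<one>"
    then have "x \<oplus> \<one> = (u \<oplus> \<one>) \<oplus> (u \<oplus> \<one>)" by (simp add: add_ac)
    then show ?thesis by blast
  qed blast
qed

lemma double_less: "u \<prec> w \<Longrightarrow> u \<oplus> u \<oplus> \<one> \<prec> w \<oplus> w"
proof -
  assume "u \<prec> w"
  then have "u \<oplus> \<one> \<preceq> w" by (simp add: suc_le)
  from add_mono[OF this this] have "u \<oplus> u \<oplus> \<one> \<oplus> \<one> \<preceq> w \<oplus> w" by (simp add: add_ac)
  then show ?thesis by (simp add: suc_le)
qed

lemma double_inj: "u \<oplus> u = w \<oplus> w \<Longrightarrow> u = w"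
  using double_less[of u w] double_less[of w u] linear[of u w] less_add_one by (metis less_irrefl less_trans)

lemma double_neq: "u \<oplus> u \<noteq> w \<oplus> w \<oplus> \<one>"
proof
  assume eq: "u \<oplus> u = w \<oplus> w \<oplus> \<one>"
  consider "u \<prec> w" | "u = w" | "w \<prec> u" using linear by blast
  then show False
  proof cases
    case 1
    then have "u \<oplus> u \<oplus> \<one> \<prec> w \<oplus> w" by (rule double_less)
    moreover have "u \<oplus> u \<prec> u \<oplus> u \<oplus> \<one>" "w \<oplus> w \<prec> w \<oplus> w \<oplus> \<one>" by simp_all
    ultimately show False using eq by order
  next
    case 2 then show False using eq by (metis less_add_one less_irrefl)
  next
    case 3
    then have "w \<oplus> w \<oplus> \<one> \<prec> u \<oplus> u" by (rule double_less)
    then show False using eq by (simp add: less_irrefl)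
  qed
qed

text \<open>In the heap coding of strings, \<open>half\<close> gives the parent and
  \<open>isodd\<close> the last bit.\<close>

definition half :: "'n \<Rightarrow> 'n" where
  "half x = (THE u. x = u \<oplus> u \<or> x = u \<oplus> u \<oplus> \<one>)"

definition isodd :: "'n \<Rightarrow> bool" where
  "isodd x \<longleftrightarrow> x = half x \<oplus> half x \<oplus> \<one>"

lemma half_iff: "u = half x \<longleftrightarrow> x = u \<oplus> u \<or> x = u \<oplus> u \<oplus> \<one>"
proof -
  have "\<exists>!u. x = u \<oplus> u \<or> x = u \<oplus> u \<oplus> \<one>"
    using even_or_odd[of x] double_neq double_inj by (metis add_cancel)
  from theI'[OF this] this show ?thesis unfolding half_def by blast
qed

lemma half_double [simp]: "half (u \<oplus> u) = u" "half (u \<oplus> u \<oplus> \<one>) = u"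
  using half_iff by metis+

lemma isodd_double [simp]: "\<not> isodd (u \<oplus> u)" "isodd (u \<oplus> u \<oplus> \<one>)"
  by (simp_all add: isodd_def double_neq)

lemma half_cases: "x = half x \<oplus> half x \<and> \<not> isodd x \<or> x = half x \<oplus> half x \<oplus> \<one> \<and> isodd x"
  using half_iff[of "half x" x] isodd_double by metis

lemma Fn_half: "Fn t \<Longrightarrow> Fn (\<lambda>v. half (t v))"
proof -
  have "Fn (\<lambda>v. half (v 0))" unfolding Fn_def half_iff
    by (intro Sig_Del Del_intros)
  then show "Fn t \<Longrightarrow> Fn (\<lambda>v. half (t v))" by (rule Fn1)
qed

lemma Del_isodd: "Fn t \<Longrightarrow> Del (\<lambda>v. isodd (t v))"
  unfolding isodd_def by (intro Del_intros Fn_half)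

abbreviation it :: "'n \<Rightarrow> 'n \<Rightarrow> 'n" where "it \<equiv> iter half"

lemmas half_it = Fn_half[OF Fn_var[of 0]]
lemmas Fn_it = Fn_iter[OF half_it]
lemmas it_Suc = iter_Suc[OF half_it] and it_Suc' = iter_Suc'[OF half_it] and it_0 = iter_0[OF half_it]

lemma one_neq_zero [simp]: "\<one> \<noteq> \<zero>" "\<zero> \<noteq> \<one>"
  using basic(1)[of \<zero>] by (simp_all add: zero_add eq_commute)

lemma zero_less_one [simp]: "\<zero> \<prec> \<one>"
  by (simp add: pos_iff)

lemma half_zero [simp]: "half \<zero> = \<zero>"
  using half_double(1)[of \<zero>] by (simp add: zero_add)

lemma half_less: "x \<noteq> \<zero> \<Longrightarrow> half x \<prec> x"
proof -
  assume x: "x \<noteq> \<zero>"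
  show ?thesis
  proof (cases "half x = \<zero>")
    case True with x show ?thesis by (simp add: pos_iff)
  next
    case False
    then have "half x \<prec> half x \<oplus> half x"
      using add_less_le_mono[of \<zero> "half x" "half x" "half x"] by (simp add: pos_iff zero_add)
    then show ?thesis using half_cases[of x] less_add_one[of "half x \<oplus> half x"] by (metis less_trans)
  qed
qed

lemma le_one_iff: "x \<preceq> \<one> \<longleftrightarrow> x = \<zero> \<or> x = \<one>"
  unfolding leq_def using less_suc[of x \<zero>] by (simp add: zero_add leq_def basic(7))

text \<open>A nonzero value drops by at least one per step, so value plus number of steps does not
  grow. Hence \<open>s\<close> steps bring \<open>s\<close> down to at most one.\<close>

lemma it_bound: "it s n \<preceq> \<one> \<or> it s n \<oplus> n \<preceq> s"
proof (rule Del_induct[where P="\<lambda>n. it s n \<preceq> \<one> \<or> it s n \<oplus> n \<preceq> s"])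
  show "Del (\<lambda>v. it s (v 0) \<preceq> \<one> \<or> it s (v 0) \<oplus> v 0 \<preceq> s)" by (intro Del_intros Fn_it)
  show "it s \<zero> \<preceq> \<one> \<or> it s \<zero> \<oplus> \<zero> \<preceq> s" by (simp add: it_0 basic(3))
  fix n assume IH: "it s n \<preceq> \<one> \<or> it s n \<oplus> n \<preceq> s"
  show "it s (n \<oplus> \<one>) \<preceq> \<one> \<or> it s (n \<oplus> \<one>) \<oplus> (n \<oplus> \<one>) \<preceq> s"
  proof (cases "it s n = \<zero>")
    case True then show ?thesis by (simp add: it_Suc)
  next
    case False
    then have lt: "it s (n \<oplus> \<one>) \<prec> it s n" by (simp add: it_Suc half_less)
    from IH show ?thesis
    proof
      assume "it s n \<preceq> \<one>" with lt show ?thesis by (intro disjI1) order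
    next
      assume b: "it s n \<oplus> n \<preceq> s"
      from lt have "it s (n \<oplus> \<one>) \<oplus> \<one> \<preceq> it s n" by (simp add: suc_le)
      from add_mono[OF this, of n n] have "it s (n \<oplus> \<one>) \<oplus> (n \<oplus> \<one>) \<preceq> it s n \<oplus> n" by (simp add: add_ac)
      with b show ?thesis by (intro disjI2) order
    qed
  qed
qed

lemma it_self: "it s s \<preceq> \<one>"
proof -
  have "it s s = \<zero>" if "it s s \<oplus> s \<preceq> s"
  proof -
    have "it s s \<oplus> s = \<zero> \<oplus> s" using that le_add(2)[of s "it s s"] unfolding zero_add by order
    then show ?thesis by (simp only: add_cancel)
  qed
  with it_bound[of s s] show ?thesis by (auto simp: le_one_iff)
qed

text \<open>The root has code one. Asking for a value at most one, rather than equal to one, makes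
  the length total: zero, which codes no string, gets length zero.\<close>

definition len_rel :: "'n \<Rightarrow> 'n \<Rightarrow> bool" where
  "len_rel s n \<longleftrightarrow> it s n \<preceq> \<one> \<and> (\<forall>m. m \<prec> n \<longrightarrow> \<not> it s m \<preceq> \<one>)"

definition len :: "'n \<Rightarrow> 'n" where "len s = (THE n. len_rel s n)"

lemma len_rel_iff: "n = len s \<longleftrightarrow> len_rel s n"
proof -
  have "Del (\<lambda>v. it s (v 0) \<preceq> \<one>)" by (intro Del_intros Fn_it)
  from Del_least[of "\<lambda>n. it s n \<preceq> \<one>", OF this it_self] have "\<exists>n. len_rel s n"
    unfolding len_rel_def by blast
  moreover have "n = m" if "len_rel s n" "len_rel s m" for n m
    using that linear unfolding len_rel_def by metis
  ultimately have "\<exists>!n. len_rel s n" by blast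
  from theI'[OF this] this show ?thesis unfolding len_def by blast
qed

lemma Fn_len: "Fn t \<Longrightarrow> Fn (\<lambda>v. len (t v))"
proof -
  have "Fn (\<lambda>v. len (v 0))" unfolding Fn_def len_rel_iff len_rel_def
    by (intro Sig_Del Del_intros Fn_it)
  then show "Fn t \<Longrightarrow> Fn (\<lambda>v. len (t v))" by (rule Fn1)
qed

lemma len_le: "len s \<preceq> s"
  using it_self[of s] len_rel_iff[of "len s" s] unfolding len_rel_def by (metis ord.leI)

lemma len_one [simp]: "len \<one> = \<zero>"
  using len_rel_iff[of \<zero> \<one>] unfolding len_rel_def by (simp add: it_0 basic(7))

lemma len_half:
  assumes "half s \<noteq> \<zero>" shows "len s = len (half s) \<oplus> \<one>"
proof -
  have l: "it (half s) (len (half s)) \<preceq> \<one>" "\<And>m. m \<prec> len (half s) \<Longrightarrow> \<not> it (half s) m \<preceq> \<one>"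
    using len_rel_iff[of "len (half s)" "half s"] unfolding len_rel_def by auto
  have "half \<one> = \<zero>" using half_double(2)[of \<zero>] by (simp add: zero_add)
  then have s: "\<not> s \<preceq> \<one>" using assms by (auto simp: le_one_iff)
  have "\<not> it s m \<preceq> \<one>" if "m \<prec> len (half s) \<oplus> \<one>" for m
  proof (cases "m = \<zero>")
    case True then show ?thesis using s by (simp add: it_0)
  next
    case False
    then obtain k where k: "m = k \<oplus> \<one>" using zero_or_suc by blast
    with that have "k \<prec> len (half s)" by (metis less_suc suc_le)
    then show ?thesis using l(2) by (simp add: k it_Suc')
  qed
  then have "len_rel s (len (half s) \<oplus> \<one>)" using l(1) unfolding len_rel_def it_Suc' by blast
  then show ?thesis using len_rel_iff by metis
qed

lemma len_zero [simp]: "len \<zero> = \<zero>"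
  using len_rel_iff[of \<zero> \<zero>] unfolding len_rel_def by (simp add: it_0 basic(7))

lemma len_0_iff: "len s = \<zero> \<longleftrightarrow> s \<preceq> \<one>"
  using len_rel_iff[of "\<zero>" s] unfolding len_rel_def by (auto simp: it_0 basic(7))

lemma len_Suc:
  assumes "len s = n \<oplus> \<one>" shows "half s \<noteq> \<zero>" "len (half s) = n"
proof -
  show h: "half s \<noteq> \<zero>"
  proof
    assume "half s = \<zero>"
    then have "s \<preceq> \<one>" using half_cases[of s] by (auto simp: zero_add le_one_iff)
    then show False using assms basic(1)[of n] by (simp add: len_0_iff[symmetric])
  qed
  then show "len (half s) = n" using len_half[OF h] assms by simp
qed

text \<open>Bits are numbered from the root: bit \<open>n\<close> is the last bit of the ancestor of
  length \<open>n + 1\<close>, reached by \<open>m\<close> halvings. Extending a string therefore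
  preserves its earlier bits.\<close>

definition bit :: "'n \<Rightarrow> 'n \<Rightarrow> bool" where
  "bit s n \<longleftrightarrow> (\<exists>m. m \<prec> len s \<and> m \<oplus> (n \<oplus> \<one>) = len s \<and> isodd (it s m))"

lemma Del_bit: "Fn t \<Longrightarrow> Fn u \<Longrightarrow> Del (\<lambda>v. bit (t v) (u v))"
  unfolding bit_def by (intro Del_intros Fn_len Del_isodd Fn_it Fn_shift)

lemma bit_last: "len s = n \<oplus> \<one> \<Longrightarrow> bit s n \<longleftrightarrow> isodd s"
proof -
  assume l: "len s = n \<oplus> \<one>"
  have "m \<oplus> (n \<oplus> \<one>) = n \<oplus> \<one> \<longleftrightarrow> m = \<zero>" for m
    using add_cancel[of m "n \<oplus> \<one>" \<zero>] by (simp add: zero_add)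
  moreover have "\<zero> \<prec> n \<oplus> \<one>" by (simp add: less_suc)
  ultimately show ?thesis unfolding bit_def l by (auto simp: it_0)
qed

lemma bit_half:
  assumes "n \<prec> len (half s)" "half s \<noteq> \<zero>" shows "bit s n \<longleftrightarrow> bit (half s) n"
proof
  assume "bit (half s) n"
  then obtain m where "m \<prec> len (half s)" "m \<oplus> (n \<oplus> \<one>) = len (half s)" "isodd (it (half s) m)"
    unfolding bit_def by blast
  moreover from this have "m \<oplus> \<one> \<oplus> (n \<oplus> \<one>) = len (half s) \<oplus> \<one>"
    by (metis add_assoc add_commute)
  ultimately show "bit s n" unfolding bit_def len_half[OF assms(2)]
    by (intro exI[of _ "m \<oplus> \<one>"]) (simp add: it_Suc' less_suc suc_le)
next
  assume "bit s n"
  then obtain m where m: "m \<prec> len s" "m \<oplus> (n \<oplus> \<one>) = len s" "isodd (it s m)"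
    unfolding bit_def by blast
  have "m \<noteq> \<zero>"
  proof
    assume "m = \<zero>"
    with m have "n \<oplus> \<one> = len (half s) \<oplus> \<one>" by (simp add: zero_add len_half[OF assms(2)])
    with assms(1) show False by (simp add: less_irrefl)
  qed
  then obtain k where k: "m = k \<oplus> \<one>" using zero_or_suc by blast
  have "k \<oplus> (n \<oplus> \<one>) \<oplus> \<one> = len (half s) \<oplus> \<one>"
    using m(2) unfolding k len_half[OF assms(2)] by (simp add: add_ac)
  then have e: "k \<oplus> (n \<oplus> \<one>) = len (half s)" by (simp only: add_cancel)
  then have "k \<prec> len (half s)" unfolding less_iff_add by metis
  with e m(3) show "bit (half s) n" unfolding bit_def k it_Suc' by blast
qed

lemma string_ex:
  assumes P: "Del (\<lambda>v. P (v 0))"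
  shows "\<exists>s. s \<noteq> \<zero> \<and> len s = l \<and> (\<forall>n. n \<prec> l \<longrightarrow> (bit s n \<longleftrightarrow> P n))"
proof (rule Sig_induct[where P="\<lambda>l. \<exists>s. s \<noteq> \<zero> \<and> len s = l \<and> (\<forall>n. n \<prec> l \<longrightarrow> (bit s n \<longleftrightarrow> P n))"])
  show "Sig (\<lambda>v. \<exists>s. s \<noteq> \<zero> \<and> len s = v 0 \<and> (\<forall>n. n \<prec> v 0 \<longrightarrow> (bit s n \<longleftrightarrow> P n)))"
    by (intro Sig_ex Sig_Del Del_intros Fn_len Del_bit Del1[of P, OF P])
  show "\<exists>s. s \<noteq> \<zero> \<and> len s = \<zero> \<and> (\<forall>n. n \<prec> \<zero> \<longrightarrow> (bit s n \<longleftrightarrow> P n))"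
    by (intro exI[of _ \<one>]) (simp add: basic(7))
  fix l assume "\<exists>s. s \<noteq> \<zero> \<and> len s = l \<and> (\<forall>n. n \<prec> l \<longrightarrow> (bit s n \<longleftrightarrow> P n))"
  then obtain s where s: "s \<noteq> \<zero>" "len s = l" "\<And>n. n \<prec> l \<Longrightarrow> bit s n \<longleftrightarrow> P n" by blast
  obtain t where t: "half t = s" "isodd t \<longleftrightarrow> P l"
    using half_double isodd_double by (cases "P l") metis+
  have lt: "len t = l \<oplus> \<one>" using len_half[of t] s t by simp
  have "t \<noteq> \<zero>" using t(1) s(1) by auto
  moreover have "bit t n \<longleftrightarrow> P n" if "n \<prec> l \<oplus> \<one>" for n
  proof (cases "n = l")
    case True then show ?thesis using bit_last[OF lt] t(2) by simp
  next
    case False then show ?thesis using bit_half[of n t] t s that by (auto simp: less_suc leq_def)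
  qed
  ultimately show "\<exists>s. s \<noteq> \<zero> \<and> len s = l \<oplus> \<one> \<and> (\<forall>n. n \<prec> l \<oplus> \<one> \<longrightarrow> (bit s n \<longleftrightarrow> P n))"
    using lt by blast
qed

subsection \<open>Weak Koenig's Lemma for strings\<close>

text \<open>Comprehension turns \<open>T\<close> into a tree in \<open>sts M\<close>. A path through
  it has one node of each length, and \<open>Z\<close> lists the last bits of these nodes.\<close>

lemma WKL_strings:
  assumes T: "Del (\<lambda>v. T (v 0))"
    and T0: "\<not> T \<zero>" and T_half: "\<And>s. T s \<Longrightarrow> half s \<noteq> \<zero> \<Longrightarrow> T (half s)"
    and T_inf: "\<And>l. \<exists>s. T s \<and> len s = l"
  obtains Z where "Del (\<lambda>v. Z (v 0))"
    "\<And>l. \<exists>s. T s \<and> len s = l \<and> (\<forall>n. n \<prec> l \<longrightarrow> (bit s n \<longleftrightarrow> Z n))"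
proof -
  obtain A where A: "A \<in> sts M" "\<And>a. mbr M a A \<longleftrightarrow> T a"
    using comprehension[of T] T unfolding Del_def by blast
  have T_parent: "T u" if "T (u \<oplus> u) \<or> T (u \<oplus> u \<oplus> \<one>)" "u \<noteq> \<zero>" for u
    using T_half[of "u \<oplus> u"] T_half[of "u \<oplus> u \<oplus> \<one>"] that by auto
  have "bin_tree M A"
    unfolding bin_tree_def A(2) using T0 T_parent by blast
  moreover have "infinite_set M A"
    unfolding infinite_set_def
  proof
    fix a
    obtain s where s: "T s" "len s = a \<oplus> \<one>" using T_inf by blast
    then have "a \<prec> s" using len_le[of s] by (simp add: suc_le)
    with s A show "\<exists>s\<in>nums M. mbr M s A \<and> a \<prec> s" by auto
  qed
  ultimately obtain B where B: "B \<in> sts M" "is_path M A B"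
    using WKL0 A(1) unfolding WKL0_def WKL_def by blast
  define P where "P s \<longleftrightarrow> mbr M s B" for s
  have DP: "Fn t \<Longrightarrow> Del (\<lambda>v. P (t v))" for t
    unfolding P_def by (rule Del_mem[OF _ B(1)])
  have PT: "P s \<Longrightarrow> T s" and P1: "P \<one>"
    and Pchild: "P s \<Longrightarrow> P (s \<oplus> s) \<longleftrightarrow> \<not> P (s \<oplus> s \<oplus> \<one>)"
    and Phalf': "u \<noteq> \<zero> \<Longrightarrow> P (u \<oplus> u) \<or> P (u \<oplus> u \<oplus> \<one>) \<Longrightarrow> P u" for s u
    using B(2) unfolding is_path_def P_def A(2) by auto
  have Pnz: "P s \<Longrightarrow> s \<noteq> \<zero>" for s using PT T0 by blast
  have Phalf: "P s \<Longrightarrow> half s \<noteq> \<zero> \<Longrightarrow> P (half s)" for s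
    using Phalf'[of "half s"] half_cases[of s] by metis
  have Pex: "\<exists>s. P s \<and> len s = l" for l
  proof (rule Sig_induct[where P="\<lambda>l. \<exists>s. P s \<and> len s = l"])
    show "Sig (\<lambda>v. \<exists>s. P s \<and> len s = v 0)" by (intro Sig_ex Sig_Del Del_intros DP Fn_len)
    show "\<exists>s. P s \<and> len s = \<zero>" using P1 by (intro exI[of _ \<one>]) simp
    fix l assume "\<exists>s. P s \<and> len s = l"
    then obtain s where s: "P s" "len s = l" by blast
    then obtain t where t: "P t" "half t = s" using Pchild half_double by metis
    with s Pnz[OF s(1)] len_half[of t] show "\<exists>s. P s \<and> len s = l \<oplus> \<one>" by auto
  qed
  have Puniq: "s = s'" if "P s" "P s'" "len s = len s'" for s s'
  proof -
    \<comment> \<open>Bounding both nodes keeps the predicate of the induction on the length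
      decidable.\<close>
    obtain b where b: "s \<prec> b" "s' \<prec> b" using bound2 by blast
    have "Del (\<lambda>v. \<forall>s. s \<prec> b \<longrightarrow> (\<forall>s'. s' \<prec> b \<longrightarrow> P s \<and> P s' \<and> len s = v 0 \<and> len s' = v 0 \<longrightarrow> s = s'))"
      by (intro Del_intros DP Fn_len)
    then have "\<forall>s. s \<prec> b \<longrightarrow> (\<forall>s'. s' \<prec> b \<longrightarrow> P s \<and> P s' \<and> len s = l \<and> len s' = l \<longrightarrow> s = s')" for l
    proof (rule Del_induct)
      show "\<forall>s. s \<prec> b \<longrightarrow> (\<forall>s'. s' \<prec> b \<longrightarrow> P s \<and> P s' \<and> len s = \<zero> \<and> len s' = \<zero> \<longrightarrow> s = s')"
        using Pnz by (auto simp: len_0_iff le_one_iff)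
      fix l assume IH: "\<forall>s. s \<prec> b \<longrightarrow> (\<forall>s'. s' \<prec> b \<longrightarrow> P s \<and> P s' \<and> len s = l \<and> len s' = l \<longrightarrow> s = s')"
      show "\<forall>s. s \<prec> b \<longrightarrow> (\<forall>s'. s' \<prec> b \<longrightarrow> P s \<and> P s' \<and> len s = l \<oplus> \<one> \<and> len s' = l \<oplus> \<one> \<longrightarrow> s = s')"
      proof (intro allI impI, elim conjE)
        fix s s' assume h: "s \<prec> b" "s' \<prec> b" "P s" "P s'" "len s = l \<oplus> \<one>" "len s' = l \<oplus> \<one>"
        have "half s \<prec> b" "half s' \<prec> b"
          using half_less[OF Pnz[OF h(3)]] half_less[OF Pnz[OF h(4)]] h(1,2) by order+
        with IH len_Suc[OF h(5)] len_Suc[OF h(6)] Phalf h(3,4) have e: "half s = half s'" by blast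
        have "P (half s)" using Phalf h(3) len_Suc(1)[OF h(5)] by blast
        from Pchild[OF this] show "s = s'"
          using half_cases[of s] half_cases[of s'] h(3,4) unfolding e by metis
      qed
    qed
    with b that show ?thesis by blast
  qed
  define Z where "Z n \<longleftrightarrow> (\<exists>s. P s \<and> len s = n \<oplus> \<one> \<and> isodd s)" for n
  \<comment> \<open>Existence and uniqueness of the node of length \<open>n + 1\<close> make the
    complement of \<open>Z\<close> a \<open>\<Sigma>\<^sub>1\<close> predicate too.\<close>
  have nZ: "\<not> Z n \<longleftrightarrow> (\<exists>s. P s \<and> len s = n \<oplus> \<one> \<and> \<not> isodd s)" for n
    unfolding Z_def using Puniq Pex[of "n \<oplus> \<one>"] by metis
  have DZ: "Del (\<lambda>v. Z (v 0))"
    unfolding Del_def nZ unfolding Z_def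
    by (intro conjI Sig_ex Sig_Del Del_intros DP Fn_len Del_isodd)
  \<comment> \<open>The fixed bound \<open>b\<close> again gives decidability; it persists in the
    induction because parents are smaller.\<close>
  have bits: "\<forall>s. s \<prec> b \<longrightarrow> P s \<and> len s = l \<longrightarrow> (\<forall>n. n \<prec> l \<longrightarrow> (bit s n \<longleftrightarrow> Z n))" for b l
  proof (rule Del_induct[where P="\<lambda>l. \<forall>s. s \<prec> b \<longrightarrow> P s \<and> len s = l \<longrightarrow> (\<forall>n. n \<prec> l \<longrightarrow> (bit s n \<longleftrightarrow> Z n))"])
    show "Del (\<lambda>v. \<forall>s. s \<prec> b \<longrightarrow> P s \<and> len s = v 0 \<longrightarrow> (\<forall>n. n \<prec> v 0 \<longrightarrow> (bit s n \<longleftrightarrow> Z n)))"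
      by (intro Del_intros DP Fn_len Del_bit Del1[of Z, OF DZ])
    fix l assume IH: "\<forall>s. s \<prec> b \<longrightarrow> P s \<and> len s = l \<longrightarrow> (\<forall>n. n \<prec> l \<longrightarrow> (bit s n \<longleftrightarrow> Z n))"
    show "\<forall>s. s \<prec> b \<longrightarrow> P s \<and> len s = l \<oplus> \<one> \<longrightarrow> (\<forall>n. n \<prec> l \<oplus> \<one> \<longrightarrow> (bit s n \<longleftrightarrow> Z n))"
    proof (intro allI impI, elim conjE)
      fix s n assume h: "s \<prec> b" "P s" "len s = l \<oplus> \<one>" "n \<prec> l \<oplus> \<one>"
      show "bit s n \<longleftrightarrow> Z n"
      proof (cases "n = l")
        case True
        then show ?thesis using bit_last[OF h(3)] h(2,3) Puniq unfolding Z_def by metis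
      next
        case False
        note ls = len_Suc[OF h(3)]
        have n: "n \<prec> l" using False h(4) by (auto simp: less_suc leq_def)
        have "half s \<prec> b" using half_less[OF Pnz[OF h(2)]] h(1) by order
        then have "bit (half s) n \<longleftrightarrow> Z n" using IH Phalf[OF h(2) ls(1)] ls(2) n by blast
        then show ?thesis using bit_half[of n s] ls n by simp
      qed
    qed
  qed (simp add: basic(7))
  show ?thesis
  proof (rule that[OF DZ])
    fix l
    obtain s where "P s" "len s = l" using Pex by blast
    with bits[of "s \<oplus> \<one>" l] PT show "\<exists>s. T s \<and> len s = l \<and> (\<forall>n. n \<prec> l \<longrightarrow> (bit s n \<longleftrightarrow> Z n))"
      using less_add_one by blast
  qed
qed

text \<open>In the tree below, the bit at position \<open>pr i c\<close> of a string says
  that \<open>c\<close> is a candidate value at \<open>i\<close> which has not been refuted yet.\<close>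

lemma Pi_choice:
  assumes S: "Sig (\<lambda>v. S (v 0) (v 1))" and a: "Fn (\<lambda>v. a (v 0))"
    and ex: "\<And>i. \<exists>c. c \<preceq> a i \<and> \<not> S i c"
  obtains f where "Fn (\<lambda>v. f (v 0))" "\<And>i. f i \<preceq> a i \<and> \<not> S i (f i)"
proof -
  obtain D where D: "D0 D" and SD: "\<And>v. S (v 0) (v 1) \<longleftrightarrow> (\<exists>z. D (case_nat z v))"
    using S by (auto simp: Sig_def)
  define R where "R d i c \<longleftrightarrow> D (case_nat d (case_nat i (\<lambda>_. c)))" for d i c
  have SR: "S i c \<longleftrightarrow> (\<exists>d. R d i c)" for i c
    using SD[of "case_nat i (\<lambda>_. c)"] by (simp add: R_def)
  have DR: "Del (\<lambda>v. R (t v) (u v) (w v))" if "Fn t" "Fn u" "Fn w" for t u w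
  proof -
    have "Del (\<lambda>v. D (\<lambda>i. case_nat t (case_nat u (\<lambda>_. w)) i v))"
      by (intro Del_D0_subst[OF D] Fn_case that)
    moreover have "(\<lambda>i. case_nat t (case_nat u (\<lambda>_. w)) i v) = case_nat (t v) (case_nat (u v) (\<lambda>_. w v))" for v
      by (auto split: nat.split)
    ultimately show ?thesis by (simp add: R_def)
  qed
  \<comment> \<open>Among the codes \<open>pr i c\<close> with \<open>c \<preceq> a i\<close> the
    largest is \<open>pr i (a i)\<close>. The last clause waits until it lies below the length, when
    all candidates at \<open>i\<close> are visible, and then demands a surviving one.\<close>
  define T where "T s \<longleftrightarrow> s \<noteq> \<zero> \<and>
      (\<forall>i. i \<prec> len s \<longrightarrow> (\<forall>c. c \<prec> len s \<longrightarrow> pr i c \<prec> len s \<and> bit s (pr i c) \<longrightarrow> (\<forall>d. d \<prec> len s \<longrightarrow> \<not> R d i c))) \<and>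
      (\<forall>i. i \<prec> len s \<longrightarrow> pr i (a i) \<prec> len s \<longrightarrow> (\<exists>c. c \<preceq> a i \<and> bit s (pr i c)))" for s
  have DT: "Del (\<lambda>v. T (v 0))"
    unfolding T_def by (intro Del_intros Fn_len Fn_pr Del_bit DR Fn1[OF a])
  have Thalf: "T (half s)" if "T s" and h: "half s \<noteq> \<zero>" for s
  proof -
    note lh = len_half[OF h]
    have less: "n \<prec> len (half s) \<Longrightarrow> n \<prec> len s" for n
      unfolding lh using less_add_one less_trans by blast
    have "bit (half s) n \<Longrightarrow> bit s n" if "n \<prec> len (half s)" for n
      using bit_half[OF that h] by blast
    moreover have "\<exists>c. c \<preceq> a i \<and> bit (half s) (pr i c)" if i: "i \<prec> len (half s)" "pr i (a i) \<prec> len (half s)" for i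
    proof -
      from \<open>T s\<close> less[OF i(1)] less[OF i(2)] obtain c where c: "c \<preceq> a i" "bit s (pr i c)"
        unfolding T_def by blast
      have "pr i c \<prec> len (half s)" using pr_mono[OF c(1), of i] i(2) by order
      then show ?thesis using c bit_half[OF _ h] by blast
    qed
    moreover have "\<not> R d i c" if "i \<prec> len s" "c \<prec> len s" "pr i c \<prec> len s" "bit s (pr i c)" "d \<prec> len s" for i c d
      using \<open>T s\<close> that unfolding T_def by blast
    ultimately show ?thesis unfolding T_def using h less by (intro conjI allI impI; blast?)
  qed
  have Tinf: "\<exists>s. T s \<and> len s = l" for l
  proof -
    \<comment> \<open>A string of length \<open>l\<close> in the tree: mark every pair that is not
      refuted before stage \<open>l\<close>. A true witness is never refuted, so each
      \<open>i\<close> keeps a candidate.\<close>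
    have "Del (\<lambda>v. \<forall>i. i \<preceq> v 0 \<longrightarrow> (\<forall>c. c \<preceq> v 0 \<longrightarrow> v 0 = pr i c \<longrightarrow> (\<forall>d. d \<prec> l \<longrightarrow> \<not> R d i c)))"
      by (intro Del_intros Fn_pr DR)
    from string_ex[of "\<lambda>n. \<forall>i. i \<preceq> n \<longrightarrow> (\<forall>c. c \<preceq> n \<longrightarrow> n = pr i c \<longrightarrow> (\<forall>d. d \<prec> l \<longrightarrow> \<not> R d i c))", OF this, of l]
    obtain s where s: "s \<noteq> \<zero>" "len s = l" "\<And>n. n \<prec> l \<Longrightarrow> bit s n \<longleftrightarrow>
        (\<forall>i. i \<preceq> n \<longrightarrow> (\<forall>c. c \<preceq> n \<longrightarrow> n = pr i c \<longrightarrow> (\<forall>d. d \<prec> l \<longrightarrow> \<not> R d i c)))" by blast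
    have b: "bit s (pr i c) \<longleftrightarrow> (\<forall>d. d \<prec> l \<longrightarrow> \<not> R d i c)" if "pr i c \<prec> l" for i c
      unfolding s(3)[OF that] pr_inj using pr_ge by blast
    have "\<exists>c. c \<preceq> a i \<and> bit s (pr i c)" if "pr i (a i) \<prec> l" for i
    proof -
      from ex[of i] obtain c where c: "c \<preceq> a i" "\<not> S i c" by blast
      have "pr i c \<prec> l" using pr_mono[OF c(1), of i] that by order
      from b[OF this] c show ?thesis unfolding SR by blast
    qed
    then have "T s" unfolding T_def s(2) using s(1) b by blast
    with s(2) show ?thesis by blast
  qed
  have nT: "\<not> T \<zero>" by (simp add: T_def)
  obtain Z where DZ: "Del (\<lambda>v. Z (v 0))"
    and Z: "\<And>l. \<exists>s. T s \<and> len s = l \<and> (\<forall>n. n \<prec> l \<longrightarrow> (bit s n \<longleftrightarrow> Z n))"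
    by (rule WKL_strings[of T, OF DT nT Thalf Tinf]) blast+
  have Zex: "\<exists>c. c \<preceq> a i \<and> Z (pr i c)" for i
  proof -
    obtain s where s: "T s" "len s = pr i (a i) \<oplus> \<one>" "\<And>n. n \<prec> pr i (a i) \<oplus> \<one> \<Longrightarrow> bit s n \<longleftrightarrow> Z n"
      using Z by blast
    have "i \<prec> len s" "pr i (a i) \<prec> len s" using pr_ge(1)[of i "a i"] by (simp_all add: s(2) less_suc)
    with s(1) obtain c where c: "c \<preceq> a i" "bit s (pr i c)" unfolding T_def by blast
    then show ?thesis using s(3) pr_mono[OF c(1), of i] by (auto simp: less_suc)
  qed
  have ZS: "\<not> S i c" if "Z (pr i c)" for i c
  proof
    assume "S i c"
    then obtain d where d: "R d i c" unfolding SR by blast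
    obtain l where l: "pr i c \<prec> l" "d \<prec> l" using bound2 by blast
    obtain s where s: "T s" "len s = l" "\<And>n. n \<prec> l \<Longrightarrow> bit s n \<longleftrightarrow> Z n" using Z by blast
    have "i \<prec> l" "c \<prec> l" using pr_ge[of i c] pr_ge(2)[of c i] l(1) by order+
    with s l d that show False unfolding T_def by blast
  qed
  \<comment> \<open>The path is decidable, so a candidate it keeps can be found by search, and every
    candidate it keeps is correct.\<close>
  have "Sig (\<lambda>v. v 1 \<preceq> a (v 0) \<and> Z (pr (v 0) (v 1)))"
    by (intro Sig_Del Del_intros Del1[of Z, OF DZ] Fn_pr Fn1[OF a])
  from Sig_choice1[of "\<lambda>i c. c \<preceq> a i \<and> Z (pr i c)", OF this Zex]
  obtain f where "Fn (\<lambda>v. f (v 0))" "\<And>i. f i \<preceq> a i \<and> Z (pr i (f i))" by blast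
  with that ZS show ?thesis by blast
qed

end

section \<open>Generic sequences, and induction over the low formula classes\<close>

lemma dense_sequence:
  fixes C :: "('x \<Rightarrow> bool) \<Rightarrow> bool" and \<R> :: "(('x \<Rightarrow> bool) \<Rightarrow> bool) set"
  assumes "countable \<R>" "C A"
    and dense: "\<And>R A. R \<in> \<R> \<Longrightarrow> C A \<Longrightarrow> \<exists>B. C B \<and> B \<le> A \<and> R B"
  obtains As :: "nat \<Rightarrow> 'x \<Rightarrow> bool"
    where "\<And>n. C (As n)" "\<And>n. As (Suc n) \<le> As n" "\<And>R. R \<in> \<R> \<Longrightarrow> \<exists>n. R (As n)"
proof -
  \<comment> \<open>Step \<open>n\<close> meets the requirement with number \<open>n\<close>, as in
    the Rasiowa-Sikorski lemma; a number that names no requirement demands nothing.\<close>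
  let ?Q = "\<lambda>n (A :: 'x \<Rightarrow> bool) B. B \<le> A \<and> (n \<in> to_nat_on \<R> ` \<R> \<longrightarrow> from_nat_into \<R> n B)"
  have "\<exists>B. C B \<and> ?Q n A B" if "C A" for A n
    using dense[OF _ that] that by (cases "n \<in> to_nat_on \<R> ` \<R>") (auto simp: assms(1))
  then have "\<exists>f. \<forall>n. C (f n) \<and> ?Q n (f n) (f (Suc n))"
    using assms(2) by (intro dependent_nat_choice[of "\<lambda>_. C" ?Q]) auto
  then obtain As where "\<forall>n. C (As n) \<and> ?Q n (As n) (As (Suc n))" ..
  then have As: "\<And>n. C (As n)" "\<And>n. ?Q n (As n) (As (Suc n))" by blast+
  have "\<exists>n. R (As n)" if "R \<in> \<R>" for R
    using As(2)[of "to_nat_on \<R> R"] that assms(1) by auto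
  with As show ?thesis by (intro that[of As]) auto
qed

lemma sigma_fm_cases:
  "sigma_fm n \<phi> \<Longrightarrow> delta0 \<phi> \<or> (\<exists>x \<psi> m. \<phi> = Ex x \<psi> \<and> n = Suc m \<and> (pi_fm m \<psi> \<or> sigma_fm n \<psi>))"
  by (erule sigma_fm.cases) auto

lemma pi_fm_cases:
  "pi_fm n \<phi> \<Longrightarrow> delta0 \<phi> \<or> (\<exists>x \<psi> m. \<phi> = Al x \<psi> \<and> n = Suc m \<and> (sigma_fm m \<psi> \<or> pi_fm n \<psi>))"
  by (erule pi_fm.cases) auto

lemma sigma_fm_0: "sigma_fm 0 \<phi> \<Longrightarrow> delta0 \<phi>" and pi_fm_0: "pi_fm 0 \<phi> \<Longrightarrow> delta0 \<phi>"
  using sigma_fm_cases pi_fm_cases by blast+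

text \<open>Level zero contains only bounded formulas, so at level one the mutual hierarchy reduces
  to a block of existential quantifiers in front of a bounded matrix.\<close>

lemma sigma1_induct [consumes 1, case_names delta0 Ex]:
  assumes "sigma_fm 1 \<phi>" and d: "\<And>\<phi>. delta0 \<phi> \<Longrightarrow> P \<phi>"
    and s: "\<And>x \<phi>. sigma_fm 1 \<phi> \<Longrightarrow> P \<phi> \<Longrightarrow> P (Ex x \<phi>)"
  shows "P \<phi>"
  using assms(1)
proof (induction \<phi> rule: fm.induct)
  case (Ex x \<phi>)
  then show ?case using sigma_fm_cases[OF Ex.prems] pi_fm_0 s d s0 by auto
qed (use sigma_fm_cases d in blast)+

lemma pi1_induct [consumes 1, case_names delta0 Al]:
  assumes "pi_fm 1 \<phi>" and d: "\<And>\<phi>. delta0 \<phi> \<Longrightarrow> P \<phi>"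
    and s: "\<And>x \<phi>. pi_fm 1 \<phi> \<Longrightarrow> P \<phi> \<Longrightarrow> P (Al x \<phi>)"
  shows "P \<phi>"
  using assms(1)
proof (induction \<phi> rule: fm.induct)
  case (Al x \<phi>)
  then show ?case using pi_fm_cases[OF Al.prems] sigma_fm_0 s d p0 by auto
qed (use pi_fm_cases d in blast)+

lemma sigma2_induct [consumes 1, case_names pi1 Ex]:
  assumes "sigma_fm 2 \<phi>" and d: "\<And>\<phi>. pi_fm 1 \<phi> \<Longrightarrow> P \<phi>"
    and s: "\<And>x \<phi>. P \<phi> \<Longrightarrow> P (Ex x \<phi>)"
  shows "P \<phi>"
  using assms(1)
proof (induction \<phi> rule: fm.induct)
  case (Ex x \<phi>)
  then show ?case using sigma_fm_cases[OF Ex.prems] s d by (auto simp: numeral_2_eq_2)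
qed (use sigma_fm_cases d p0 in blast)+

context cmod begin

subsection \<open>Generic filters of unbounded decidable sets\<close>

text \<open>Every such predicate is defined by a formula under one fixed enumeration of parameters,
  so formulas alone count the predicates.\<close>

lemma countable_Sig: "countable {P. Sig P}"
proof -
  have "{P. Sig P} \<subseteq> range (\<lambda>\<phi> v. sat M (Ex 2 \<phi>) (mg v) spar)"
  proof
    fix P assume "P \<in> {P. Sig P}"
    then obtain \<phi> where "\<And>v. P v \<longleftrightarrow> sat M (Ex 2 \<phi>) (mg v) spar"
      by (auto elim: Sig_formula)
    then have "P = (\<lambda>v. sat M (Ex 2 \<phi>) (mg v) spar)" by blast
    then show "P \<in> range (\<lambda>\<phi> v. sat M (Ex 2 \<phi>) (mg v) spar)" by blast
  qed
  then show ?thesis by (rule countable_subset) simp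
qed

lemma countable_Sig1: "countable {W. Sig (\<lambda>v. W (v 0))}"
proof (rule countable_subset[OF _ countable_image[OF countable_Sig]])
  show "{W. Sig (\<lambda>v. W (v 0))} \<subseteq> (\<lambda>P a. P (\<lambda>_. a)) ` {P. Sig P}"
  proof
    fix W assume "W \<in> {W. Sig (\<lambda>v. W (v 0))}"
    then show "W \<in> (\<lambda>P a. P (\<lambda>_. a)) ` {P. Sig P}"
      by (intro image_eqI[of _ _ "\<lambda>v. W (v 0)"]) auto
  qed
qed

definition F :: "('n \<Rightarrow> 'n) set" where "F = {f. Fn (\<lambda>v. f (v 0))}"

lemma countable_F: "countable F"
proof (rule countable_subset[OF _ countable_image[OF countable_Sig]])
  show "F \<subseteq> (\<lambda>P i. THE y. P (case_nat y (\<lambda>_. i))) ` {P. Sig P}"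
  proof
    fix f assume "f \<in> F"
    then show "f \<in> (\<lambda>P i. THE y. P (case_nat y (\<lambda>_. i))) ` {P. Sig P}"
      by (intro image_eqI[of _ _ "\<lambda>v. v 0 = f (v 1)"]) (auto simp: F_def Fn_def)
  qed
qed

definition cond :: "('n \<Rightarrow> bool) \<Rightarrow> bool" where
  "cond A \<longleftrightarrow> Del (\<lambda>v. A (v 0)) \<and> (\<forall>b. \<exists>i. b \<prec> i \<and> A i)"

lemma Sig_dense:
  assumes W: "Sig (\<lambda>v. W (v 0))" and A: "cond A"
  shows "\<exists>B. cond B \<and> B \<le> A \<and> ((\<forall>i. B i \<longrightarrow> W i) \<or> (\<forall>i. B i \<longrightarrow> \<not> W i))"
proof (cases "\<forall>b. \<exists>i. b \<prec> i \<and> A i \<and> W i")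
  case False
  then obtain b where b: "\<And>i. b \<prec> i \<Longrightarrow> A i \<Longrightarrow> \<not> W i" by blast
  have "cond (\<lambda>i. b \<prec> i \<and> A i)" unfolding cond_def
  proof (intro conjI allI)
    show "Del (\<lambda>v. b \<prec> v 0 \<and> A (v 0))" using A unfolding cond_def by (intro Del_intros) auto
    fix b'
    obtain c where c: "b \<prec> c" "b' \<prec> c" using bound2 by blast
    from A obtain i where "c \<prec> i" "A i" unfolding cond_def by blast
    with c less_trans show "\<exists>i. b' \<prec> i \<and> b \<prec> i \<and> A i" by blast
  qed
  then show ?thesis using b by (intro exI[of _ "\<lambda>i. b \<prec> i \<and> A i"]) auto
next
  case True
  have "Sig (\<lambda>v. A (v 0) \<and> W (v 0))" using A W unfolding cond_def by (intro Sig_conj) (auto intro: Sig_Del)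
  then obtain D where D: "D0 D" "\<And>v. (A (v 0) \<and> W (v 0)) \<longleftrightarrow> (\<exists>z. D (case_nat z v))"
    by (auto simp: Sig_def)
  define R where "R z i \<longleftrightarrow> D (case_nat z (\<lambda>_. i))" for z i
  have WR: "(A i \<and> W i) \<longleftrightarrow> (\<exists>z. R z i)" for i
    using D(2)[of "\<lambda>_. i"] by (simp add: R_def)
  have DR: "Del (\<lambda>v. R (t v) (u v))" if "Fn t" "Fn u" for t u
  proof -
    have "Del (\<lambda>v. D (\<lambda>i. case_nat t (\<lambda>_. u) i v))"
      by (intro Del_D0_subst[OF D(1)] Fn_case that)
    moreover have "(\<lambda>i. case_nat t (\<lambda>_. u) i v) = case_nat (t v) (\<lambda>_. u v)" for v
      by (auto split: nat.split)
    ultimately show ?thesis by (simp add: R_def)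
  qed
  \<comment> \<open>\<open>E w\<close> is the part of \<open>A \<inter> W\<close> enumerated by stage \<open>w\<close>.  Keeping \<open>i\<close> only if it is enumerated by
    the first stage \<open>w i\<close> that reaches some \<open>j \<ge> i\<close> yields a decidable subset; it is unbounded since
    such a \<open>j\<close> satisfies \<open>w j = w i\<close>.\<close>
  define E where "E w j \<longleftrightarrow> j \<prec> w \<and> (\<exists>z. z \<prec> w \<and> R z j)" for w j
  define H where "H w i \<longleftrightarrow> (\<exists>j. j \<prec> w \<and> i \<preceq> j \<and> E w j)" for w i
  have DE: "Fn t \<Longrightarrow> Fn u \<Longrightarrow> Del (\<lambda>v. E (t v) (u v))" for t u
    unfolding E_def by (intro Del_intros DR Fn_shift)
  have DH: "Fn t \<Longrightarrow> Fn u \<Longrightarrow> Del (\<lambda>v. H (t v) (u v))" for t u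
    unfolding H_def by (intro Del_intros DE Fn_shift)
  have ex: "\<exists>w. H w i \<and> (\<forall>w'. w' \<prec> w \<longrightarrow> \<not> H w' i)" for i
  proof -
    from True obtain j where j: "i \<prec> j" "A j \<and> W j" by blast
    then obtain z where "R z j" unfolding WR by blast
    moreover obtain w where "j \<prec> w" "z \<prec> w" using bound2 by blast
    ultimately have "H w i" using j(1) unfolding H_def E_def leq_def by blast
    moreover have "Del (\<lambda>v. H (v 0) i)" by (intro DH Fn_intros)
    ultimately show ?thesis using Del_least[of "\<lambda>w. H w i"] by blast
  qed
  have "Sig (\<lambda>v. H (v 1) (v 0) \<and> (\<forall>w'. w' \<prec> v 1 \<longrightarrow> \<not> H w' (v 0)))"
    by (intro Sig_Del Del_intros DH)
  from Sig_choice1[of "\<lambda>i w. H w i \<and> (\<forall>w'. w' \<prec> w \<longrightarrow> \<not> H w' i)", OF this ex]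
  obtain w where w: "Fn (\<lambda>v. w (v 0))"
    and w': "\<And>i. H (w i) i \<and> (\<forall>w'. w' \<prec> w i \<longrightarrow> \<not> H w' i)" by blast
  have w: "Fn (\<lambda>v. w (v 0))" "\<And>i. H (w i) i" "\<And>i w'. w' \<prec> w i \<Longrightarrow> \<not> H w' i"
    using w w' by blast+
  have "cond (\<lambda>i. E (w i) i)" unfolding cond_def
  proof (intro conjI allI)
    show "Del (\<lambda>v. E (w (v 0)) (v 0))" by (intro DE w(1) Fn_var)
    fix k
    from w(2)[of "k \<oplus> \<one>"] obtain j where j: "k \<oplus> \<one> \<preceq> j" "E (w (k \<oplus> \<one>)) j"
      unfolding H_def by blast
    have "j \<prec> w (k \<oplus> \<one>)" using j(2) by (simp add: E_def)
    then have "H (w (k \<oplus> \<one>)) j" using j(2) unfolding H_def leq_def by blast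
    moreover have "H (w j) (k \<oplus> \<one>)" using w(2)[of j] j(1) unfolding H_def by (meson ord.order_trans)
    ultimately have "w j = w (k \<oplus> \<one>)" using w(3) linear by blast
    then show "\<exists>i. k \<prec> i \<and> E (w i) i" using j by (auto simp: suc_le)
  qed
  moreover have "A i \<and> W i" if "E (w i) i" for i using that unfolding E_def WR by blast
  ultimately show ?thesis by (intro exI[of _ "\<lambda>i. E (w i) i"]) auto
qed

text \<open>Suppose \<open>f\<close> stays below \<open>m\<close> on a tail of \<open>A\<close> and
  takes each value only boundedly often there. Being a bound for the occurrences of a value is a
  \<open>\<Pi>\<^sub>1\<close> property, so collection gives one bound for all values below
  \<open>m\<close>, and \<open>A\<close> would be bounded.\<close>

lemma pigeonhole_dense:
  assumes f: "f \<in> F" and A: "cond A"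
  shows "\<exists>B. cond B \<and> B \<le> A \<and> ((\<forall>i. B i \<longrightarrow> m \<preceq> f i) \<or> (\<exists>j. \<forall>i. B i \<longrightarrow> f i = j))"
proof -
  note Ff = Fn1[of f, OF f[unfolded F_def, simplified]]
  have DA: "Fn t \<Longrightarrow> Del (\<lambda>v. A (t v))" for t using A Del1[of A] unfolding cond_def by blast
  have c: "cond (\<lambda>i. A i \<and> Q i)" if "\<forall>b. \<exists>i. b \<prec> i \<and> A i \<and> Q i" "Del (\<lambda>v. Q (v 0))" for Q
    using that unfolding cond_def by (intro conjI Del_conj DA Fn_var) auto
  show ?thesis
  proof (cases "\<forall>b. \<exists>i. b \<prec> i \<and> A i \<and> m \<preceq> f i")
    case True
    have "Del (\<lambda>v. m \<preceq> f (v 0))" by (intro Del_intros Ff)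
    from c[OF True this] show ?thesis by (intro exI[of _ "\<lambda>i. A i \<and> m \<preceq> f i"]) auto
  next
    case False
    then obtain b where b: "\<And>i. b \<prec> i \<Longrightarrow> A i \<Longrightarrow> f i \<prec> m" using ord.not_le by blast
    have "\<exists>j. \<forall>b. \<exists>i. b \<prec> i \<and> A i \<and> f i = j"
    proof (rule ccontr)
      assume "\<nexists>j. \<forall>b. \<exists>i. b \<prec> i \<and> A i \<and> f i = j"
      then have no: "\<exists>b. \<not> (\<exists>i. b \<prec> i \<and> A i \<and> f i = j)" for j by blast
      have "Sig (\<lambda>v. \<exists>i. v 1 \<prec> i \<and> A i \<and> f i = v 0)"
        by (intro Sig_ex Sig_Del Del_intros DA Ff)
      from Pi_collection[of "\<lambda>j b. \<exists>i. b \<prec> i \<and> A i \<and> f i = j", OF this no]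
      obtain B where B: "\<And>j. j \<prec> m \<Longrightarrow> \<exists>d. d \<prec> B \<and> \<not> (\<exists>i. d \<prec> i \<and> A i \<and> f i = j)" by blast
      obtain c where c: "b \<prec> c" "B \<prec> c" using bound2 by blast
      from A obtain i where i: "c \<prec> i" "A i" unfolding cond_def by blast
      then have "f i \<prec> m" using b c less_trans by blast
      from B[OF this] i c show False using less_trans by blast
    qed
    then obtain j where j: "\<forall>b. \<exists>i. b \<prec> i \<and> A i \<and> f i = j" by blast
    have "Del (\<lambda>v. f (v 0) = j)" by (intro Del_intros Ff)
    from c[OF j this] show ?thesis by (intro exI[of _ "\<lambda>i. A i \<and> f i = j"]) auto
  qed
qed

lemma generic_sequence:
  obtains As :: "nat \<Rightarrow> 'n \<Rightarrow> bool"
  where "\<And>n. cond (As n)" "\<And>n. As (Suc n) \<le> As n"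
    "\<And>W. Sig (\<lambda>v. W (v 0)) \<Longrightarrow> \<exists>n. (\<forall>i. As n i \<longrightarrow> W i) \<or> (\<forall>i. As n i \<longrightarrow> \<not> W i)"
    "\<And>f m. f \<in> F \<Longrightarrow> \<exists>n. (\<forall>i. As n i \<longrightarrow> m \<preceq> f i) \<or> (\<exists>j. \<forall>i. As n i \<longrightarrow> f i = j)"
proof -
  define \<R> where "\<R> = (\<lambda>W B. (\<forall>i. B i \<longrightarrow> W i) \<or> (\<forall>i. B i \<longrightarrow> \<not> W i)) ` {W. Sig (\<lambda>v. W (v 0))}
    \<union> (\<lambda>(f, m) B. (\<forall>i. B i \<longrightarrow> m \<preceq> f i) \<or> (\<exists>j. \<forall>i. B i \<longrightarrow> f i = j)) ` (F \<times> UNIV)"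
  have c: "countable \<R>" unfolding \<R>_def
    by (intro countable_Un countable_image countable_SIGMA countable_Sig1 countable_F countable_nums)
  have "\<exists>i. b \<prec> i" for b using less_add_one by blast
  then have "cond (\<lambda>_. True)" unfolding cond_def by (simp add: Del_const)
  moreover have "\<exists>B. cond B \<and> B \<le> A \<and> R B" if "R \<in> \<R>" "cond A" for R A
    using that(1) Sig_dense[OF _ that(2)] pigeonhole_dense[OF _ that(2)] unfolding \<R>_def by auto
  ultimately obtain As where As: "\<And>n. cond (As n)" "\<And>n. As (Suc n) \<le> As n" "\<And>R. R \<in> \<R> \<Longrightarrow> \<exists>n. R (As n)"
    using dense_sequence[OF c, of cond] by blast
  show ?thesis
  proof (rule that[of As, OF As(1,2)])
    fix W assume "Sig (\<lambda>v. W (v 0))"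
    then show "\<exists>n. (\<forall>i. As n i \<longrightarrow> W i) \<or> (\<forall>i. As n i \<longrightarrow> \<not> W i)"
      by (intro As(3)) (auto simp: \<R>_def)
  next
    fix f m assume "f \<in> F"
    then have "(\<lambda>(f, m) B. (\<forall>i. B i \<longrightarrow> m \<preceq> f i) \<or> (\<exists>j. \<forall>i. B i \<longrightarrow> f i = j)) (f, m) \<in> \<R>"
      unfolding \<R>_def by blast
    from As(3)[OF this] show "\<exists>n. (\<forall>i. As n i \<longrightarrow> m \<preceq> f i) \<or> (\<exists>j. \<forall>i. As n i \<longrightarrow> f i = j)" by simp
  qed
qed

lemma Sig_upd: "Sig P \<Longrightarrow> Sig (\<lambda>v. P ((\<lambda>i. v (Suc i))(x := v 0)))"
proof -
  have eq: "(\<lambda>i. v (if i = x then 0 else Suc i)) = (\<lambda>i. v (Suc i))(x := v 0)" for v :: "nat \<Rightarrow> 'n"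
    by auto
  show "Sig P \<Longrightarrow> Sig (\<lambda>v. P ((\<lambda>i. v (Suc i))(x := v 0)))"
    using Sig_ren[of P "\<lambda>i. if i = x then 0 else Suc i"] unfolding eq .
qed

lemma Del_sat:
  assumes "\<And>X. E X \<in> sts M" "delta0 \<phi>" shows "Del (\<lambda>v. sat M \<phi> v E)"
  using D0_sat[OF assms] by (rule Del_D0)

lemma Sig_sat:
  assumes "\<And>X. E X \<in> sts M"
  shows "sigma_fm 1 \<phi> \<Longrightarrow> Sig (\<lambda>v. sat M \<phi> v E)"
proof (induction rule: sigma1_induct)
  case (Ex x \<phi>)
  from Sig_ex[of "\<lambda>a v. sat M \<phi> (v(x := a)) E", OF Sig_upd[OF Ex(2)]] show ?case by simp
qed (rule Sig_Del[OF Del_sat[OF assms]])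

lemma Sig_not_sat:
  assumes "\<And>X. E X \<in> sts M"
  shows "pi_fm 1 \<phi> \<Longrightarrow> Sig (\<lambda>v. \<not> sat M \<phi> v E)"
proof (induction rule: pi1_induct)
  case (Al x \<phi>)
  from Sig_ex[of "\<lambda>a v. \<not> sat M \<phi> (v(x := a)) E", OF Sig_upd[OF Al(2)]] show ?case by simp
next
  case (delta0 \<phi>)
  then show ?case using Del_not[OF Del_sat[OF assms]] by (simp add: Sig_Del)
qed

end

section \<open>The generic filter and representatives of its classes\<close>

locale generic = cmod M for M :: "('n, 's) l2str" +
  fixes As :: "nat \<Rightarrow> 'n \<Rightarrow> bool"
  assumes cond_As: "cond (As n)" and dec_As: "As (Suc n) \<le> As n"
    and decide: "Sig (\<lambda>v. W (v 0)) \<Longrightarrow> \<exists>n. (\<forall>i. As n i \<longrightarrow> W i) \<or> (\<forall>i. As n i \<longrightarrow> \<not> W i)"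
    and split: "f \<in> F \<Longrightarrow> \<exists>n. (\<forall>i. As n i \<longrightarrow> m \<preceq> f i) \<or> (\<exists>j. \<forall>i. As n i \<longrightarrow> f i = j)"
begin

text \<open>Defined for arbitrary predicates, for all of which it is a proper filter; that it
  chooses between a predicate and its complement is guaranteed for \<open>\<Sigma>\<^sub>1\<close>
  predicates.\<close>

definition Um :: "('n \<Rightarrow> bool) \<Rightarrow> bool" where
  "Um P \<longleftrightarrow> (\<exists>n. \<forall>i. As n i \<longrightarrow> P i)"

lemma Um_mono: "Um P \<Longrightarrow> (\<And>i. P i \<Longrightarrow> Q i) \<Longrightarrow> Um Q"
  unfolding Um_def by blast

lemma Um_const [simp]: "Um (\<lambda>i. c) \<longleftrightarrow> c"
  using cond_As unfolding Um_def cond_def by blast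

lemma Um_conj: "Um (\<lambda>i. P i \<and> Q i) \<longleftrightarrow> Um P \<and> Um Q"
proof
  assume "Um P \<and> Um Q"
  then obtain n m where nm: "\<And>i. As n i \<Longrightarrow> P i" "\<And>i. As m i \<Longrightarrow> Q i" unfolding Um_def by blast
  have "As (max n m) \<le> As n" "As (max n m) \<le> As m"
    using lift_Suc_antimono_le[of As, OF dec_As] by simp_all
  with nm show "Um (\<lambda>i. P i \<and> Q i)" unfolding Um_def by (intro exI[of _ "max n m"]) auto
qed (auto elim: Um_mono)

lemma Um_mp2: "Um P \<Longrightarrow> Um Q \<Longrightarrow> (\<And>i. P i \<Longrightarrow> Q i \<Longrightarrow> R i) \<Longrightarrow> Um R"
  using Um_conj[of P Q] Um_mono[of "\<lambda>i. P i \<and> Q i" R] by blast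

lemma Um_cong: "Um (\<lambda>i. P i \<longleftrightarrow> Q i) \<Longrightarrow> Um P \<longleftrightarrow> Um Q"
  by (metis (mono_tags, lifting) Um_mp2)

lemma Um_not: "Sig (\<lambda>v. P (v 0)) \<Longrightarrow> Um (\<lambda>i. \<not> P i) \<longleftrightarrow> \<not> Um P"
  using decide[of P] Um_conj[of P "\<lambda>i. \<not> P i"] unfolding Um_def[of P] Um_def[of "\<lambda>i. \<not> P i"] by auto

lemma Um_choice:
  assumes R: "Sig (\<lambda>v. R (v 0) (v 1))" and ex: "Um (\<lambda>i. \<exists>d. R i d)"
  shows "\<exists>f\<in>F. Um (\<lambda>i. R i (f i))"
proof -
  obtain n where n: "\<And>i. As n i \<Longrightarrow> \<exists>d. R i d" using ex unfolding Um_def by blast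
  have "Del (\<lambda>v. As n (v 0))" using cond_As unfolding cond_def by blast
  then have "Sig (\<lambda>v. \<not> As n (v 0) \<or> R (v 0) (v 1))"
    by (intro Sig_disj R Sig_Del Del_not)
  from Sig_choice1[of "\<lambda>i d. \<not> As n i \<or> R i d", OF this] n
  obtain f where "Fn (\<lambda>v. f (v 0))" "\<And>i. \<not> As n i \<or> R i (f i)" by blast
  then show ?thesis unfolding F_def Um_def by blast
qed

text \<open>A class containing a constant function is represented by that constant.  Hence an
  assignment of parameters from \<open>M\<close> and its image in \<open>K\<close> agree at every index, and not only
  for each variable separately up to the filter.\<close>

definition rep :: "('n \<Rightarrow> 'n) \<Rightarrow> 'n \<Rightarrow> 'n" where
  "rep f = (if \<exists>a. Um (\<lambda>i. f i = a) then (\<lambda>_. THE a. Um (\<lambda>i. f i = a))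
     else (SOME g. g \<in> F \<and> Um (\<lambda>i. g i = f i)))"

lemma const_unique: "Um (\<lambda>i. f i = a) \<Longrightarrow> Um (\<lambda>i. f i = b) \<Longrightarrow> a = b"
  using Um_mp2[of "\<lambda>i. f i = a" "\<lambda>i. f i = b" "\<lambda>_. a = b"] by auto

lemma rep_eq_const: "Um (\<lambda>i. f i = a) \<Longrightarrow> rep f = (\<lambda>_. a)"
  unfolding rep_def using const_unique[of f] by auto

lemma rep_const [simp]: "rep (\<lambda>_. a) = (\<lambda>_. a)"
  by (rule rep_eq_const) simp

lemma const_F [simp]: "(\<lambda>_. a) \<in> F"
  by (simp add: F_def Fn_const)

lemma rep_F: "f \<in> F \<Longrightarrow> rep f \<in> F" and rep_eq: "f \<in> F \<Longrightarrow> Um (\<lambda>i. rep f i = f i)"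
proof -
  assume f: "f \<in> F"
  have "rep f \<in> F \<and> Um (\<lambda>i. rep f i = f i)"
  proof (cases "\<exists>a. Um (\<lambda>i. f i = a)")
    case True
    then obtain a where "Um (\<lambda>i. f i = a)" by blast
    then show ?thesis by (simp add: rep_eq_const eq_commute)
  next
    case False
    have "\<exists>g. g \<in> F \<and> Um (\<lambda>i. g i = f i)" using f by (intro exI[of _ f]) simp
    from someI_ex[OF this] False show ?thesis by (simp add: rep_def)
  qed
  then show "rep f \<in> F" "Um (\<lambda>i. rep f i = f i)" by auto
qed

lemma rep_cong: "Um (\<lambda>i. f i = g i) \<Longrightarrow> rep f = rep g"
proof -
  assume fg: "Um (\<lambda>i. f i = g i)"
  have "Um (\<lambda>i. f i = a) \<longleftrightarrow> Um (\<lambda>i. g i = a)" for a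
    by (rule Um_cong) (rule Um_mono[OF fg], simp)
  moreover have "Um (\<lambda>i. h i = f i) \<longleftrightarrow> Um (\<lambda>i. h i = g i)" for h
    by (rule Um_cong) (rule Um_mono[OF fg], simp)
  ultimately show ?thesis unfolding rep_def by simp
qed

subsection \<open>The restricted ultrapower\<close>

text \<open>\<open>Eq\<close> is evaluated as equality of the type. Hence the numbers are chosen
  representatives, and \<open>rep\<close> normalises sums and products.\<close>

definition K :: "('n \<Rightarrow> 'n, 's) l2str" where
  "K = \<lparr>nums = rep ` F, zro = (\<lambda>_. \<zero>), uno = (\<lambda>_. \<one>),
     pls = (\<lambda>f g. rep (\<lambda>i. f i \<oplus> g i)), tms = (\<lambda>f g. rep (\<lambda>i. f i \<otimes> g i)),
     lss = (\<lambda>f g. Um (\<lambda>i. f i \<prec> g i)), sts = sts M, mbr = (\<lambda>f A. Um (\<lambda>i. mbr M (f i) A))\<rparr>"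

lemma K_simps [simp]:
  "zro K = (\<lambda>_. \<zero>)" "uno K = (\<lambda>_. \<one>)" "sts K = sts M"
  "pls K f g = rep (\<lambda>i. f i \<oplus> g i)" "tms K f g = rep (\<lambda>i. f i \<otimes> g i)"
  "lss K f g \<longleftrightarrow> Um (\<lambda>i. f i \<prec> g i)" "mbr K f A \<longleftrightarrow> Um (\<lambda>i. mbr M (f i) A)"
  by (simp_all add: K_def)

lemma nums_K: "nums K = rep ` F" by (simp add: K_def)

lemma nums_K_F: "f \<in> nums K \<Longrightarrow> f \<in> F"
  using rep_F by (auto simp: nums_K)

lemma rep_nums: "f \<in> F \<Longrightarrow> rep f \<in> nums K" by (simp add: nums_K)

lemma const_nums [simp]: "(\<lambda>_. a) \<in> nums K"
  using rep_nums[of "\<lambda>_. a"] by simp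

lemma rep_nums_id: "f \<in> nums K \<Longrightarrow> rep f = f"
  using rep_cong rep_eq by (auto simp: nums_K)

lemma nums_K_eq: "f \<in> nums K \<Longrightarrow> g \<in> nums K \<Longrightarrow> f = g \<longleftrightarrow> Um (\<lambda>i. f i = g i)"
  using rep_cong[of f g] rep_nums_id by auto

lemma F_Fn: "f \<in> F \<Longrightarrow> Fn t \<Longrightarrow> Fn (\<lambda>v. f (t v))"
  unfolding F_def using Fn1[of f] by blast

lemma F_add: "f \<in> F \<Longrightarrow> g \<in> F \<Longrightarrow> (\<lambda>i. f i \<oplus> g i) \<in> F"
  and F_mul: "f \<in> F \<Longrightarrow> g \<in> F \<Longrightarrow> (\<lambda>i. f i \<otimes> g i) \<in> F"
  unfolding F_def by (simp_all add: Fn_add Fn_mul)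

lemma l2_wf_K: "l2_wf K"
  by (simp add: l2_wf_def rep_nums F_add F_mul nums_K_F)

lemma evt_K:
  assumes e: "\<forall>k. e k \<in> nums K"
  shows "evt K t e \<in> nums K \<and> Um (\<lambda>i. evt K t e i = evt M t (\<lambda>k. e k i))"
proof (induction t)
  case (Pl t u)
  then have f: "(\<lambda>i. evt K t e i \<oplus> evt K u e i) \<in> F" by (intro F_add nums_K_F) auto
  have "Um (\<lambda>i. evt K t e i = evt M t (\<lambda>k. e k i) \<and> evt K u e i = evt M u (\<lambda>k. e k i))"
    using Pl by (simp add: Um_conj)
  from Um_mp2[OF this rep_eq[OF f]] show ?case using rep_nums[OF f] by auto
next
  case (Tm t u)
  then have f: "(\<lambda>i. evt K t e i \<otimes> evt K u e i) \<in> F" by (intro F_mul nums_K_F) auto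
  have "Um (\<lambda>i. evt K t e i = evt M t (\<lambda>k. e k i) \<and> evt K u e i = evt M u (\<lambda>k. e k i))"
    using Tm by (simp add: Um_conj)
  from Um_mp2[OF this rep_eq[OF f]] show ?case using rep_nums[OF f] by auto
qed (use e in auto)

lemma upd_at: "(\<lambda>k. (e(x := f)) k i) = (\<lambda>k. e k i)(x := f i)"
  by auto

lemma Sig_sat_at:
  assumes "Sig (\<lambda>v. Q v)" "\<forall>k. e k \<in> nums K"
  shows "Sig (\<lambda>v. Q (\<lambda>k. e k (v 0)))" "Sig (\<lambda>v. Q ((\<lambda>k. e k (v 0))(x := v 1)))"
    "Sig (\<lambda>v. Q ((\<lambda>k. e k (v 0))(x := v 1, y := v 2)))"
proof -
  have e: "Fn (\<lambda>v. e k (v 0))" for k using F_Fn[OF nums_K_F Fn_var] assms(2) by blast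
  show "Sig (\<lambda>v. Q (\<lambda>k. e k (v 0)))" by (rule Sig_subst[OF assms(1)]) (rule e)
  have "Fn (\<lambda>v. ((\<lambda>k. e k (v 0))(x := v 1)) k)" for k
    by (cases "k = x") (simp_all add: e Fn_var)
  from Sig_subst[where s="\<lambda>k v. ((\<lambda>k. e k (v 0))(x := v 1)) k", OF assms(1) this]
  show "Sig (\<lambda>v. Q ((\<lambda>k. e k (v 0))(x := v 1)))" .
  have "Fn (\<lambda>v. ((\<lambda>k. e k (v 0))(x := v 1, y := v 2)) k)" for k
    by (cases "k = x"; cases "k = y") (simp_all add: e Fn_var)
  from Sig_subst[where s="\<lambda>k v. ((\<lambda>k. e k (v 0))(x := v 1, y := v 2)) k", OF assms(1) this]
  show "Sig (\<lambda>v. Q ((\<lambda>k. e k (v 0))(x := v 1, y := v 2)))" .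
qed

text \<open>The existential step of Los's theorem: uniformization turns witnesses at the single
  indices into one element of \<open>K\<close>.\<close>

lemma ex_K:
  assumes R: "Sig (\<lambda>v. R (v 0) (v 1))"
  shows "(\<exists>f\<in>nums K. Um (\<lambda>i. R i (f i))) \<longleftrightarrow> Um (\<lambda>i. \<exists>d. R i d)"
proof
  assume "Um (\<lambda>i. \<exists>d. R i d)"
  from Um_choice[OF R this] obtain f where f: "f \<in> F" "Um (\<lambda>i. R i (f i))" by blast
  from Um_mp2[OF f(2) rep_eq[OF f(1)], of "\<lambda>i. R i (rep f i)"] rep_nums[OF f(1)]
  show "\<exists>f\<in>nums K. Um (\<lambda>i. R i (f i))" by auto
qed (auto elim!: Um_mono)

lemma Los_delta0:
  assumes E: "\<And>X. E X \<in> sts M"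
  shows "delta0 \<phi> \<Longrightarrow> \<forall>k. e k \<in> nums K \<Longrightarrow> sat K \<phi> e E \<longleftrightarrow> Um (\<lambda>i. sat M \<phi> (\<lambda>k. e k i) E)"
proof (induction \<phi> arbitrary: e)
  case (Eq t u)
  note ev = evt_K[OF Eq.prems(2)]
  have "Um (\<lambda>i. (evt K t e i = evt K u e i) \<longleftrightarrow> evt M t (\<lambda>k. e k i) = evt M u (\<lambda>k. e k i))"
    by (rule Um_mp2[OF conjunct2[OF ev[of t]] conjunct2[OF ev[of u]]]) simp
  from Um_cong[OF this] show ?case using nums_K_eq ev by simp
next
  case (Lt t u)
  note ev = evt_K[OF Lt.prems(2)]
  have "Um (\<lambda>i. evt K t e i \<prec> evt K u e i \<longleftrightarrow> evt M t (\<lambda>k. e k i) \<prec> evt M u (\<lambda>k. e k i))"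
    by (rule Um_mp2[OF conjunct2[OF ev[of t]] conjunct2[OF ev[of u]]]) simp
  from Um_cong[OF this] show ?case by simp
next
  case (In t X)
  note ev = evt_K[OF In.prems(2)]
  have "Um (\<lambda>i. mbr M (evt K t e i) (E X) \<longleftrightarrow> mbr M (evt M t (\<lambda>k. e k i)) (E X))"
    by (rule Um_mono[OF conjunct2[OF ev[of t]]]) simp
  from Um_cong[OF this] show ?case by simp
next
  case (Neg \<phi>)
  have S: "Sig (\<lambda>v. sat M \<phi> (\<lambda>k. e k (v 0)) E)"
    using Neg.prems by (intro Sig_sat_at(1) Sig_Del Del_sat E) auto
  show ?case using Um_not[OF S] Neg by simp
next
  case (Cj \<phi> \<psi>)
  then show ?case by (simp add: Um_conj)
next
  case (Dj \<phi> \<psi>)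
  \<comment> \<open>The filter decides both disjuncts and the disjunction, so the latter reduces to
    a conjunction of complements.\<close>
  have S: "Sig (\<lambda>v. sat M \<phi> (\<lambda>k. e k (v 0)) E)" "Sig (\<lambda>v. sat M \<psi> (\<lambda>k. e k (v 0)) E)"
    "Sig (\<lambda>v. sat M (Dj \<phi> \<psi>) (\<lambda>k. e k (v 0)) E)"
    using Dj.prems by (intro Sig_sat_at(1) Sig_Del Del_sat E; simp)+
  show ?case using Um_not[OF S(1)] Um_not[OF S(2)] Um_not[OF S(3)] Dj by (auto simp: Um_conj)
next
  case (Im \<phi> \<psi>)
  have S: "Sig (\<lambda>v. sat M \<phi> (\<lambda>k. e k (v 0)) E)" "Sig (\<lambda>v. sat M \<psi> (\<lambda>k. e k (v 0)) E)"
    "Sig (\<lambda>v. sat M (Im \<phi> \<psi>) (\<lambda>k. e k (v 0)) E)"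
    using Im.prems by (intro Sig_sat_at(1) Sig_Del Del_sat E; simp)+
  show ?case using Um_not[OF S(1)] Um_not[OF S(2)] Um_not[OF S(3)] Im by (auto simp: Um_conj)
next
  case (BEx x t \<phi>)
  note ev = evt_K[OF BEx.prems(2)]
  have IH: "f \<in> nums K \<Longrightarrow> sat K \<phi> (e(x := f)) E \<longleftrightarrow> Um (\<lambda>i. sat M \<phi> ((\<lambda>k. e k i)(x := f i)) E)" for f
    unfolding upd_at[symmetric] using BEx.prems by (intro BEx.IH) auto
  have "Sig (\<lambda>v. sat M \<phi> v E)" using BEx.prems by (intro Sig_Del Del_sat E) simp
  from Sig_sat_at(2)[OF this BEx.prems(2)]
  have R: "Sig (\<lambda>v. v 1 \<prec> evt K t e (v 0) \<and> sat M \<phi> ((\<lambda>k. e k (v 0))(x := v 1)) E)"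
    by (intro Sig_conj Sig_Del[OF Del_less] Fn_var F_Fn[OF nums_K_F[OF conjunct1[OF ev[of t]]]])
  have "sat K (BEx x t \<phi>) e E \<longleftrightarrow> (\<exists>f\<in>nums K. Um (\<lambda>i. f i \<prec> evt K t e i \<and> sat M \<phi> ((\<lambda>k. e k i)(x := f i)) E))"
    by (auto simp: IH Um_conj)
  also have "\<dots> \<longleftrightarrow> Um (\<lambda>i. \<exists>d. d \<prec> evt K t e i \<and> sat M \<phi> ((\<lambda>k. e k i)(x := d)) E)"
    by (rule ex_K[OF R])
  also have "\<dots> \<longleftrightarrow> Um (\<lambda>i. sat M (BEx x t \<phi>) (\<lambda>k. e k i) E)"
    by (rule Um_cong, rule Um_mono[OF conjunct2[OF ev[of t]]]) simp
  finally show ?case .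
next
  case (BAl x t \<phi>)
  note ev = evt_K[OF BAl.prems(2)]
  have D: "Del (\<lambda>v. sat M \<phi> v E)" using BAl.prems by (intro Del_sat E) simp
  have IH: "\<not> sat K \<phi> (e(x := f)) E \<longleftrightarrow> Um (\<lambda>i. \<not> sat M \<phi> ((\<lambda>k. e k i)(x := f i)) E)" if "f \<in> nums K" for f
  proof -
    have e': "\<forall>k. (e(x := f)) k \<in> nums K" using that BAl.prems by simp
    have "sat K \<phi> (e(x := f)) E \<longleftrightarrow> Um (\<lambda>i. sat M \<phi> (\<lambda>k. (e(x := f)) k i) E)"
      using BAl.prems e' by (intro BAl.IH) auto
    with Um_not[OF Sig_sat_at(1)[OF Sig_Del[OF D] e']] show ?thesis unfolding upd_at by blast
  qed
  have R: "Sig (\<lambda>v. v 1 \<prec> evt K t e (v 0) \<and> \<not> sat M \<phi> ((\<lambda>k. e k (v 0))(x := v 1)) E)"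
    using Sig_sat_at(2)[OF Sig_Del[OF Del_not[OF D]] BAl.prems(2)]
    by (intro Sig_conj Sig_Del[OF Del_less] Fn_var F_Fn[OF nums_K_F[OF conjunct1[OF ev[of t]]]])
  \<comment> \<open>A bounded universal quantifier is treated through its negation, to which
    \<open>ex_K\<close> applies; \<open>Um_not\<close> then removes the negations.\<close>
  have "\<not> sat K (BAl x t \<phi>) e E \<longleftrightarrow> (\<exists>f\<in>nums K. Um (\<lambda>i. f i \<prec> evt K t e i \<and> \<not> sat M \<phi> ((\<lambda>k. e k i)(x := f i)) E))"
    by (auto simp: IH Um_conj)
  also have "\<dots> \<longleftrightarrow> Um (\<lambda>i. \<exists>d. d \<prec> evt K t e i \<and> \<not> sat M \<phi> ((\<lambda>k. e k i)(x := d)) E)"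
    by (rule ex_K[OF R])
  also have "\<dots> \<longleftrightarrow> Um (\<lambda>i. \<not> sat M (BAl x t \<phi>) (\<lambda>k. e k i) E)"
    by (rule Um_cong, rule Um_mono[OF conjunct2[OF ev[of t]]]) simp
  also have "\<dots> \<longleftrightarrow> \<not> Um (\<lambda>i. sat M (BAl x t \<phi>) (\<lambda>k. e k i) E)"
    using BAl.prems by (intro Um_not Sig_sat_at(1) Sig_Del Del_sat E) auto
  finally show ?case by blast
qed simp_all

lemma Los_sigma1:
  assumes E: "\<And>X. E X \<in> sts M"
  shows "sigma_fm 1 \<phi> \<Longrightarrow> \<forall>k. e k \<in> nums K \<Longrightarrow> sat K \<phi> e E \<longleftrightarrow> Um (\<lambda>i. sat M \<phi> (\<lambda>k. e k i) E)"
proof (induction arbitrary: e rule: sigma1_induct)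
  case (delta0 \<phi>)
  then show ?case by (intro Los_delta0 E)
next
  case (Ex x \<phi>)
  have IH: "f \<in> nums K \<Longrightarrow> sat K \<phi> (e(x := f)) E \<longleftrightarrow> Um (\<lambda>i. sat M \<phi> ((\<lambda>k. e k i)(x := f i)) E)" for f
    unfolding upd_at[symmetric] using Ex.prems by (intro Ex.IH) auto
  show ?case using ex_K[OF Sig_sat_at(2)[OF Sig_sat[where E=E, OF E Ex.hyps] Ex.prems, of x]] by (simp add: IH del: fun_upd_apply)
qed

text \<open>In this doubly negated form only the \<open>\<Sigma>\<^sub>1\<close> negation stands
  under \<open>Um\<close>, so each universal quantifier is again an instance of
  \<open>ex_K\<close>.\<close>

lemma Los_pi1:
  assumes E: "\<And>X. E X \<in> sts M"
  shows "pi_fm 1 \<phi> \<Longrightarrow> \<forall>k. e k \<in> nums K \<Longrightarrow> sat K \<phi> e E \<longleftrightarrow> \<not> Um (\<lambda>i. \<not> sat M \<phi> (\<lambda>k. e k i) E)"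
proof (induction arbitrary: e rule: pi1_induct)
  case (delta0 \<phi>)
  have "Sig (\<lambda>v. sat M \<phi> (\<lambda>k. e k (v 0)) E)"
    using delta0 by (intro Sig_sat_at(1) Sig_Del Del_sat E) auto
  then show ?case using Los_delta0[of E \<phi> e] Um_not[of "\<lambda>i. sat M \<phi> (\<lambda>k. e k i) E"] delta0 E by simp
next
  case (Al x \<phi>)
  have IH: "f \<in> nums K \<Longrightarrow> sat K \<phi> (e(x := f)) E \<longleftrightarrow> \<not> Um (\<lambda>i. \<not> sat M \<phi> ((\<lambda>k. e k i)(x := f i)) E)" for f
    unfolding upd_at[symmetric] using Al.prems by (intro Al.IH) auto
  show ?case using ex_K[OF Sig_sat_at(2)[OF Sig_not_sat[where E=E, OF E Al.hyps] Al.prems, of x]] by (auto simp: IH simp del: fun_upd_apply)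
qed

text \<open>Only this direction passes existential quantifiers over a \<open>\<Pi>\<^sub>1\<close>
  matrix; the converse would have to choose \<open>\<Pi>\<^sub>1\<close> witnesses. For constant
  assignments the conclusion is just truth in \<open>M\<close>.\<close>

lemma sigma2_down:
  assumes E: "\<And>X. E X \<in> sts M"
  shows "sigma_fm 2 \<phi> \<Longrightarrow> \<forall>k. e k \<in> nums K \<Longrightarrow> sat K \<phi> e E \<Longrightarrow> \<not> Um (\<lambda>i. \<not> sat M \<phi> (\<lambda>k. e k i) E)"
proof (induction arbitrary: e rule: sigma2_induct)
  case (pi1 \<phi>)
  then show ?case using Los_pi1[where E=E, OF E pi1.hyps pi1.prems(1)] by simp
next
  case (Ex x \<phi>)
  then obtain f where f: "f \<in> nums K" "sat K \<phi> (e(x := f)) E" by auto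
  have "\<forall>k. (e(x := f)) k \<in> nums K" using f(1) Ex.prems(1) by simp
  from Ex.IH[OF this f(2)] have "\<not> Um (\<lambda>i. \<not> sat M \<phi> ((\<lambda>k. e k i)(x := f i)) E)"
    unfolding upd_at .
  moreover have "Um (\<lambda>i. \<not> sat M (Ex x \<phi>) (\<lambda>k. e k i) E) \<Longrightarrow> Um (\<lambda>i. \<not> sat M \<phi> ((\<lambda>k. e k i)(x := f i)) E)"
    by (erule Um_mono) (simp del: fun_upd_apply)
  ultimately show ?case by blast
qed

text \<open>Witnesses in \<open>M\<close> are kept as constant functions, on which
  \<open>\<Pi>\<^sub>1\<close> truth in \<open>K\<close> coincides with truth in
  \<open>M\<close>.\<close>

lemma sigma2_up:
  assumes E: "\<And>X. E X \<in> sts M"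
  shows "sigma_fm 2 \<phi> \<Longrightarrow> sat M \<phi> e E \<Longrightarrow> sat K \<phi> (\<lambda>k _. e k) E"
proof (induction arbitrary: e rule: sigma2_induct)
  case (pi1 \<phi>)
  then show ?case using Los_pi1[where E=E, OF E, of \<phi> "\<lambda>k _. e k"] by simp
next
  case (Ex x \<phi>)
  then obtain a where "sat M \<phi> (e(x := a)) E" by auto
  from Ex.IH[OF this] have "sat K \<phi> ((\<lambda>k _. e k)(x := \<lambda>_. a)) E"
    by (rule back_subst[of "\<lambda>e. sat K \<phi> e E"]) auto
  then show ?case by auto
qed

lemma sigma_elem_K: "sigma_elem 2 M K (\<lambda>a _. a)"
  unfolding sigma_elem_def
proof (intro allI impI)
  fix \<phi> e E assume s: "sigma_fm 2 \<phi>" "envs M e E"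
  then have E: "\<And>X. E X \<in> sts M" by (simp add: envs_def)
  show "sat M \<phi> e E \<longleftrightarrow> sat K \<phi> ((\<lambda>a _. a) \<circ> e) E"
    using sigma2_up[where E=E, OF E s(1), of e] sigma2_down[where E=E, OF E s(1), of "\<lambda>k _. e k"] by (auto simp: comp_def)
qed

lemma end_ext_K: "end_ext M K (\<lambda>a _. a)"
  unfolding end_ext_def
proof (intro conjI ballI)
  fix f a assume f: "f \<in> nums K - (\<lambda>a _. a) ` nums M"
  have fF: "f \<in> F" using f nums_K_F by blast
  \<comment> \<open>A class containing a constant is represented by that constant, so a new number
    is constant on no set of the filter; \<open>split\<close> then forces it above every
    bound.\<close>
  have "\<not> Um (\<lambda>i. f i = j)" for j
    using rep_eq_const[of f j] rep_nums_id[of f] f by auto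
  then have "Um (\<lambda>i. a \<oplus> \<one> \<preceq> f i)"
    using split[OF fF, of "a \<oplus> \<one>"] unfolding Um_def by blast
  then show "lss K (\<lambda>_. a) f" by (simp add: suc_le)
qed (auto simp: inj_on_def fun_eq_iff)

text \<open>The identity gives a new number: the sets of the sequence are unbounded, so it is
  constant on none of them.\<close>

lemma proper_K: "nums K \<noteq> (\<lambda>a _. a) ` nums M"
proof
  assume *: "nums K = (\<lambda>a _. a) ` nums M"
  have "(\<lambda>i. i) \<in> F" by (simp add: F_def Fn_var)
  from rep_nums[OF this] rep_eq[OF this] * obtain a where "Um (\<lambda>i. a = i)" by auto
  then obtain n where "\<And>i. As n i \<Longrightarrow> a = i" unfolding Um_def by blast
  then show False using cond_As[of n] less_irrefl unfolding cond_def by metis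
qed

lemma countable_K: "countable (nums K)"
  by (simp add: nums_K countable_F)

lemma BSigma_K: "BSigma 1 K"
  unfolding BSigma_def
proof (intro allI impI ballI)
  fix \<phi> x y e E a
  assume s: "sigma_fm 1 \<phi>" "(x::nat) \<noteq> y" "envs K e E" and a: "a \<in> nums K"
    and h: "\<forall>c\<in>nums K. lss K c a \<longrightarrow> (\<exists>d\<in>nums K. sat K \<phi> (e(x := c, y := d)) E)"
  have E: "\<And>X. E X \<in> sts M" and e: "\<forall>k. e k \<in> nums K" using s(3) by (auto simp: envs_def)
  define R where "R i c d \<longleftrightarrow> sat M \<phi> ((\<lambda>k. e k i)(x := c, y := d)) E" for i c d
  have S: "Sig (\<lambda>v. R (v 0) (v 1) (v 2))"
    unfolding R_def by (rule Sig_sat_at(3)[OF Sig_sat[where E=E, OF E s(1)] e])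
  note SR = Sig3[of R, OF S]
  note aF = F_Fn[OF nums_K_F[OF a]]
  have Los: "sat K \<phi> (e(x := c, y := d)) E \<longleftrightarrow> Um (\<lambda>i. R i (c i) (d i))" if "c \<in> nums K" "d \<in> nums K" for c d
    using Los_sigma1[where E=E, OF E s(1), of "e(x := c, y := d)"] e that unfolding upd_at R_def by auto
  have W: "Sig (\<lambda>v. \<forall>c. c \<prec> a (v 0) \<longrightarrow> (\<exists>d. R (v 0) c d))"
    by (intro Sig_ball Sig_ex SR aF Fn_intros)
  show "\<exists>b\<in>nums K. \<forall>c\<in>nums K. lss K c a \<longrightarrow> (\<exists>d\<in>nums K. lss K d b \<and> sat K \<phi> (e(x := c, y := d)) E)"
  proof (cases "Um (\<lambda>i. \<forall>c. c \<prec> a i \<longrightarrow> (\<exists>d. R i c d))")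
    case True
    have "\<exists>b. \<forall>c. c \<prec> a i \<longrightarrow> (\<exists>d. d \<prec> b \<and> R i c d)" if "\<forall>c. c \<prec> a i \<longrightarrow> (\<exists>d. R i c d)" for i
    proof -
      have "Sig (\<lambda>v. R i (v 0) (v 1))" by (intro SR Fn_intros)
      from Sig_collection[of "R i", OF this] that show ?thesis by blast
    qed
    with True have "Um (\<lambda>i. \<exists>b. \<forall>c. c \<prec> a i \<longrightarrow> (\<exists>d. d \<prec> b \<and> R i c d))" by (rule Um_mono) blast
    moreover have "Sig (\<lambda>v. \<forall>c. c \<prec> a (v 0) \<longrightarrow> (\<exists>d. d \<prec> v 1 \<and> R (v 0) c d))"
      by (intro Sig_ball Sig_bex SR aF Fn_intros)
    ultimately obtain b where b: "b \<in> nums K" "Um (\<lambda>i. \<forall>c. c \<prec> a i \<longrightarrow> (\<exists>d. d \<prec> b i \<and> R i c d))"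
      using ex_K[of "\<lambda>i b. \<forall>c. c \<prec> a i \<longrightarrow> (\<exists>d. d \<prec> b \<and> R i c d)"] by blast
    show ?thesis
    proof (rule bexI[OF _ b(1)], intro ballI impI)
      fix c assume c: "c \<in> nums K" "lss K c a"
      then have "Um (\<lambda>i. c i \<prec> a i)" by simp
      from Um_mp2[OF this b(2), of "\<lambda>i. \<exists>d. d \<prec> b i \<and> R i (c i) d"]
      have "Um (\<lambda>i. \<exists>d. d \<prec> b i \<and> R i (c i) d)" by blast
      moreover have "Sig (\<lambda>v. v 1 \<prec> b (v 0) \<and> R (v 0) (c (v 0)) (v 1))"
        by (intro Sig_conj Sig_Del[OF Del_less] SR Fn_intros F_Fn[OF nums_K_F[OF c(1)]] F_Fn[OF nums_K_F[OF b(1)]])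
      ultimately obtain d where d: "d \<in> nums K" "Um (\<lambda>i. d i \<prec> b i \<and> R i (c i) (d i))"
        using ex_K[of "\<lambda>i d. d \<prec> b i \<and> R i (c i) d"] by blast
      then show "\<exists>d\<in>nums K. lss K d b \<and> sat K \<phi> (e(x := c, y := d)) E"
        using Los[OF c(1) d(1)] by (intro bexI[OF _ d(1)]) (simp add: Um_conj)
    qed
  next
    case False
    then have "Um (\<lambda>i. \<not> (\<forall>c. c \<prec> a i \<longrightarrow> (\<exists>d. R i c d)))" using Um_not[OF W] by blast
    then obtain n where n: "\<And>i. As n i \<Longrightarrow> \<exists>c. c \<prec> a i \<and> (\<forall>d. \<not> R i c d)" unfolding Um_def by blast
    have "Del (\<lambda>v. As n (v 0))" using cond_As unfolding cond_def by blast
    \<comment> \<open>This is the relation to be avoided. \<open>Pi_choice\<close> bounds its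
      function weakly, leaving a value even where \<open>a i\<close> is zero; the disjunct
      \<open>a i \<preceq> c\<close> makes the bound strict on \<open>As n\<close>, and outside
      \<open>As n\<close> nothing is forbidden.\<close>
    then have "Sig (\<lambda>v. As n (v 0) \<and> (a (v 0) \<preceq> v 1 \<or> (\<exists>d. R (v 0) (v 1) d)))"
      by (intro Sig_conj Sig_disj Sig_ex SR Fn_intros Sig_Del[OF Del_leq] aF) (rule Sig_Del)
    moreover have "\<exists>c. c \<preceq> a i \<and> \<not> (As n i \<and> (a i \<preceq> c \<or> (\<exists>d. R i c d)))" for i
      using n[of i] by (metis leq_def ord.not_le)
    ultimately obtain c where c: "Fn (\<lambda>v. c (v 0))"
        "\<And>i. c i \<preceq> a i \<and> \<not> (As n i \<and> (a i \<preceq> c i \<or> (\<exists>d. R i (c i) d)))"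
      using Pi_choice[of "\<lambda>i c. As n i \<and> (a i \<preceq> c \<or> (\<exists>d. R i c d))" a] aF[OF Fn_var] by blast
    have cF: "c \<in> F" using c(1) by (simp add: F_def)
    have "Um (\<lambda>i. c i \<prec> a i \<and> (\<forall>d. \<not> R i (c i) d))"
      unfolding Um_def using c(2) ord.not_le by blast
    from Um_mp2[OF this rep_eq[OF cF], of "\<lambda>i. rep c i \<prec> a i \<and> (\<forall>d. \<not> R i (rep c i) d)"]
    have rc: "Um (\<lambda>i. rep c i \<prec> a i)" "Um (\<lambda>i. \<forall>d. \<not> R i (rep c i) d)" by (auto simp: Um_conj)
    with h rep_nums[OF cF] obtain d where d: "d \<in> nums K" "sat K \<phi> (e(x := rep c, y := d)) E" by auto
    then have "Um (\<lambda>i. R i (rep c i) (d i))" using Los rep_nums[OF cF] by blast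
    from Um_mp2[OF this rc(2), of "\<lambda>_. False"] show ?thesis by auto
  qed
qed

end

section \<open>Assembly and transfer to the original type\<close>

lemma (in cmod) extension_exists:
  "\<exists>(K :: ('n \<Rightarrow> 'n, 's) l2str) h. l2_wf K \<and> end_ext M K h \<and> nums K \<noteq> h ` nums M
      \<and> sigma_elem 2 M K h \<and> BSigma 1 K \<and> countable (nums K)"
proof -
  obtain As :: "nat \<Rightarrow> 'n \<Rightarrow> bool" where As: "generic_axioms M As"
    by (rule generic_sequence, rule that, rule generic_axioms.intro) blast+
  from cmod_axioms As have "generic M As" by (rule generic.intro)
  then interpret generic M As .
  show ?thesis using l2_wf_K end_ext_K proper_K sigma_elem_K BSigma_K countable_K by blast
qed

text \<open>Infinity lets the carrier be copied onto all of \<open>nat\<close> and gives room for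
  the extension in the original type. On a finite carrier the injective successor map would be onto,
  but zero is no successor.\<close>

lemma infinite_nums:
  assumes "l2_wf M" "basic_ax M" shows "infinite (nums M)"
proof
  assume f: "finite (nums M)"
  have "inj_on (\<lambda>a. pls M a (uno M)) (nums M)"
    using assms(2) by (intro inj_onI) (auto simp: basic_ax_def)
  moreover have "(\<lambda>a. pls M a (uno M)) ` nums M \<subseteq> nums M"
    using assms(1) by (auto simp: l2_wf_def)
  ultimately have "(\<lambda>a. pls M a (uno M)) ` nums M = nums M"
    using f endo_inj_surj by blast
  moreover have "zro M \<in> nums M" using assms(1) by (simp add: l2_wf_def)
  ultimately show False using assms(2) by (metis (no_types, lifting) basic_ax_def imageE)
qed

text \<open>Without sets there are no environments, so adding one point at infinity is enough.\<close>

lemma extension_exists_no_sets: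
  fixes M :: "('a, 's) l2str"
  assumes wf: "l2_wf M" and no: "sts M = {}"
  shows "\<exists>(K :: ('a option, 's) l2str) h. l2_wf K \<and> end_ext M K h \<and> nums K \<noteq> h ` nums M
      \<and> sigma_elem 2 M K h \<and> BSigma 1 K"
proof -
  define K where "K = \<lparr>nums = insert None (Some ` nums M), zro = Some (zro M), uno = Some (uno M),
     pls = (\<lambda>a b. case (a, b) of (Some a, Some b) \<Rightarrow> Some (pls M a b) | _ \<Rightarrow> None),
     tms = (\<lambda>a b. case (a, b) of (Some a, Some b) \<Rightarrow> Some (tms M a b) | _ \<Rightarrow> None),
     lss = (\<lambda>a b. case (a, b) of (Some a, Some b) \<Rightarrow> lss M a b | _ \<Rightarrow> True),
     sts = sts M, mbr = (\<lambda>a A. mbr M (the a) A)\<rparr>"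
  have "l2_wf K" "end_ext M K Some" "nums K \<noteq> Some ` nums M"
    using wf by (auto simp: K_def l2_wf_def end_ext_def inj_on_def)
  moreover have "sigma_elem 2 M K Some" "BSigma 1 K"
    using no by (auto simp: K_def sigma_elem_def BSigma_def envs_def)
  ultimately show ?thesis by blast
qed

theorem theorem4p1:
  fixes M :: "('a, 'a set) l2str"
  assumes "countable (nums M)" and "countable (sts M)"
    and "sts M \<subseteq> Pow (nums M)" and "\<forall>a A. mbr M a A = (a \<in> A)"
    and "WKL0 M" and "BSigma 2 M"
  shows "\<exists>(K :: ('a, 'a set) l2str) h. l2_wf K \<and> end_ext M K h \<and> nums K \<noteq> h ` nums M
           \<and> sigma_elem 2 M K h \<and> BSigma 1 K"
proof -
  have wf: "l2_wf M" and ba: "basic_ax M" using assms(5) by (auto simp: WKL0_def RCA0_def)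
  have inf: "infinite (nums M)" by (rule infinite_nums[OF wf ba])
  define j where "j = to_nat_on (nums M)"
  have bij: "bij_betw j (nums M) UNIV" unfolding j_def by (rule to_nat_on_infinite[OF assms(1) inf])
  then have inj: "inj_on j (nums M)" and img: "j ` nums M = UNIV" by (auto simp: bij_betw_def)
  have wf': "l2_wf (push j M)" by (rule l2_wf_push[OF inj wf])
  \<comment> \<open>Whatever type an extension lives on, countability lets it be moved into the type
    of \<open>M\<close> along an injection of the natural numbers.\<close>
  have copy: ?thesis
    if K: "l2_wf K" "end_ext (push j M) K h" "nums K \<noteq> h ` nums (push j M)"
      "sigma_elem 2 (push j M) K h" "BSigma 1 K" "countable (nums K)" for K :: "('b, 'a set) l2str" and h
  proof -
    obtain g :: "nat \<Rightarrow> 'a" where g: "inj g" using infinite_countable_subset[OF inf] by blast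
    have k: "inj_on (g \<circ> to_nat_on (nums K)) (nums K)"
      by (intro comp_inj_on inj_on_to_nat_on K(6) inj_on_subset[OF g]) simp
    show ?thesis
      using extension_push[OF inj wf k K(1,2,4,3)] l2_wf_push[OF k K(1)] BSigma_push[OF k K(1,5)] by blast
  qed
  show ?thesis
  proof (cases "sts M = {}")
    case True
    then have "sts (push j M) = {}" by (simp add: push_simps[OF inj wf])
    from extension_exists_no_sets[OF wf' this] obtain K :: "(nat option, 'a set) l2str" and h
      where "l2_wf K \<and> end_ext (push j M) K h \<and> nums K \<noteq> h ` nums (push j M)
      \<and> sigma_elem 2 (push j M) K h \<and> BSigma 1 K" by blast
    then show ?thesis by (intro copy[of K h]) auto
  next
    case False
    have "cmod (push j M)"
      by unfold_locales
        (simp_all add: push_simps[OF inj wf] img assms(2) False WKL0_push[OF inj wf assms(5)] BSigma_push[OF inj wf assms(6)])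
    then interpret cmod "push j M" .
    from extension_exists show ?thesis using copy by blast
  qed
qed

end
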